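(* Suppose that a simple full vertex operator algebra $F$ satisfies the following conditions: - (PN1) $F_{0,0}=\mathbb C\mathbf 1$; - (PN2) $F_{n,m}=0$ if $n\in\frac12\mathbb Z_{<0}$ or $m\in\frac12\mathbb Z_{<0}$; - (PN3) $L(1)F_{1,n}=0$ and $\bar L(1)F_{n,1}=0$ for any $n\in\mathbb Z$; - (PN4) $L(-1)F_{0,n}=0$ and $\bar L(-1)F_{n,0}=0$ for any $n\in\mathbb Z$. Then $F$ is self-dual and QP-generated.
   Context: **Conventions.** $z,\bar z$ are independent formal variables, $\underline z=(z,\bar z)$, and $|z|$ stands for $z\bar z$ in exponents, so $|z|^r=z^r\bar z^r$. For a vector space $V$, $V[[z,\bar z,|z|^{\mathbb R}]]$ is the set of formal sums $\sum_{r,s\in\mathbb R}a_{r,s}z^r\bar z^s$ with countable support and $a_{r,s}=0$ unless $r-s\in\mathbb Z$; $V((z,\bar z,|z|^{\mathbb R}))$ is the subspace of those for which there is $N$ with $a_{r,s}=0$ unless $r,s\ge N$. **Function spaces.** $F_{0,1,\infty}$ is the space of real analytic functions $f:\mathbb CP^1\setminus\{0,1,\infty\}\to\mathbb C$ with conformal singularities at $0,1,\infty$: for each $\alpha\in\{0,1,\infty\}$ and each holomorphic chart $\chi$ at $\alpha$ with $\chi(\alpha)=0$ there is a series in $\mathbb C((p,\bar p,|p|^{\mathbb R}))$ converging absolutely and compactly to $f\circ\chi^{-1}(p)$ in some punctured disc around $p=0$. For $\chi\in\{p,1/p,1-1/p\}$ ($p$ the standard coordinate) this uniquely determined series is denoted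 $j(\chi,f)$. $\mathrm{GCor}_2$ is the complex span of the functions on $Y_2=\{(z_1,z_2)\in\mathbb C^2: z_1\ne z_2, z_1\ne0,z_2\neq 0\}$ $$\mu=z_1^{\alpha_1}z_2^{\alpha_2}(z_1-z_2)^{\alpha_{12}}\bar z_1^{\beta_1}\bar z_2^{\beta_2}(\bar z_1-\bar z_2)^{\beta_{12}}f(z_2/z_1),$$ $f\in F_{0,1,\infty}$, $\alpha$'s, $\beta$'s real with $\alpha_1-\beta_1,\alpha_2-\beta_2,\alpha_{12}-\beta_{12}\in\mathbb Z$. Its expansions, extended linearly, are: $\mu|_{|z_1|>|z_2|}$: expand $(z_1-z_2)^{\alpha_{12}}(\bar z_1-\bar z_2)^{\beta_{12}}$ binomially in non-negative powers of $z_2/z_1,\bar z_2/\bar z_1$ and replace $f(z_2/z_1)$ by $j(p,f)$ at $p=z_2/z_1$; $\mu|_{|z_2|>|z_1|}$: expand in non-negative powers of $z_1/z_2,\bar z_1/\bar z_2$ (with sign $(-1)^{\alpha_{12}-\beta_{12}}$) and replace $f(z_2/z_1)$ by $j(p^{-1},f)$ at $p=z_1/z_2$; $\mu|_{|z_2|>|z_1-z_2|}$: put $z_1=z_2+z_0$, expand $(z_2+z_0)^{\alpha_1}(\bar z_2+\bar z_0)^{\beta_1}$ in non-negative powers of $z_0/z_2,\bar z_0/\bar z_2$ and replace $f(z_2/z_1)$ by $j(1-p^{-1},f)$ at $p=-z_0/z_2$. **Full vertex algebra.** For $F=\bigoplus_{h,\bar h\in\mathbb R}F_{h,\bar h}$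 put $F^\vee=\bigoplus F_{h,\bar h}^*$. A full vertex algebra is such an $F$ over $\mathbb C$ with $Y(-,\underline z):F\to\mathrm{End}(F)[[z,\bar z,|z|^{\mathbb R}]]$, $Y(a,\underline z)=\sum_{r,s\in\mathbb R}a(r,s)z^{-r-1}\bar z^{-s-1}$, and $\mathbf 1\in F_{0,0}$ such that: (FV1) for all $a,b$ there is $N$ with $a(r,s)b=0$ if $r\ge N$ or $s\ge N$; (FV2) $F_{h,\bar h}=0$ unless $h-\bar h\in\mathbb Z$; (FV3) $Y(a,\underline z)\mathbf 1\in F[[z,\bar z]]$ with constant term $a$; (FV4) $Y(\mathbf 1,\underline z)=\mathrm{id}$; (FV5) for all $a,b,c\in F$, $u\in F^\vee$ there is $\mu\in\mathrm{GCor}_2$ with $u(Y(a,\underline z_1)Y(b,\underline z_2)c)=\mu|_{|z_1|>|z_2|}$, $u(Y(Y(a,\underline z_0)b,\underline z_2)c)=\mu|_{|z_2|>|z_1-z_2|}$ ($z_0=z_1-z_2$), $u(Y(b,\underline z_2)Y(a,\underline z_1)c)=\mu|_{|z_2|>|z_1|}$; (FV6) $F_{h,\bar h}(r,s)F_{h',\bar h'}\subset F_{h+h'-r-1,\bar h+\bar h'-s-1}$. Define $D,\bar D\in\mathrm{End}F$ by $Y(a,\underline z)\mathbf 1=a+Da\,z+\bar Da\,\bar z+\cdots$. An ideal is a subspace $I$ with $Y(a,\underline z)v,\,Y(v,\underline z)a\in I((z,\bar z,|z|^{\mathbb R}))$ for $a\in F,v\in I$; $F$ is simple if its only ideals are $0$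 and $F$. **Full vertex operator algebra.** A full vertex algebra $F$ with $\omega,\bar\omega\in F$, $\bar D\omega=0$, $D\bar\omega=0$, such that $L(n)=\omega(n+1,-1)$ and $\bar L(n)=\bar\omega(-1,n+1)$ satisfy: $[L(n),L(m)]=(n-m)L(n+m)+\frac{n^3-n}{12}\delta_{n+m,0}c$ and $[\bar L(n),\bar L(m)]=(n-m)\bar L(n+m)+\frac{n^3-n}{12}\delta_{n+m,0}\bar c$ for some $c,\bar c\in\mathbb C$; $D=L(-1)$, $\bar D=\bar L(-1)$; $L(0)=h$, $\bar L(0)=\bar h$ on $F_{h,\bar h}$; $\dim F_{h,\bar h}<\infty$; there is $N\in\mathbb R$ with $F_{h,\bar h}=0$ if $h\le N$ or $\bar h\le N$. An invariant bilinear form is a bilinear form with $(Y(a,\underline z)b,c)=(b,Y(S_za,\underline z^{-1})c)$, where $S_za=\exp(zL(1)+\bar z\bar L(1))(-1)^{h-\bar h}z^{-2h}\bar z^{-2\bar h}a$ for $a\in F_{h,\bar h}$. $F$ is self-dual if it has a non-degenerate invariant bilinear form. With $QF_{h,\bar h}=\{v\in F_{h,\bar h}:L(1)v=\bar L(1)v=0\}$ and $QF=\bigoplus QF_{h,\bar h}$, $F$ is QP-generated if $F=\mathbb C[L(-1),\bar L(-1)]QF$. *)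

theory Defs
  imports "HOL-Complex_Analysis.Complex_Analysis" "HOL-Library.Function_Algebras"
begin

section \<open>Formal series with real exponents\<close>

text \<open>
  A family \<open>A :: real \<Rightarrow> real \<Rightarrow> 'b\<close> stands for the formal sum of the \<open>A r s\<close> times
  \<open>z^r zb^s\<close>; a four-index family \<open>A r1 s1 r2 s2\<close> stands for a sum over
  \<open>z1^r1 zb1^s1 z2^r2 zb2^s2\<close>, where \<open>zb\<close> is the variable conjugate to \<open>z\<close>.
  The predicates below are membership in \<open>V[[z,zb,|z|^R]]\<close> and \<open>V((z,zb,|z|^R))\<close>.
\<close>

type_synonym 'b series2 = "real \<Rightarrow> real \<Rightarrow> 'b"
type_synonym 'b series4 = "real \<Rightarrow> real \<Rightarrow> real \<Rightarrow> real \<Rightarrow> 'b"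

definition formal_series :: "'b::zero set \<Rightarrow> 'b series2 \<Rightarrow> bool" where
  "formal_series V A \<longleftrightarrow>
     (\<forall>r s. A r s \<in> V) \<and>
     countable {(r, s). A r s \<noteq> 0} \<and>
     (\<forall>r s. A r s \<noteq> 0 \<longrightarrow> r - s \<in> \<int>)"

definition formal_laurent :: "'b::zero set \<Rightarrow> 'b series2 \<Rightarrow> bool" where
  "formal_laurent V A \<longleftrightarrow>
     formal_series V A \<and> (\<exists>N. \<forall>r s. A r s \<noteq> 0 \<longrightarrow> N \<le> r \<and> N \<le> s)"


section \<open>Functions with conformal singularities\<close>

text \<open>The single-valued function \<open>z^r cnj(z)^s\<close> on nonzero \<open>z\<close>, meaningful for \<open>r - s \<in> \<int>\<close>.\<close>

definition zpow :: "real \<Rightarrow> real \<Rightarrow> complex \<Rightarrow> complex" where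
  "zpow r s z = z powi \<lfloor>r - s\<rfloor> * of_real (norm z powr (2 * s))"

definition real_analytic_at :: "(complex \<Rightarrow> complex) \<Rightarrow> complex \<Rightarrow> bool" where
  "real_analytic_at f p \<longleftrightarrow>
     (\<exists>e>0. \<exists>c :: nat \<Rightarrow> nat \<Rightarrow> complex. \<forall>w. \<bar>Re w\<bar> < e \<and> \<bar>Im w\<bar> < e \<longrightarrow>
        ((\<lambda>(m, n). c m n * of_real (Re w ^ m * Im w ^ n)) has_sum f (p + w)) UNIV)"

definition expands_at_0 :: "(complex \<Rightarrow> complex) \<Rightarrow> complex series2 \<Rightarrow> bool" where
  "expands_at_0 g A \<longleftrightarrow> formal_laurent UNIV A \<and>
     (\<exists>\<rho>>0.
        (\<forall>p \<in> ball 0 \<rho> - {0}. (\<lambda>(r, s). norm (A r s * zpow r s p)) summable_on UNIV) \<and>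
        (\<forall>K. compact K \<and> K \<subseteq> ball 0 \<rho> - {0} \<longrightarrow>
           uniform_limit K (\<lambda>X p. \<Sum>(r, s)\<in>X. A r s * zpow r s p) g
             (finite_subsets_at_top UNIV)))"

text \<open>
  The injective holomorphic functions \<open>\<phi>\<close> are the charts at \<open>\<alpha>\<close>. The radius in
  \<open>expands_at_0\<close> may be taken as small as one likes, so the values of \<open>inv_into U \<phi>\<close>
  off \<open>\<phi> ` U\<close>, and those of \<open>f\<close> at the singularities, play no role.
\<close>

definition conformal_singularity :: "(complex \<Rightarrow> complex) \<Rightarrow> complex \<Rightarrow> bool" where
  "conformal_singularity f \<alpha> \<longleftrightarrow>
     (\<forall>U \<phi>. open U \<and> \<alpha> \<in> U \<and> \<phi> holomorphic_on U \<and> inj_on \<phi> U \<and> \<phi> \<alpha> = 0 \<longrightarrow>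
        (\<exists>A. expands_at_0 (f \<circ> inv_into U \<phi>) A))"

text \<open>
  A function on the projective line minus \<open>0, 1, \<infinity>\<close> is given by its values on
  \<open>- {0, 1} :: complex set\<close>. Charts at \<open>\<infinity>\<close> are charts at \<open>0\<close> composed with \<open>1/p\<close>.
\<close>

definition F_01inf :: "(complex \<Rightarrow> complex) set" where
  "F_01inf = {f. (\<forall>p \<in> - {0, 1}. real_analytic_at f p) \<and>
     conformal_singularity f 0 \<and> conformal_singularity f 1 \<and>
     conformal_singularity (\<lambda>w. f (1 / w)) 0}"

text \<open>
  \<open>j(\<phi>, f)\<close> is the unique expansion of \<open>f \<circ> \<phi>\<inverse>\<close>. It is rendered as a relation; the inverses
  of the charts \<open>p\<close>, \<open>1/p\<close>, \<open>1 - 1/p\<close> are \<open>p\<close>, \<open>1/p\<close>, \<open>1/(1 - p)\<close>.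
\<close>

definition j_0 :: "(complex \<Rightarrow> complex) \<Rightarrow> complex series2 \<Rightarrow> bool" where
  "j_0 f A \<longleftrightarrow> expands_at_0 f A"

definition j_inf :: "(complex \<Rightarrow> complex) \<Rightarrow> complex series2 \<Rightarrow> bool" where
  "j_inf f A \<longleftrightarrow> expands_at_0 (\<lambda>p. f (1 / p)) A"

definition j_1 :: "(complex \<Rightarrow> complex) \<Rightarrow> complex series2 \<Rightarrow> bool" where
  "j_1 f A \<longleftrightarrow> expands_at_0 (\<lambda>p. f (1 / (1 - p))) A"


section \<open>Generalized two-point correlation functions and their expansions\<close>

text \<open>
  The coefficients of \<open>(1 - p)^\<alpha> (1 - pb)^\<beta> A(p, pb)\<close>, both powers expanded in
  non-negative powers of \<open>p\<close>, \<open>pb\<close>. For \<open>A\<close> in \<open>\<complex>((p,pb,|p|^R))\<close> the sum is finite.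
\<close>

definition binom_mult :: "real \<Rightarrow> real \<Rightarrow> complex series2 \<Rightarrow> complex series2" where
  "binom_mult \<alpha> \<beta> A r s =
     (\<Sum>(k, l) | A (r - real k) (s - real l) \<noteq> 0.
        of_real ((-1) ^ k * (\<alpha> gchoose k) * ((-1) ^ l * (\<beta> gchoose l)))
          * A (r - real k) (s - real l))"

definition gcor2_fun ::
  "real \<Rightarrow> real \<Rightarrow> real \<Rightarrow> real \<Rightarrow> real \<Rightarrow> real \<Rightarrow> (complex \<Rightarrow> complex) \<Rightarrow> complex \<Rightarrow> complex \<Rightarrow> complex"
where
  "gcor2_fun \<alpha>1 \<alpha>2 \<alpha>12 \<beta>1 \<beta>2 \<beta>12 f z1 z2 =
     (if z1 \<noteq> z2 \<and> z1 \<noteq> 0 \<and> z2 \<noteq> 0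
      then zpow \<alpha>1 \<beta>1 z1 * zpow \<alpha>2 \<beta>2 z2 * zpow \<alpha>12 \<beta>12 (z1 - z2) * f (z2 / z1)
      else 0)"

text \<open>
  With \<open>p = z2/z1\<close>, the product of the powers is
  \<open>z1^(\<alpha>1 + \<alpha>12) z2^\<alpha>2 (1 - p)^\<alpha>12\<close> times its conjugate analogue.
\<close>

definition expand_12 ::
  "real \<Rightarrow> real \<Rightarrow> real \<Rightarrow> real \<Rightarrow> real \<Rightarrow> real \<Rightarrow> complex series2 \<Rightarrow> complex series4"
where
  "expand_12 \<alpha>1 \<alpha>2 \<alpha>12 \<beta>1 \<beta>2 \<beta>12 A r1 s1 r2 s2 =
     (if r1 + r2 = \<alpha>1 + \<alpha>2 + \<alpha>12 \<and> s1 + s2 = \<beta>1 + \<beta>2 + \<beta>12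
      then binom_mult \<alpha>12 \<beta>12 A (r2 - \<alpha>2) (s2 - \<beta>2)
      else 0)"

text \<open>
  With \<open>p = z1/z2\<close>, the product of the powers is \<open>(-1)^(\<alpha>12 - \<beta>12)\<close> times
  \<open>z1^\<alpha>1 z2^(\<alpha>2 + \<alpha>12) (1 - p)^\<alpha>12\<close> times its conjugate analogue.
\<close>

definition expand_21 ::
  "real \<Rightarrow> real \<Rightarrow> real \<Rightarrow> real \<Rightarrow> real \<Rightarrow> real \<Rightarrow> complex series2 \<Rightarrow> complex series4"
where
  "expand_21 \<alpha>1 \<alpha>2 \<alpha>12 \<beta>1 \<beta>2 \<beta>12 A r1 s1 r2 s2 =
     (if r1 + r2 = \<alpha>1 + \<alpha>2 + \<alpha>12 \<and> s1 + s2 = \<beta>1 + \<beta>2 + \<beta>12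
      then (-1) powi \<lfloor>\<alpha>12 - \<beta>12\<rfloor> * binom_mult \<alpha>12 \<beta>12 A (r1 - \<alpha>1) (s1 - \<beta>1)
      else 0)"

text \<open>
  Here the first two exponents belong to \<open>z0, zb0\<close>. With \<open>p = -z0/z2\<close>, the product of the
  powers is \<open>z0^\<alpha>12 z2^(\<alpha>1 + \<alpha>2) (1 - p)^\<alpha>1\<close> times its conjugate analogue, and
  \<open>p^r pb^s = (-1)^(r - s) (z0/z2)^r (zb0/zb2)^s\<close>.
\<close>

definition expand_02 ::
  "real \<Rightarrow> real \<Rightarrow> real \<Rightarrow> real \<Rightarrow> real \<Rightarrow> real \<Rightarrow> complex series2 \<Rightarrow> complex series4"
where
  "expand_02 \<alpha>1 \<alpha>2 \<alpha>12 \<beta>1 \<beta>2 \<beta>12 A r0 s0 r2 s2 =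
     (if r0 + r2 = \<alpha>1 + \<alpha>2 + \<alpha>12 \<and> s0 + s2 = \<beta>1 + \<beta>2 + \<beta>12
      then (-1) powi \<lfloor>(r0 - \<alpha>12) - (s0 - \<beta>12)\<rfloor>
             * binom_mult \<alpha>1 \<beta>1 A (r0 - \<alpha>12) (s0 - \<beta>12)
      else 0)"

text \<open>
  \<open>GCor2 \<mu> E12 E02 E21\<close>: the function \<open>\<mu>\<close> lies in the complex span of the functions
  \<open>gcor2_fun\<close>, and \<open>E12\<close>, \<open>E02\<close>, \<open>E21\<close> are its linearly extended expansions in
  \<open>|z1| > |z2|\<close>, \<open>|z2| > |z1 - z2|\<close>, \<open>|z2| > |z1|\<close>.
\<close>

inductive GCor2 ::
  "(complex \<Rightarrow> complex \<Rightarrow> complex) \<Rightarrow> complex series4 \<Rightarrow> complex series4 \<Rightarrow> complex series4 \<Rightarrow> bool"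
where
  generator:
    "\<lbrakk>f \<in> F_01inf; \<alpha>1 - \<beta>1 \<in> \<int>; \<alpha>2 - \<beta>2 \<in> \<int>; \<alpha>12 - \<beta>12 \<in> \<int>; j_0 f A; j_1 f B; j_inf f C\<rbrakk>
     \<Longrightarrow> GCor2 (gcor2_fun \<alpha>1 \<alpha>2 \<alpha>12 \<beta>1 \<beta>2 \<beta>12 f)
          (expand_12 \<alpha>1 \<alpha>2 \<alpha>12 \<beta>1 \<beta>2 \<beta>12 A)
          (expand_02 \<alpha>1 \<alpha>2 \<alpha>12 \<beta>1 \<beta>2 \<beta>12 B)
          (expand_21 \<alpha>1 \<alpha>2 \<alpha>12 \<beta>1 \<beta>2 \<beta>12 C)"
| add:
    "\<lbrakk>GCor2 \<mu> E12 E02 E21; GCor2 \<mu>' E12' E02' E21'\<rbrakk>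
     \<Longrightarrow> GCor2 (\<lambda>z1 z2. \<mu> z1 z2 + \<mu>' z1 z2)
          (\<lambda>r1 s1 r2 s2. E12 r1 s1 r2 s2 + E12' r1 s1 r2 s2)
          (\<lambda>r0 s0 r2 s2. E02 r0 s0 r2 s2 + E02' r0 s0 r2 s2)
          (\<lambda>r1 s1 r2 s2. E21 r1 s1 r2 s2 + E21' r1 s1 r2 s2)"
| scale:
    "GCor2 \<mu> E12 E02 E21
     \<Longrightarrow> GCor2 (\<lambda>z1 z2. k * \<mu> z1 z2)
          (\<lambda>r1 s1 r2 s2. k * E12 r1 s1 r2 s2)
          (\<lambda>r0 s0 r2 s2. k * E02 r0 s0 r2 s2)
          (\<lambda>r1 s1 r2 s2. k * E21 r1 s1 r2 s2)"


section \<open>Full vertex algebras\<close>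

text \<open>
  \<open>Y a r s b\<close> is \<open>a(r,s) b\<close>, so the coefficient of \<open>z^r zb^s\<close> in \<open>Y(a,z) b\<close> is
  \<open>Y a (-r-1) (-s-1) b\<close>. The space is all of \<open>'a\<close>, and \<open>F h hb\<close> is its component of
  weight \<open>(h, hb)\<close>.
\<close>

type_synonym 'a vertex_op = "'a \<Rightarrow> real \<Rightarrow> real \<Rightarrow> 'a \<Rightarrow> 'a"

definition graded_by ::
  "(complex \<Rightarrow> 'a \<Rightarrow> 'a) \<Rightarrow> (real \<Rightarrow> real \<Rightarrow> 'a::ab_group_add set) \<Rightarrow> bool" where
  "graded_by sc F \<longleftrightarrow>
     (\<forall>h hb. module.subspace sc (F h hb)) \<and>
     (\<forall>v. \<exists>!c. (\<forall>h hb. c (h, hb) \<in> F h hb) \<and> finite {x. c x \<noteq> 0} \<and> v = sum c {x. c x \<noteq> 0})"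

text \<open>The direct sum of the dual spaces of the homogeneous components.\<close>

definition restricted_dual ::
  "(complex \<Rightarrow> 'a \<Rightarrow> 'a) \<Rightarrow> (real \<Rightarrow> real \<Rightarrow> 'a::ab_group_add set) \<Rightarrow> ('a \<Rightarrow> complex) set" where
  "restricted_dual sc F =
     {u. Vector_Spaces.linear sc (*) u \<and> finite {(h, hb). \<exists>v \<in> F h hb. u v \<noteq> 0}}"

definition D_op :: "'a vertex_op \<Rightarrow> 'a \<Rightarrow> 'a \<Rightarrow> 'a" where
  "D_op Y vac a = Y a (-2) (-1) vac"

definition Dbar_op :: "'a vertex_op \<Rightarrow> 'a \<Rightarrow> 'a \<Rightarrow> 'a" where
  "Dbar_op Y vac a = Y a (-1) (-2) vac"

locale full_vertex_algebra = vector_space sc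
  for sc :: "complex \<Rightarrow> 'a::ab_group_add \<Rightarrow> 'a" +
  fixes F :: "real \<Rightarrow> real \<Rightarrow> 'a set"
    and Y :: "'a vertex_op"
    and vac :: 'a
  assumes grading: "graded_by sc F"
    and Y_linear: "Vector_Spaces.linear sc sc (\<lambda>a. Y a r s b)"
    and Y_series: "formal_series {T. Vector_Spaces.linear sc sc T}
                     (\<lambda>r s. Y a (- r - 1) (- s - 1))"
    and vac_weight: "vac \<in> F 0 0"
    and FV1: "\<exists>N. \<forall>r s. r \<ge> N \<or> s \<ge> N \<longrightarrow> Y a r s b = 0"
    and FV2: "h - hb \<notin> \<int> \<Longrightarrow> F h hb = {0}"
    and FV3_series: "\<not> (- r - 1 \<in> \<nat> \<and> - s - 1 \<in> \<nat>) \<Longrightarrow> Y a r s vac = 0"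
    and FV3_const: "Y a (-1) (-1) vac = a"
    and FV4: "Y vac r s a = (if r = -1 \<and> s = -1 then a else 0)"
    and FV5: "u \<in> restricted_dual sc F \<Longrightarrow>
       \<exists>\<mu>. GCor2 \<mu>
         (\<lambda>r1 s1 r2 s2. u (Y a (- r1 - 1) (- s1 - 1) (Y b (- r2 - 1) (- s2 - 1) c)))
         (\<lambda>r0 s0 r2 s2. u (Y (Y a (- r0 - 1) (- s0 - 1) b) (- r2 - 1) (- s2 - 1) c))
         (\<lambda>r1 s1 r2 s2. u (Y b (- r2 - 1) (- s2 - 1) (Y a (- r1 - 1) (- s1 - 1) c)))"
    and FV6: "\<lbrakk>a \<in> F h hb; b \<in> F h' hb'\<rbrakk> \<Longrightarrow> Y a r s b \<in> F (h + h' - r - 1) (hb + hb' - s - 1)"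
begin

definition ideal :: "'a set \<Rightarrow> bool" where
  "ideal I \<longleftrightarrow> subspace I \<and>
     (\<forall>a. \<forall>v \<in> I. formal_laurent I (\<lambda>r s. Y a (- r - 1) (- s - 1) v) \<and>
                  formal_laurent I (\<lambda>r s. Y v (- r - 1) (- s - 1) a))"

definition simple :: bool where
  "simple \<longleftrightarrow> (\<forall>I. ideal I \<longrightarrow> I = {0} \<or> I = UNIV)"

end


section \<open>Full vertex operator algebras\<close>

definition L_op :: "'a vertex_op \<Rightarrow> 'a \<Rightarrow> int \<Rightarrow> 'a \<Rightarrow> 'a" where
  "L_op Y \<omega> n = Y \<omega> (of_int n + 1) (-1)"

definition Lbar_op :: "'a vertex_op \<Rightarrow> 'a \<Rightarrow> int \<Rightarrow> 'a \<Rightarrow> 'a" where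
  "Lbar_op Y \<omega>b n = Y \<omega>b (-1) (of_int n + 1)"

definition virasoro ::
  "(complex \<Rightarrow> 'a::ab_group_add \<Rightarrow> 'a) \<Rightarrow> complex \<Rightarrow> (int \<Rightarrow> 'a \<Rightarrow> 'a) \<Rightarrow> bool" where
  "virasoro sc c T \<longleftrightarrow>
     (\<forall>n m v. T n (T m v) - T m (T n v) =
        sc (of_int (n - m)) (T (n + m) v) +
        sc (of_int (n ^ 3 - n) / 12 * (if n + m = 0 then 1 else 0) * c) v)"

locale full_vertex_operator_algebra = full_vertex_algebra sc F Y vac
  for sc :: "complex \<Rightarrow> 'a::ab_group_add \<Rightarrow> 'a"
    and F :: "real \<Rightarrow> real \<Rightarrow> 'a set"
    and Y :: "'a vertex_op"
    and vac :: 'a +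
  fixes \<omega> \<omega>b :: 'a
  assumes Dbar_omega: "Dbar_op Y vac \<omega> = 0"
    and D_omegab: "D_op Y vac \<omega>b = 0"
    and virasoro_L: "\<exists>c. virasoro sc c (L_op Y \<omega>)"
    and virasoro_Lbar: "\<exists>c. virasoro sc c (Lbar_op Y \<omega>b)"
    and D_eq: "D_op Y vac = L_op Y \<omega> (-1)"
    and Dbar_eq: "Dbar_op Y vac = Lbar_op Y \<omega>b (-1)"
    and L0: "v \<in> F h hb \<Longrightarrow> L_op Y \<omega> 0 v = sc (of_real h) v"
    and Lbar0: "v \<in> F h hb \<Longrightarrow> Lbar_op Y \<omega>b 0 v = sc (of_real hb) v"
    and finite_dim: "\<exists>B. finite B \<and> F h hb = span B"
    and bounded_below: "\<exists>N::real. \<forall>h hb. h \<le> N \<or> hb \<le> N \<longrightarrow> F h hb = {0}"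
begin

abbreviation L :: "int \<Rightarrow> 'a \<Rightarrow> 'a" where "L \<equiv> L_op Y \<omega>"
abbreviation Lbar :: "int \<Rightarrow> 'a \<Rightarrow> 'a" where "Lbar \<equiv> Lbar_op Y \<omega>b"

text \<open>
  \<open>L1_pow m n\<close> is the coefficient of \<open>z^m zb^n\<close> in \<open>(z L(1) + zb Lbar(1))^(m+n)\<close>, so that
  \<open>L1_exp m n\<close> is the coefficient of \<open>z^m zb^n\<close> in \<open>exp(z L(1) + zb Lbar(1))\<close>.
\<close>

fun L1_pow :: "nat \<Rightarrow> nat \<Rightarrow> 'a \<Rightarrow> 'a" where
  "L1_pow 0 0 v = v"
| "L1_pow (Suc m) 0 v = L 1 (L1_pow m 0 v)"
| "L1_pow 0 (Suc n) v = Lbar 1 (L1_pow 0 n v)"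
| "L1_pow (Suc m) (Suc n) v = L 1 (L1_pow m (Suc n) v) + Lbar 1 (L1_pow (Suc m) n v)"

definition L1_exp :: "nat \<Rightarrow> nat \<Rightarrow> 'a \<Rightarrow> 'a" where
  "L1_exp m n v = sc (1 / fact (m + n)) (L1_pow m n v)"

definition bilinear_form :: "('a \<Rightarrow> 'a \<Rightarrow> complex) \<Rightarrow> bool" where
  "bilinear_form B \<longleftrightarrow>
     (\<forall>b. Vector_Spaces.linear sc (*) (\<lambda>a. B a b)) \<and>
     (\<forall>a. Vector_Spaces.linear sc (*) (B a))"

text \<open>
  Comparison of the coefficients of \<open>z^r zb^s\<close> in \<open>(Y(a,z) b, c) = (b, Y(S_z a, z\<inverse>) c)\<close>.
  For \<open>a \<in> F h hb\<close>, the series \<open>Y(S_z a, z\<inverse>)\<close> is the sum over \<open>m, n \<ge> 0\<close> and \<open>k, l\<close> of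
  \<open>(-1)^(h - hb) (L1_exp m n a)(k,l) z^(m - 2h + k + 1) zb^(n - 2hb + l + 1)\<close>.
  Only finitely many \<open>L1_exp m n a\<close> are nonzero, as the weights are bounded below.
\<close>

definition invariant :: "('a \<Rightarrow> 'a \<Rightarrow> complex) \<Rightarrow> bool" where
  "invariant B \<longleftrightarrow>
     (\<forall>h hb. \<forall>a \<in> F h hb. \<forall>b c r s.
        B (Y a (- r - 1) (- s - 1) b) c =
        (\<Sum>(m, n) | L1_exp m n a \<noteq> 0.
           (-1) powi \<lfloor>h - hb\<rfloor> *
           B b (Y (L1_exp m n a) (r - real m + 2 * h - 1) (s - real n + 2 * hb - 1) c)))"

definition nondegenerate :: "('a \<Rightarrow> 'a \<Rightarrow> complex) \<Rightarrow> bool" where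
  "nondegenerate B \<longleftrightarrow>
     (\<forall>a. (\<forall>b. B a b = 0) \<longrightarrow> a = 0) \<and> (\<forall>b. (\<forall>a. B a b = 0) \<longrightarrow> b = 0)"

definition self_dual :: bool where
  "self_dual \<longleftrightarrow> (\<exists>B. bilinear_form B \<and> invariant B \<and> nondegenerate B)"

definition QF_comp :: "real \<Rightarrow> real \<Rightarrow> 'a set" where
  "QF_comp h hb = {v \<in> F h hb. L 1 v = 0 \<and> Lbar 1 v = 0}"

definition QF :: "'a set" where
  "QF = span (\<Union>h hb. QF_comp h hb)"

definition QP_generated :: bool where
  "QP_generated \<longleftrightarrow>
     span {(L (-1) ^^ m) ((Lbar (-1) ^^ n) v) | m n v. v \<in> QF} = UNIV"

end

end

theory Submission imports Defs begin

text \<open>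
  Under the hypotheses, \<open>L(1)\<close> vanishes between the weights \<open>1\<close> and \<open>0\<close>, which is the only place where
  an \<open>sl2\<close>-module with weights in the admissible range can fail to be generated by its lowest weight
  vectors; applied to both copies of \<open>sl2\<close> this gives QP-generation.

  Let \<open>\<theta>\<close> be the projection to \<open>F 0 0 = \<complex> vac\<close>. It is annihilated by \<open>L(1)\<close>, \<open>L(-1)\<close> and their conjugates,
  and \<open>(x, y) = \<theta> (R x y)\<close>, where \<open>R x\<close> is the constant term of \<open>Y(S_z x, 1/z)\<close>, is contravariant for both
  copies of \<open>sl2\<close>. By contravariance and QP-generation, invariance need only be checked on quasi-primary
  vectors, for which it compares coefficients of three-point functions \<open>\<theta>(Y(a,z1) Y(b,z2) c)\<close>.
  The Ward identities determine each expansion of such a function up to a constant, and the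
  identity theorem for real analytic functions on \<open>\<complex> - {0,1}\<close> relates the three constants.
  The radical of the form is an ideal not containing the vacuum, hence zero.
\<close>

section \<open>Powers and real analytic functions\<close>

text \<open>Modes carry real indices and correlators are only real analytic, so identities cannot be
  read off from formal delta functions. They are read off from a function \<open>g\<close> on
  \<open>- {0, 1}\<close>, the part of a correlator of fixed bidegree: it is known near one
  puncture, continued to the others, and compared with its expansions there. A real analytic
  function has to vanish on an open set before it can be continued as zero, hence the
  complexifications. The half-integers in PN2 come from
  \<open>L(1) L(-1)^(m+1) w = (m+1)(2h+m) L(-1)^m w\<close> for \<open>w\<close> of weight
  \<open>h\<close> killed by \<open>L(1)\<close>: the factor vanishes exactly at
  \<open>h = - m/2\<close>. Neither the weights of \<open>\<omega>\<close> and
  \<open>\<omega>b\<close> nor the commutation of the two Virasoro actions is among the axioms. Both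
  are derived, and both derivations use the absence of negative half-integral weights.\<close>

lemma zpow_exp:
  assumes "z \<noteq> 0" "r - s \<in> \<int>"
  shows "zpow r s z = exp (of_real r * Ln z + of_real s * cnj (Ln z))"
proof -
  obtain k where k: "r - s = of_int k" using assms(2) by (auto elim: Ints_cases)
  have r: "r = s + of_int k" using k by simp
  \<comment> \<open>Eliminating \<open>cnj (Ln z)\<close> leaves \<open>Ln z\<close> with the
    integer coefficient \<open>k\<close>, so the branch of the logarithm drops out; this is where
    integrality of \<open>r - s\<close> enters.\<close>
  have c: "cnj (Ln z) = 2 * of_real (ln (norm z)) - Ln z"
    using assms(1) by (simp add: complex_eq_iff Re_Ln)
  have "of_real r * Ln z + of_real s * cnj (Ln z)
        = of_int k * Ln z + of_real (2 * s * ln (norm z))"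
    unfolding c r by (simp add: algebra_simps)
  moreover have "exp (of_int k * Ln z) = z powi k"
    using assms(1) by (simp add: exp_power_int[symmetric])
  moreover have "exp (of_real (2 * s * ln (norm z))) = (of_real (norm z powr (2 * s)) :: complex)"
    using assms(1) by (simp add: powr_def exp_of_real[symmetric])
  ultimately show ?thesis
    by (simp add: zpow_def k exp_add)
qed

lemma zpow_nonzero: "z \<noteq> 0 \<Longrightarrow> zpow r s z \<noteq> 0"
  by (simp add: zpow_def)

lemma zpow_0 [simp]: "z \<noteq> 0 \<Longrightarrow> zpow 0 0 z = 1"
  by (simp add: zpow_def)

lemma zpow_one [simp]: "zpow r s 1 = 1"
  by (simp add: zpow_def)

lemma zpow_add:
  assumes "z \<noteq> 0" "r - s \<in> \<int>" "r' - s' \<in> \<int>"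
  shows "zpow (r + r') (s + s') z = zpow r s z * zpow r' s' z"
proof -
  have "(r + r') - (s + s') \<in> \<int>" 
    using Ints_add[OF assms(2,3)] by (simp add: algebra_simps)
  thus ?thesis
    using assms by (simp add: zpow_exp exp_add[symmetric] algebra_simps)
qed

lemma zpow_minus:
  assumes "z \<noteq> 0" "r - s \<in> \<int>"
  shows "zpow (- r) (- s) z = inverse (zpow r s z)"
proof -
  have "- r - - s \<in> \<int>" using Ints_minus[OF assms(2)] by simp
  thus ?thesis
    using assms by (simp add: zpow_exp exp_minus[symmetric] algebra_simps)
qed

lemma zpow_mult: "zpow r s (z * w) = zpow r s z * zpow r s w"
  by (simp add: zpow_def power_int_mult_distrib norm_mult powr_mult)

lemma zpow_inverse:
  assumes "z \<noteq> 0" "r - s \<in> \<int>"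
  shows "zpow r s (1 / z) = zpow (- r) (- s) z"
proof -
  have "zpow r s (1 / z) * zpow r s z = 1"
    using assms by (simp flip: zpow_mult)
  thus ?thesis using zpow_nonzero[OF assms(1)] assms
    by (simp add: zpow_minus field_simps)
qed

lemma zpow_nat: "z \<noteq> 0 \<Longrightarrow> zpow (real m) (real n) z = z ^ m * cnj z ^ n"
  by (simp add: zpow_exp exp_add exp_of_nat_mult flip: exp_cnj)

lemma zpow_int: "z \<noteq> 0 \<Longrightarrow> zpow (of_int k) 0 z = z powi k"
  by (simp add: zpow_def)

lemma zpow_minus_one: "zpow r s (- 1) = (- 1) powi \<lfloor>r - s\<rfloor>"
  by (simp add: zpow_def)

lemma zpow_uminus: "zpow r s (- z) = (- 1) powi \<lfloor>r - s\<rfloor> * zpow r s z"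
  using zpow_mult[of r s "-1" z] by (simp add: zpow_minus_one)

lemma zpow_cnj:
  assumes "z \<noteq> 0" "r - s \<in> \<int>"
  shows "zpow r s (cnj z) = zpow s r z"
proof -
  obtain k where k: "r - s = of_int k" using assms(2) by (auto elim: Ints_cases)
  have r: "r = s + of_int k" using k by simp
  have sr: "\<lfloor>s - r\<rfloor> = - k" unfolding r by simp
  have "z * cnj z = of_real (norm z powr 2)"
    using assms(1) by (simp add: complex_norm_square [symmetric] powr_numeral)
  hence "cnj z = inverse z * of_real (norm z powr 2)"
    using assms(1) by (simp add: field_simps)
  hence "cnj z powi k = inverse z powi k * (of_real (norm z powr 2)) powi k"
    by (simp add: power_int_mult_distrib)
  also have "inverse z powi k = z powi (- k)"
    by (simp add: power_int_minus power_int_inverse)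
  also have "(of_real (norm z powr 2) :: complex) powi k = of_real ((norm z powr 2) powi k)"
    by simp
  also have "(norm z powr 2) powi k = (norm z powr 2) powr of_int k"
    using assms(1) by (intro powr_real_of_int'[symmetric]) auto
  also have "\<dots> = norm z powr (2 * of_int k)"
    by (rule powr_powr)
  finally show ?thesis
    using assms(1) unfolding zpow_def k sr by (simp add: r algebra_simps powr_add)
qed

text \<open>
  \<open>P\<close> is a convenient substitute for a holomorphic function of two complex variables on a
  polydisc: it is holomorphic along every pair of holomorphic functions of one variable.
\<close>

definition biholo :: "(complex \<Rightarrow> complex \<Rightarrow> complex) \<Rightarrow> real \<Rightarrow> bool" where
  "biholo P e \<longleftrightarrow> (\<forall>\<phi> \<psi> S. open S \<longrightarrow> \<phi> holomorphic_on S \<longrightarrow> \<psi> holomorphic_on S \<longrightarrow>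
      \<phi> ` S \<subseteq> ball 0 e \<longrightarrow> \<psi> ` S \<subseteq> ball 0 e \<longrightarrow> (\<lambda>t. P (\<phi> t) (\<psi> t)) holomorphic_on S)"

text \<open>\<open>P\<close> is a complexification of \<open>g\<close> near \<open>p\<close>: it
  extends \<open>g\<close> from real to complex coordinates. Products and continuation then involve
  holomorphic functions of one variable instead of rearranged double power series.\<close>

definition ranalytic :: "(complex \<Rightarrow> complex) \<Rightarrow> complex \<Rightarrow> bool" where
  "ranalytic g p \<longleftrightarrow> (\<exists>e>0. \<exists>P. biholo P e \<and>
     (\<forall>x y. \<bar>x\<bar> < e \<longrightarrow> \<bar>y\<bar> < e \<longrightarrow> g (p + Complex x y) = P (of_real x) (of_real y)))"

lemma biholoD:
  "\<lbrakk>biholo P e; open S; \<phi> holomorphic_on S; \<psi> holomorphic_on S;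
    \<And>t. t \<in> S \<Longrightarrow> norm (\<phi> t) < e; \<And>t. t \<in> S \<Longrightarrow> norm (\<psi> t) < e\<rbrakk>
   \<Longrightarrow> (\<lambda>t. P (\<phi> t) (\<psi> t)) holomorphic_on S"
  unfolding biholo_def by (auto simp: image_subset_iff)

lemma biholo_mono: "biholo P e \<Longrightarrow> e' \<le> e \<Longrightarrow> biholo P e'"
  unfolding biholo_def by (meson order_trans subset_ball)

lemma ranalytic_bin:
  assumes "ranalytic g p" "ranalytic h p"
    and op: "\<And>u v S. u holomorphic_on S \<Longrightarrow> v holomorphic_on S \<Longrightarrow> (\<lambda>t. f (u t) (v t)) holomorphic_on S"
  shows "ranalytic (\<lambda>w. f (g w) (h w)) p"
proof -
  obtain e P where 1: "e > 0" "biholo P e"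
    "\<And>x y. \<bar>x\<bar> < e \<Longrightarrow> \<bar>y\<bar> < e \<Longrightarrow> g (p + Complex x y) = P (of_real x) (of_real y)"
    using assms(1) unfolding ranalytic_def by blast
  obtain e' P' where 2: "e' > 0" "biholo P' e'"
    "\<And>x y. \<bar>x\<bar> < e' \<Longrightarrow> \<bar>y\<bar> < e' \<Longrightarrow> h (p + Complex x y) = P' (of_real x) (of_real y)"
    using assms(2) unfolding ranalytic_def by blast
  show ?thesis unfolding ranalytic_def
  proof (intro exI[of _ "min e e'"] conjI exI[of _ "\<lambda>X Y. f (P X Y) (P' X Y)"] allI impI)
    have "biholo P (min e e')" "biholo P' (min e e')"
      by (rule biholo_mono[OF 1(2)] biholo_mono[OF 2(2)]; simp)+
    thus "biholo (\<lambda>X Y. f (P X Y) (P' X Y)) (min e e')"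
      unfolding biholo_def by (intro allI impI op) simp_all
    show "min e e' > 0" using 1(1) 2(1) by simp
    fix x y :: real assume "\<bar>x\<bar> < min e e'" "\<bar>y\<bar> < min e e'"
    thus "f (g (p + Complex x y)) (h (p + Complex x y)) = f (P (of_real x) (of_real y)) (P' (of_real x) (of_real y))"
      using 1(3)[of x y] 2(3)[of x y] by simp
  qed
qed

lemma ranalytic_add: "ranalytic g p \<Longrightarrow> ranalytic h p \<Longrightarrow> ranalytic (\<lambda>w. g w + h w) p"
  by (rule ranalytic_bin[of g p h "(+)"]) (auto intro: holomorphic_intros)

lemma ranalytic_mult: "ranalytic g p \<Longrightarrow> ranalytic h p \<Longrightarrow> ranalytic (\<lambda>w. g w * h w) p"
  by (rule ranalytic_bin[of g p h "(*)"]) (auto intro: holomorphic_intros)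

lemma ranalytic_diff: "ranalytic g p \<Longrightarrow> ranalytic h p \<Longrightarrow> ranalytic (\<lambda>w. g w - h w) p"
  by (rule ranalytic_bin[of g p h "(-)"]) (auto intro: holomorphic_intros)

lemma ranalytic_const [simp]: "ranalytic (\<lambda>_. k) p"
  unfolding ranalytic_def biholo_def by (intro exI[of _ 1] conjI exI[of _ "\<lambda>_ _. k"]) auto

text \<open>Conjugation acts as \<open>(X, Y) \<mapsto> (X, - Y)\<close> on the
  complexification.\<close>

lemma ranalytic_cnj:
  assumes "ranalytic g (cnj p)"
  shows "ranalytic (\<lambda>w. g (cnj w)) p"
proof -
  obtain e P where 1: "e > 0" "biholo P e"
    "\<And>x y. \<bar>x\<bar> < e \<Longrightarrow> \<bar>y\<bar> < e \<Longrightarrow> g (cnj p + Complex x y) = P (of_real x) (of_real y)"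
    using assms unfolding ranalytic_def by blast
  show ?thesis unfolding ranalytic_def
  proof (intro exI[of _ e] conjI exI[of _ "\<lambda>X Y. P X (- Y)"] allI impI)
    show "biholo (\<lambda>X Y. P X (- Y)) e"
      unfolding biholo_def
    proof (intro allI impI)
      fix \<phi> \<psi> S assume h: "open S" "\<phi> holomorphic_on S" "\<psi> holomorphic_on S" 
        "\<phi> ` S \<subseteq> ball 0 e" "\<psi> ` S \<subseteq> ball (0::complex) e"
      show "(\<lambda>t. P (\<phi> t) (- \<psi> t)) holomorphic_on S"
        by (rule biholoD[OF 1(2) h(1)]) (use h in \<open>auto intro!: holomorphic_intros\<close>)
    qed
    fix x y :: real assume "\<bar>x\<bar> < e" "\<bar>y\<bar> < e"
    moreover have "cnj (p + Complex x y) = cnj p + Complex x (- y)"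
      by (simp add: complex_eq_iff)
    ultimately show "g (cnj (p + Complex x y)) = P (of_real x) (- of_real y)"
      using 1(3)[of x "-y"] by simp
  qed (use 1 in auto)
qed

text \<open>On the complexification \<open>w\<close> and \<open>cnj w\<close> become the independent
  \<open>X + \<i> Y\<close> and \<open>X - \<i> Y\<close>, with one logarithm for each. Reality of
  \<open>b\<close> makes the arguments of the two logarithms conjugate at real points. The cases in
  use are \<open>b = 1\<close> and \<open>b = - 1\<close>.\<close>

lemma ranalytic_zpow_affine:
  assumes "r - s \<in> \<int>" "a + b * p \<noteq> 0" and b: "b \<in> \<real>" "norm b \<le> 1"
  shows "ranalytic (\<lambda>w. zpow r s (a + b * w)) p"
proof -
  define q where "q = a + b * p"
  have q: "q \<noteq> 0" using assms by (simp add: q_def)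
  \<comment> \<open>Small enough that \<open>|X| + |Y| < |q|\<close>, which keeps both arguments of
    \<open>Ln\<close> in the right half plane.\<close>
  define e where "e = norm q / 4"
  have e: "e > 0" using q by (simp add: e_def)
  define P where "P = (\<lambda>X Y. zpow r s q * exp (of_real r * Ln (1 + b * (X + \<i> * Y) / q) +
       of_real s * Ln (1 + b * (X - \<i> * Y) / cnj q)))"
  have re: "Re (1 + u) > 0" if "norm u < 1" for u :: complex
    using abs_Re_le_cmod[of u] that by simp
  have small: "norm (b * U / q') < 1" if "norm X < e" "norm Y < e" "norm q' = norm q" 
       "U = X + \<i> * Y \<or> U = X - \<i> * Y" for X Y U q'
  proof -
    have "norm U \<le> norm X + norm Y" using that(4)
      by (auto intro: norm_triangle_le norm_triangle_le_diff simp: norm_mult)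
    hence "norm U < norm q" using that(1,2) norm_ge_zero[of q] unfolding e_def by linarith
    moreover have "norm (b * U) \<le> norm U" 
      using b by (simp add: norm_mult mult_left_le_one_le)
    ultimately show ?thesis using q that(3) by (simp add: norm_divide field_simps)
  qed
  have nR: "1 + b * U / q' \<notin> \<real>\<^sub>\<le>\<^sub>0" if "norm X < e" "norm Y < e" "norm q' = norm q" 
       "U = X + \<i> * Y \<or> U = X - \<i> * Y" for X Y U q'
    using re[OF small[OF that]] by (auto simp: complex_nonpos_Reals_iff)
  show ?thesis unfolding ranalytic_def
  proof (intro exI[of _ e] conjI exI[of _ P] allI impI)
    show "biholo P e" unfolding biholo_def
    proof (intro allI impI)
      fix \<phi> \<psi> S assume h: "open S" "\<phi> holomorphic_on S" "\<psi> holomorphic_on S" 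
        "\<phi> ` S \<subseteq> ball 0 e" "\<psi> ` S \<subseteq> ball (0::complex) e"
      have "1 + b * (\<phi> t + \<i> * \<psi> t) / q \<notin> \<real>\<^sub>\<le>\<^sub>0" "1 + b * (\<phi> t - \<i> * \<psi> t) / cnj q \<notin> \<real>\<^sub>\<le>\<^sub>0" if "t \<in> S" for t
        using h(4,5) that by (intro nR[of "\<phi> t" "\<psi> t"]; auto)+
      thus "(\<lambda>t. P (\<phi> t) (\<psi> t)) holomorphic_on S"
        unfolding P_def using q by (intro holomorphic_intros h(2,3)) auto
    qed
    fix x y :: real assume xy: "\<bar>x\<bar> < e" "\<bar>y\<bar> < e"
    define u where "u = b * Complex x y / q"
    have cu: "cnj u = b * (of_real x - \<i> * of_real y) / cnj q"
      using b by (simp add: u_def Reals_cnj_iff[THEN iffD1] Complex_eq)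
    have u': "u = b * (of_real x + \<i> * of_real y) / q"
      by (simp add: u_def Complex_eq)
    have nu: "norm u < 1" unfolding u' using xy by (intro small[of "of_real x" "of_real y"]) auto
    have u0: "1 + u \<noteq> 0" using re[OF nu] by (metis less_irrefl zero_complex.sel(1))
    have "a + b * (p + Complex x y) = q * (1 + u)"
      using q by (simp add: u_def q_def[symmetric] field_simps) (simp add: q_def algebra_simps)
    hence "zpow r s (a + b * (p + Complex x y)) = zpow r s q * zpow r s (1 + u)"
      by (simp add: zpow_mult)
    also have "zpow r s (1 + u) = exp (of_real r * Ln (1 + u) + of_real s * Ln (1 + cnj u))"
      using u0 assms(1) re[OF nu] by (simp add: zpow_exp cnj_Ln complex_nonpos_Reals_iff)
    finally show "zpow r s (a + b * (p + Complex x y)) = P (of_real x) (of_real y)"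
      by (simp add: P_def cu[symmetric] u'[symmetric])
  qed (fact e)
qed

lemma ranalytic_zpow: "r - s \<in> \<int> \<Longrightarrow> p \<noteq> 0 \<Longrightarrow> ranalytic (zpow r s) p"
  using ranalytic_zpow_affine[of r s 0 1 p] by simp

lemma ranalytic_zpow_one_minus: 
  "r - s \<in> \<int> \<Longrightarrow> p \<noteq> 1 \<Longrightarrow> ranalytic (\<lambda>w. zpow r s (1 - w)) p"
  using ranalytic_zpow_affine[of r s 1 "-1" p] by simp

lemma holomorphic_on_uniform_limit:
  assumes "open S" "\<And>n. f n holomorphic_on S" "uniform_limit S f g F" "F \<noteq> bot"
  shows "g holomorphic_on S"
proof -
  have "g holomorphic_on ball z r" if "z \<in> S" "cball z r \<subseteq> S" for z r
  proof (rule holomorphic_uniform_limit)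
    show "uniform_limit (cball z r) f g F"
      using assms(3) that(2) by (rule uniform_limit_on_subset)
    have "f n holomorphic_on cball z r" for n
      using assms(2) that(2) by (rule holomorphic_on_subset)
    thus "\<forall>\<^sub>F n in F. continuous_on (cball z r) (f n) \<and> f n holomorphic_on ball z r"
      by (intro always_eventually allI conjI)
         (auto intro: holomorphic_on_imp_continuous_on holomorphic_on_subset[OF _ ball_subset_cball])
  qed (use assms in auto)
  moreover have "\<exists>r>0. cball z r \<subseteq> S" if "z \<in> S" for z
    using assms(1) that open_contains_cball by blast
  ultimately have "g analytic_on S"
    unfolding analytic_on_def by blast
  thus ?thesis by (rule analytic_imp_holomorphic)
qed

text \<open>Absolute convergence at the corner \<open>(e', e')\<close> gives a summable majorant on
  the polydisc, so the partial sums converge uniformly along every pair of holomorphic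
  functions.\<close>

lemma ranalytic_if_real_analytic_at:
  assumes "real_analytic_at f p"
  shows "ranalytic f p"
proof -
  obtain e c where e: "e > 0" and c: "\<And>w. \<bar>Re w\<bar> < e \<Longrightarrow> \<bar>Im w\<bar> < e \<Longrightarrow>
        ((\<lambda>(m, n). c m n * of_real (Re w ^ m * Im w ^ n)) has_sum f (p + w)) (UNIV::(nat\<times>nat) set)"
    using assms unfolding real_analytic_at_def by blast
  define e' where "e' = e / 2"
  have e': "e' > 0" "e' < e" using e by (auto simp: e'_def)
  define M where "M = (\<lambda>(m::nat, n::nat). norm (c m n) * e' ^ m * e' ^ n)"
  have "(\<lambda>(m, n). c m n * of_real (e' ^ m * e' ^ n)) summable_on UNIV"
    using c[of "Complex e' e'"] e' by (auto simp: summable_on_def)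
  hence "(\<lambda>x. norm ((\<lambda>(m, n). c m n * of_real (e' ^ m * e' ^ n)) x)) summable_on UNIV"
    by (simp add: summable_on_iff_abs_summable_on_complex)
  also have "(\<lambda>x. norm ((\<lambda>(m, n). c m n * of_real (e' ^ m * e' ^ n)) x)) = M"
    using e' by (auto simp: M_def norm_mult norm_power)
  finally have M: "M summable_on UNIV" .
  have le: "norm (c m n * X ^ m * Y ^ n) \<le> M (m, n)" if "norm X < e'" "norm Y < e'" for X Y m n
    unfolding M_def norm_mult norm_power prod.case using that
    by (intro mult_mono power_mono mult_nonneg_nonneg zero_le_power norm_ge_zero) (use e' in auto)
  define P where "P = (\<lambda>X Y. \<Sum>\<^sub>\<infinity>(m, n). c m n * X ^ m * Y ^ n)"
  show ?thesis unfolding ranalytic_def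
  proof (intro exI[of _ e'] conjI exI[of _ P] allI impI)
    show "biholo P e'" unfolding biholo_def
    proof (intro allI impI)
      fix \<phi> \<psi> S assume h: "open S" "\<phi> holomorphic_on S" "\<psi> holomorphic_on S" 
        "\<phi> ` S \<subseteq> ball 0 e'" "\<psi> ` S \<subseteq> ball (0::complex) e'"
      have hb: "norm (\<phi> t) < e'" "norm (\<psi> t) < e'" if "t \<in> S" for t
        using h that by auto
      have "uniform_limit S (\<lambda>X t. \<Sum>(m,n)\<in>X. c m n * \<phi> t ^ m * \<psi> t ^ n) 
             (\<lambda>t. \<Sum>\<^sub>\<infinity>(m,n). c m n * \<phi> t ^ m * \<psi> t ^ n) (finite_subsets_at_top UNIV)"
        by (rule Weierstrass_m_test_general[where M = M, THEN uniform_limit_eq_rhs])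
           (use le hb M in \<open>auto simp: case_prod_unfold\<close>)
      hence ul: "uniform_limit S (\<lambda>X t. \<Sum>(m,n)\<in>X. c m n * \<phi> t ^ m * \<psi> t ^ n) 
             (\<lambda>t. P (\<phi> t) (\<psi> t)) (finite_subsets_at_top UNIV)" by (simp add: P_def)
      show "(\<lambda>t. P (\<phi> t) (\<psi> t)) holomorphic_on S"
        by (rule holomorphic_on_uniform_limit[OF h(1) _ ul])
           (use h in \<open>auto intro!: holomorphic_intros simp: case_prod_unfold\<close>)
    qed
    fix x y :: real assume xy: "\<bar>x\<bar> < e'" "\<bar>y\<bar> < e'"
    show "f (p + Complex x y) = P (of_real x) (of_real y)"
      using c[of "Complex x y"] xy e' by (simp add: P_def infsumI mult.assoc)
  qed (fact e')
qed

section \<open>Analytic continuation\<close>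

text \<open>The identity theorem in the form in which complexifications use it: zeros are known on a
  real interval only, and \<open>x0\<close> is a limit point of them inside the disc.\<close>

lemma vanish_real_segment:
  fixes f :: "complex \<Rightarrow> complex"
  assumes "f holomorphic_on ball (of_real c) e" "\<bar>x0 - c\<bar> < e" "d > 0"
    and zero: "\<And>x. \<bar>x - x0\<bar> < d \<Longrightarrow> \<bar>x - c\<bar> < e \<Longrightarrow> f (of_real x) = 0"
    and w: "w \<in> ball (of_real c) e"
  shows "f w = 0"
proof (rule analytic_continuation[OF assms(1), of "of_real ` {x. \<bar>x - x0\<bar> < d \<and> \<bar>x - c\<bar> < e}" "of_real x0"])
  have dist_c: "dist (of_real c) (of_real x :: complex) = \<bar>x - c\<bar>" for x
    by (metis dist_commute dist_norm norm_of_real of_real_diff)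
  show "of_real ` {x. \<bar>x - x0\<bar> < d \<and> \<bar>x - c\<bar> < e} \<subseteq> ball (complex_of_real c) e"
    by (auto simp: dist_real_def)
  show "complex_of_real x0 \<in> ball (of_real c) e" using assms(2) by (auto simp: dist_real_def)
  show "complex_of_real x0 islimpt of_real ` {x. \<bar>x - x0\<bar> < d \<and> \<bar>x - c\<bar> < e}"
    unfolding islimpt_approachable
  proof (intro allI impI)
    fix \<epsilon> :: real assume "\<epsilon> > 0"
    define m where "m = min (min d \<epsilon>) (e - \<bar>x0 - c\<bar>)"
    define x where "x = x0 + m / 2"
    have m: "m > 0" "m \<le> d" "m \<le> \<epsilon>" "m \<le> e - \<bar>x0 - c\<bar>"
      using assms(2,3) \<open>\<epsilon> > 0\<close> by (auto simp: m_def)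
    have x: "x > x0" "x - x0 < d" "x - x0 < \<epsilon>" "\<bar>x - c\<bar> < e" 
      using m unfolding x_def by linarith+
    have "dist (complex_of_real x) (of_real x0) = \<bar>x - x0\<bar>"
      by (metis dist_norm norm_of_real of_real_diff)
    thus "\<exists>x'\<in>complex_of_real ` {x. \<bar>x - x0\<bar> < d \<and> \<bar>x - c\<bar> < e}. x' \<noteq> of_real x0 \<and> dist x' (of_real x0) < \<epsilon>"
      using x by (intro bexI[of _ "of_real x"]) auto
  qed
qed (use zero w in auto)

lemma biholo_section1: "biholo P e \<Longrightarrow> norm Y < e \<Longrightarrow> (\<lambda>X. P X Y) holomorphic_on ball 0 e"
  by (rule biholoD) auto

lemma biholo_section2: "biholo P e \<Longrightarrow> norm X < e \<Longrightarrow> (\<lambda>Y. P X Y) holomorphic_on ball 0 e"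
  by (rule biholoD) auto

text \<open>The one-variable statement is applied in \<open>X\<close> for real \<open>y\<close>,
  then in \<open>Y\<close> for complex \<open>X\<close>. Thus a complexification is determined by
  any small square of real points.\<close>

lemma biholo_vanish:
  assumes P: "biholo P e" and "\<bar>x0\<bar> < e" "\<bar>y0\<bar> < e" "d > 0"
    and zero: "\<And>x y. \<bar>x - x0\<bar> < d \<Longrightarrow> \<bar>y - y0\<bar> < d \<Longrightarrow> \<bar>x\<bar> < e \<Longrightarrow> \<bar>y\<bar> < e \<Longrightarrow> P (of_real x) (of_real y) = 0"
    and "norm X < e" "norm Y < e"
  shows "P X Y = 0"
proof -
  have 1: "P X' (of_real y) = 0" if "norm X' < e" "\<bar>y - y0\<bar> < d" "\<bar>y\<bar> < e" for X' y
    by (rule vanish_real_segment[of "\<lambda>X. P X (of_real y)" 0 e x0 d])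
       (use biholo_section1[OF P, of "of_real y"] that assms(2,4) zero in auto)
  show ?thesis
    by (rule vanish_real_segment[of "\<lambda>Y. P X Y" 0 e y0 d])
       (use biholo_section2[OF P, of X] assms 1 in auto)
qed

lemma connected_punctured2: "connected (- {0, 1 :: complex})"
  by (intro path_connected_imp_connected path_connected_complement_countable) auto

text \<open>The complexification at \<open>a\<close> carries vanishing near any point of a ball
  around \<open>a\<close> to the whole ball, and connectedness of \<open>- {0, 1}\<close> does the
  rest. The property propagated is vanishing on an open set, not vanishing at accumulating
  points.\<close>

lemma ranalytic_zero_continuation:
  assumes g: "\<And>p. p \<in> - {0, 1} \<Longrightarrow> ranalytic g p"
    and "\<rho> > 0" and zero: "\<And>p. p \<in> ball 0 \<rho> - {0} \<Longrightarrow> g p = 0"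
    and p: "p \<in> - {0, 1}"
  shows "g p = 0"
proof -
  define Q where "Q = (\<lambda>p. \<exists>r>0. \<forall>w\<in>ball p r. g w = 0)"
  \<comment> \<open>A starting point inside the punctured disc and different from 1.\<close>
  define s where "s = min (\<rho> / 2) (1 / 2)"
  have s: "s > 0" "s < \<rho>" "s < 1" using \<open>\<rho> > 0\<close> by (auto simp: s_def)
  have "Q p"
  proof (rule connected_induction_simple[OF connected_punctured2])
    show "of_real s \<in> - {0, 1 :: complex}" using s by auto
    show "Q (of_real s)" unfolding Q_def
    proof (intro exI[of _ "min s (\<rho> - s)"] conjI ballI)
      fix w :: complex assume w: "w \<in> ball (of_real s) (min s (\<rho> - s))"
      have "norm w < \<rho>"
        using w s norm_triangle_ineq2[of w "of_real s"] 
        by (auto simp: dist_norm norm_minus_commute)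
      moreover have "w \<noteq> 0" using w s by auto
      ultimately show "g w = 0" by (intro zero) auto
    qed (use s in auto)
  next
    fix a :: complex assume a: "a \<in> - {0, 1}"
    obtain e P where e: "e > 0" and P: "biholo P e"
      and gP: "\<And>x y. \<bar>x\<bar> < e \<Longrightarrow> \<bar>y\<bar> < e \<Longrightarrow> g (a + Complex x y) = P (of_real x) (of_real y)"
      using g[OF a] unfolding ranalytic_def by blast
    have "Q y" if xy: "x \<in> ball a e" "y \<in> ball a e" "Q x" for x y
    proof -
      obtain r where r: "r > 0" "\<And>w. w \<in> ball x r \<Longrightarrow> g w = 0" using xy(3) unfolding Q_def by blast
      define x0 y0 where "x0 = Re (x - a)" and "y0 = Im (x - a)"
      have xa: "x = a + Complex x0 y0" by (simp add: x0_def y0_def complex_eq_iff)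
      have n: "norm (x - a) < e" using xy(1) by (simp add: dist_norm norm_minus_commute)
      have xy0: "\<bar>x0\<bar> < e" "\<bar>y0\<bar> < e"
        using abs_Re_le_cmod[of "x - a"] abs_Im_le_cmod[of "x - a"] n unfolding x0_def y0_def by linarith+
      have PZ: "P X Y = 0" if "norm X < e" "norm Y < e" for X Y
      proof (rule biholo_vanish[OF P xy0 _ _ that, of "r / 2"])
        fix x1 y1 :: real assume h: "\<bar>x1 - x0\<bar> < r / 2" "\<bar>y1 - y0\<bar> < r / 2" "\<bar>x1\<bar> < e" "\<bar>y1\<bar> < e"
        have "a + Complex x1 y1 - x = Complex (x1 - x0) (y1 - y0)" by (simp add: xa complex_eq_iff)
        hence "norm (a + Complex x1 y1 - x) < r"
          using cmod_le[of "Complex (x1 - x0) (y1 - y0)"] h by simp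
        hence "g (a + Complex x1 y1) = 0" by (intro r(2)) (simp add: dist_norm norm_minus_commute)
        thus "P (of_real x1) (of_real y1) = 0" using gP h by simp
      qed (use r in auto)
      have g0: "g w = 0" if "w \<in> ball a e" for w
      proof -
        have n: "norm (w - a) < e" using that(1) by (simp add: dist_norm norm_minus_commute)
        have xy: "\<bar>Re (w - a)\<bar> < e" "\<bar>Im (w - a)\<bar> < e"
          using abs_Re_le_cmod[of "w - a"] abs_Im_le_cmod[of "w - a"] n by linarith+
        have "w = a + Complex (Re (w - a)) (Im (w - a))" by (simp add: complex_eq_iff)
        thus ?thesis using gP[OF xy] PZ xy by (metis norm_of_real)
      qed
      obtain r' where "r' > 0" "ball y r' \<subseteq> ball a e"
        using xy(2) open_ball open_contains_ball by blast
      thus "Q y" unfolding Q_def using g0 by blast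
    qed
    moreover have "openin (top_of_set (- {0, 1})) (- {0, 1} \<inter> ball a e)"
      by (rule openin_open_Int) simp
    ultimately show "\<exists>T. openin (top_of_set (- {0, 1})) T \<and> a \<in> T \<and> (\<forall>x\<in>T. \<forall>y\<in>T. Q x \<longrightarrow> Q y)"
    proof (intro exI[of _ "- {0, 1} \<inter> ball a e"] conjI ballI impI)
      show "a \<in> - {0, 1} \<inter> ball a e" using a e by simp
    qed blast+
  qed fact
  thus ?thesis unfolding Q_def by auto
qed

text \<open>
  Where \<open>g\<close> is holomorphic, the function \<open>P X Y\<close> depends only on \<open>X + \<i> Y\<close>, i.e. it is invariant
  under \<open>(X, Y) \<mapsto> (X - \<i> t, Y + t)\<close>; this persists on the whole polydisc.
\<close>

lemma ranalytic_holomorphic_local: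
  assumes e: "e > 0" and P: "biholo P e"
    and gP: "\<And>x y. \<bar>x\<bar> < e \<Longrightarrow> \<bar>y\<bar> < e \<Longrightarrow> g (a + Complex x y) = P (of_real x) (of_real y)"
    and b: "b \<in> ball a (e / 4)" and "r > 0" and hol: "g holomorphic_on ball b r"
  shows "g holomorphic_on ball a (e / 4)"
proof -
  define x0 y0 where "x0 = Re (b - a)" and "y0 = Im (b - a)"
  have ba: "b = a + Complex x0 y0" by (simp add: x0_def y0_def complex_eq_iff)
  have n: "norm (b - a) < e / 4" using b by (simp add: dist_norm norm_minus_commute)
  have xy0: "\<bar>x0\<bar> < e / 4" "\<bar>y0\<bar> < e / 4"
    using abs_Re_le_cmod[of "b - a"] abs_Im_le_cmod[of "b - a"] n unfolding x0_def y0_def by linarith+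
  define \<delta> where "\<delta> = min (r / 2) (e / 4)"
  have \<delta>: "\<delta> > 0" "\<delta> \<le> r / 2" "\<delta> \<le> e / 4" using e \<open>r > 0\<close> by (auto simp: \<delta>_def)
  have near: "norm (of_real u + Z) < e" if "\<bar>u\<bar> < e / 4" "norm Z < e / 2" for u and Z :: complex
    using norm_triangle_ineq[of "of_real u" Z] that e by simp
  have small: "norm X < e / 2" if "norm (X - of_real u) < \<delta>" "\<bar>u\<bar> < e / 4" for X :: complex and u
    using norm_triangle_sub[of X "of_real u"] that \<delta> by simp
  have inb: "a + (X + \<i> * Y) \<in> ball b r" 
    if "norm (X - of_real x0) < \<delta>" "norm (Y - of_real y0) < \<delta>" for X Y
  proof -
    have eq: "a + (X + \<i> * Y) - b = (X - of_real x0) + \<i> * (Y - of_real y0)"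
      by (simp add: ba Complex_eq algebra_simps)
    have "norm (a + (X + \<i> * Y) - b) \<le> norm (X - of_real x0) + norm (\<i> * (Y - of_real y0))"
      unfolding eq by (rule norm_triangle_ineq)
    also have "\<dots> < r" using that \<delta> by (simp add: norm_mult)
    finally show ?thesis by (simp add: dist_norm norm_minus_commute)
  qed
  \<comment> \<open>Both sides agree at real arguments. They are extended to complex ones near
    \<open>(x0, y0)\<close>, here in \<open>X\<close> and next in \<open>Y\<close>; the right-hand
    side makes sense there because \<open>g\<close> is holomorphic on
    \<open>ball b r\<close>.\<close>
  have 1: "P X (of_real y) = g (a + (X + \<i> * of_real y))" 
    if "norm (X - of_real x0) < \<delta>" "\<bar>y - y0\<bar> < \<delta>" for X y
  proof -
    have y: "norm (of_real y - of_real y0 :: complex) < \<delta>" 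
      using that(2) by (metis norm_of_real of_real_diff)
    have y': "norm (of_real y :: complex) < e" using small[OF y xy0(2)] e by linarith
    have "P X (of_real y) - g (a + (X + \<i> * of_real y)) = 0"
    proof (rule vanish_real_segment[where c = x0 and e = \<delta> and ?x0.0 = x0 and d = \<delta> and 
            f = "\<lambda>X. P X (of_real y) - g (a + (X + \<i> * of_real y))"])
      show "(\<lambda>X. P X (of_real y) - g (a + (X + \<i> * of_real y))) holomorphic_on ball (of_real x0) \<delta>"
      proof (intro holomorphic_intros)
        show "(\<lambda>X. P X (of_real y)) holomorphic_on ball (of_real x0) \<delta>"
          using small[OF _ xy0(1)] e
          by (intro holomorphic_on_subset[OF biholo_section1[OF P y']])
             (force simp: dist_norm norm_minus_commute)
        have "(g \<circ> (\<lambda>X. a + (X + \<i> * of_real y))) holomorphic_on ball (of_real x0) \<delta>"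
          by (rule holomorphic_on_compose_gen[OF _ hol])
             (use inb[OF _ y] in \<open>auto intro!: holomorphic_intros simp: dist_norm norm_minus_commute\<close>)
        thus "(\<lambda>X. g (a + (X + \<i> * of_real y))) holomorphic_on ball (of_real x0) \<delta>"
          by (simp add: o_def)
      qed
      fix x :: real assume "\<bar>x - x0\<bar> < \<delta>"
      hence "norm (of_real x - of_real x0 :: complex) < \<delta>" by (metis norm_of_real of_real_diff)
      hence "\<bar>x\<bar> < e" using small[OF _ xy0(1), of "of_real x"] e by simp
      thus "P (of_real x) (of_real y) - g (a + (of_real x + \<i> * of_real y)) = 0"
        using gP[of x y] y' by (simp add: Complex_eq)
    qed (use that \<delta> in \<open>auto simp: dist_norm norm_minus_commute\<close>)
    thus ?thesis by simp
  qed
  have 2: "P X Y = g (a + (X + \<i> * Y))" 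
    if "norm (X - of_real x0) < \<delta>" "norm (Y - of_real y0) < \<delta>" for X Y
  proof -
    have X': "norm X < e" using small[OF that(1) xy0(1)] e by linarith
    have "P X Y - g (a + (X + \<i> * Y)) = 0"
    proof (rule vanish_real_segment[where c = y0 and e = \<delta> and ?x0.0 = y0 and d = \<delta> and 
            f = "\<lambda>Y. P X Y - g (a + (X + \<i> * Y))"])
      show "(\<lambda>Y. P X Y - g (a + (X + \<i> * Y))) holomorphic_on ball (of_real y0) \<delta>"
      proof (intro holomorphic_intros)
        show "(\<lambda>Y. P X Y) holomorphic_on ball (of_real y0) \<delta>"
          using small[OF _ xy0(2)] e
          by (intro holomorphic_on_subset[OF biholo_section2[OF P X']])
             (force simp: dist_norm norm_minus_commute)
        have "(g \<circ> (\<lambda>Y. a + (X + \<i> * Y))) holomorphic_on ball (of_real y0) \<delta>"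
          by (rule holomorphic_on_compose_gen[OF _ hol])
             (use inb[OF that(1)] in \<open>auto intro!: holomorphic_intros simp: dist_norm norm_minus_commute\<close>)
        thus "(\<lambda>Y. g (a + (X + \<i> * Y))) holomorphic_on ball (of_real y0) \<delta>"
          by (simp add: o_def)
      qed
    qed (use that \<delta> 1 in \<open>auto simp: dist_norm norm_minus_commute\<close>)
    thus ?thesis by simp
  qed
  \<comment> \<open>On the line \<open>(x - \<i> t, y + t)\<close> the function \<open>P\<close> is
    constant for small real \<open>t\<close>. The difference \<open>f\<close> is holomorphic in
    \<open>t\<close>, so \<open>t = - y\<close> may be inserted, which moves the second coordinate
    to 0.\<close>
  have 3: "P (of_real x + \<i> * of_real y) 0 = P (of_real x) (of_real y)"
    if "\<bar>x - x0\<bar> < \<delta> / 2" "\<bar>y - y0\<bar> < \<delta> / 2" "\<bar>x\<bar> < e / 4" "\<bar>y\<bar> < e / 4" for x y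
  proof -
    define f where "f = (\<lambda>t. P (of_real x - \<i> * t) (of_real y + t) - P (of_real x) (of_real y))"
    have "f (- of_real y) = 0"
    proof (rule vanish_real_segment[of f 0 "e / 2" 0 "\<delta> / 2"])
      show "f holomorphic_on ball (of_real 0) (e / 2)"
        unfolding f_def
      proof (intro holomorphic_intros biholoD[OF P])
        fix t :: complex assume t: "t \<in> ball (of_real 0) (e / 2)"
        show "norm (of_real x - \<i> * t) < e"
          using near[OF that(3), of "- \<i> * t"] t by (simp add: norm_mult)
        show "norm (of_real y + t) < e" using near[OF that(4), of t] t by simp
      qed auto
      fix t assume t: "\<bar>t - 0\<bar> < \<delta> / 2"
      have "norm (of_real x - \<i> * of_real t - of_real x0) \<le> norm (of_real (x - x0) :: complex) + norm (\<i> * of_real t)"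
        using norm_triangle_ineq4[of "of_real (x - x0)" "\<i> * of_real t"] by (simp add: algebra_simps)
      hence "norm (of_real x - \<i> * of_real t - of_real x0) < \<delta>"
        unfolding norm_of_real norm_mult using that t by simp
      moreover have "norm (of_real y + of_real t - of_real y0 :: complex) < \<delta>"
      proof -
        have "norm (of_real y + of_real t - of_real y0 :: complex) = \<bar>y + t - y0\<bar>"
          by (metis norm_of_real of_real_add of_real_diff)
        thus ?thesis using that t by linarith
      qed
      ultimately have "P (of_real x - \<i> * of_real t) (of_real y + of_real t) = g (a + (of_real x + \<i> * of_real y))"
        by (subst 2) (auto simp: algebra_simps)
      moreover have "P (of_real x) (of_real y) = g (a + (of_real x + \<i> * of_real y))"
        using gP[of x y] that e by (simp add: Complex_eq)
      ultimately show "f (of_real t) = 0" by (simp add: f_def)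
    qed (use that \<delta> e in auto)
    thus ?thesis by (simp add: f_def)
  qed
  \<comment> \<open>\<open>R\<close> measures how far \<open>P\<close> is from depending on
    \<open>X + \<i> Y\<close> alone. It vanishes at real points near \<open>(x0, y0)\<close>, hence
    on the polydisc, and so \<open>g w = P (w - a) 0\<close>.\<close>
  define R where "R = (\<lambda>X Y. P (X + \<i> * Y) 0 - P X Y)"
  have R: "biholo R (e / 4)" unfolding biholo_def
  proof (intro allI impI)
    fix \<phi> \<psi> S assume h: "open S" "\<phi> holomorphic_on S" "\<psi> holomorphic_on S" 
      "\<phi> ` S \<subseteq> ball 0 (e / 4)" "\<psi> ` S \<subseteq> ball (0::complex) (e / 4)"
    have b: "norm (\<phi> t) < e / 4" "norm (\<psi> t) < e / 4" if "t \<in> S" for t using h(4,5) that by auto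
    have b': "norm (\<phi> t + \<i> * \<psi> t) < e" if "t \<in> S" for t
      using norm_triangle_ineq[of "\<phi> t" "\<i> * \<psi> t"] b[OF that] e by (simp add: norm_mult)
    show "(\<lambda>t. R (\<phi> t) (\<psi> t)) holomorphic_on S"
      unfolding R_def
    proof (intro holomorphic_intros biholoD[OF P h(1)] h(2,3))
      fix t assume t: "t \<in> S"
      show "norm (\<phi> t + \<i> * \<psi> t) < e" by (rule b'[OF t])
      show "norm (0 :: complex) < e" "norm (\<phi> t) < e" "norm (\<psi> t) < e" using b[OF t] e by auto
    qed
  qed
  have R0: "R X Y = 0" if "norm X < e / 4" "norm Y < e / 4" for X Y
    by (rule biholo_vanish[OF R xy0 _ _ that, of "\<delta> / 2"]) (use 3 \<delta> in \<open>auto simp: R_def\<close>)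
  have "(\<lambda>w. P (w - a) 0) holomorphic_on ball a (e / 4)"
    using e by (intro biholoD[OF P]) (auto intro!: holomorphic_intros simp: dist_norm norm_minus_commute)
  moreover have "P (w - a) 0 = g w" if "w \<in> ball a (e / 4)" for w
  proof -
    have n: "norm (w - a) < e / 4" using that by (simp add: dist_norm norm_minus_commute)
    define x y where "x = Re (w - a)" and "y = Im (w - a)"
    have xy: "\<bar>x\<bar> < e / 4" "\<bar>y\<bar> < e / 4"
      using abs_Re_le_cmod[of "w - a"] abs_Im_le_cmod[of "w - a"] n unfolding x_def y_def by linarith+
    have w: "w - a = of_real x + \<i> * of_real y" by (simp add: x_def y_def complex_eq_iff)
    have "P (w - a) 0 = P (of_real x) (of_real y)"
      using R0[of "of_real x" "of_real y"] xy w by (simp add: R_def)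
    also have "\<dots> = g (a + Complex x y)" using gP xy e by simp
    also have "a + Complex x y = w" by (simp add: x_def y_def complex_eq_iff)
    finally show ?thesis .
  qed
  ultimately show ?thesis by (rule holomorphic_transform)
qed

text \<open>A Laurent series shows holomorphy only near one puncture, while the residue theorem asks
  for all of \<open>- {0, 1}\<close>. The local lemma spreads holomorphy over balls, and
  connectedness completes the argument.\<close>

lemma ranalytic_holomorphic_continuation:
  assumes g: "\<And>p. p \<in> - {0, 1} \<Longrightarrow> ranalytic g p"
    and "\<rho> > 0" and hol: "g holomorphic_on ball 0 \<rho> - {0}"
  shows "g holomorphic_on - {0, 1}"
proof -
  define Q where "Q = (\<lambda>p. \<exists>r>0. g holomorphic_on ball p r)"
  define s where "s = min (\<rho> / 2) (1 / 2)"
  have s: "s > 0" "s < \<rho>" "s < 1" using \<open>\<rho> > 0\<close> by (auto simp: s_def)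
  have "Q p" if p: "p \<in> - {0, 1}" for p
  proof (rule connected_induction_simple[OF connected_punctured2])
    show "of_real s \<in> - {0, 1 :: complex}" using s by auto
    have "open (ball 0 \<rho> - {0 :: complex})" "of_real s \<in> ball 0 \<rho> - {0 :: complex}" using s by auto
    then obtain r where "r > 0" "ball (of_real s) r \<subseteq> ball 0 \<rho> - {0 :: complex}"
      using open_contains_ball by blast
    thus "Q (of_real s)" unfolding Q_def using hol holomorphic_on_subset by blast
  next
    fix a :: complex assume a: "a \<in> - {0, 1}"
    obtain e P where e: "e > 0" and P: "biholo P e"
      and gP: "\<And>x y. \<bar>x\<bar> < e \<Longrightarrow> \<bar>y\<bar> < e \<Longrightarrow> g (a + Complex x y) = P (of_real x) (of_real y)"
      using g[OF a] unfolding ranalytic_def by blast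
    have "Q y" if xy: "x \<in> ball a (e / 4)" "y \<in> ball a (e / 4)" "Q x" for x y
    proof -
      obtain r where "r > 0" "g holomorphic_on ball x r" using xy(3) unfolding Q_def by blast
      hence "g holomorphic_on ball a (e / 4)"
        by (intro ranalytic_holomorphic_local[OF e P _ xy(1)]) (auto intro: gP)
      moreover obtain r' where "r' > 0" "ball y r' \<subseteq> ball a (e / 4)"
        using xy(2) open_ball open_contains_ball by blast
      ultimately show "Q y" unfolding Q_def using holomorphic_on_subset by blast
    qed
    moreover have "openin (top_of_set (- {0, 1})) (- {0, 1} \<inter> ball a (e / 4))"
      by (rule openin_open_Int) simp
    ultimately show "\<exists>T. openin (top_of_set (- {0, 1})) T \<and> a \<in> T \<and> (\<forall>x\<in>T. \<forall>y\<in>T. Q x \<longrightarrow> Q y)"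
    proof (intro exI[of _ "- {0, 1} \<inter> ball a (e / 4)"] conjI ballI impI)
      show "a \<in> - {0, 1} \<inter> ball a (e / 4)" using a e by simp
    qed blast+
  qed fact
  hence "g analytic_on - {0, 1}" unfolding analytic_on_def Q_def by blast
  thus ?thesis by (rule analytic_imp_holomorphic)
qed

section \<open>Expansions of correlation functions\<close>

text \<open>Summable families of complex numbers are absolutely summable, which justifies summing
  over the product.\<close>

lemma has_sum_product_complex:
  fixes f :: "'i \<Rightarrow> complex" and g :: "'j \<Rightarrow> complex"
  assumes f: "(f has_sum a) A" and g: "(g has_sum b) B"
  shows "((\<lambda>(x, y). f x * g y) has_sum (a * b)) (A \<times> B)"
proof (rule has_sum_SigmaI)
  have fa: "(\<lambda>x. norm (f x)) summable_on A" and ga: "(\<lambda>x. norm (g x)) summable_on B"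
    using f g has_sum_imp_summable summable_on_iff_abs_summable_on_complex by blast+
  have 1: "(\<lambda>y. norm (f x * g y)) summable_on B" for x
    using summable_on_cmult_right[OF ga, of "norm (f x)"] by (simp add: norm_mult)
  have "(\<lambda>x. norm (f x) * (\<Sum>\<^sub>\<infinity>y\<in>B. norm (g y))) summable_on A"
    by (rule summable_on_cmult_left[OF fa])
  hence 2: "(\<lambda>x. \<bar>\<Sum>\<^sub>\<infinity>y\<in>B. norm (f x * g y)\<bar>) summable_on A"
    by (simp add: norm_mult infsum_cmult_right[OF ga] abs_mult infsum_nonneg)
  show "((\<lambda>y. (\<lambda>(x, y). f x * g y) (x, y)) has_sum f x * b) B" if "x \<in> A" for x
    using has_sum_cmult_right[OF g] by simp
  show "((\<lambda>x. f x * b) has_sum a * b) A"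
    by (rule has_sum_cmult_left[OF f])
  have "(\<lambda>z. norm ((\<lambda>(x, y). f x * g y) z)) summable_on A \<times> B"
    using Infinite_Sum.abs_summable_on_Sigma_iff[of "\<lambda>(x, y). f x * g y" A "\<lambda>_. B"] 1 2
    by simp
  thus "(\<lambda>(x, y). f x * g y) summable_on A \<times> B"
    by (rule Infinite_Sum.abs_summable_summable)
qed

text \<open>The Taylor coefficients of \<open>(1 - p)^\<alpha>\<close>, which are the factors in
  \<open>binom_mult\<close>.\<close>

definition signed_binom :: "real \<Rightarrow> nat \<Rightarrow> real" where
  "signed_binom \<alpha> k = (- 1) ^ k * (\<alpha> gchoose k)"

lemma signed_binom_0 [simp]: "signed_binom \<alpha> 0 = 1"
  by (simp add: signed_binom_def)

lemma signed_binom_has_sum: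
  assumes p: "norm (p :: complex) < 1"
  shows "((\<lambda>k. of_real (signed_binom \<alpha> k) * p ^ k) has_sum (1 - p) powr of_real \<alpha>) UNIV"
proof -
  have eq: "(\<lambda>k. of_real (signed_binom \<alpha> k) * q ^ k) = (\<lambda>k. (of_real \<alpha> gchoose k) * (- q) ^ k)" for q :: complex
  proof
    fix k
    have "(- q) ^ k = (- 1) ^ k * q ^ k" by (rule power_minus)
    moreover have "(of_real \<alpha> gchoose k :: complex) = of_real (\<alpha> gchoose k)"
      by (simp add: gbinomial_prod_rev)
    ultimately show "of_real (signed_binom \<alpha> k) * q ^ k = (of_real \<alpha> gchoose k) * (- q) ^ k" 
      by (simp add: signed_binom_def)
  qed
  have sums: "(\<lambda>k. of_real (signed_binom \<alpha> k) * q ^ k) sums (1 - q) powr of_real \<alpha>" if "norm q < 1" for q :: complex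
    using gen_binomial_complex[of "- q" "of_real \<alpha>"] that unfolding eq by simp
  show ?thesis
  proof (rule norm_summable_imp_has_sum[OF _ sums[OF p]])
    \<comment> \<open>A point of modulus strictly between \<open>|p|\<close> and 1: convergence at
      \<open>x\<close> gives absolute convergence at \<open>p\<close>.\<close>
    define x :: complex where "x = of_real ((1 + norm p) / 2)"
    have nx: "norm x = (1 + norm p) / 2" unfolding x_def norm_of_real by simp
    show "summable (\<lambda>k. norm (of_real (signed_binom \<alpha> k) * p ^ k))"
    proof (rule powser_insidea)
      show "summable (\<lambda>k. of_real (signed_binom \<alpha> k) * x ^ k)"
        using sums[of x] p nx by (simp add: sums_iff)
    qed (use p nx in simp)
  qed
qed

lemma zpow_one_minus_has_sum:
  assumes p: "norm p < 1" and ab: "\<alpha> - \<beta> \<in> \<int>"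
  shows "((\<lambda>(k, l). of_real (signed_binom \<alpha> k * signed_binom \<beta> l) * (p ^ k * cnj p ^ l)) 
            has_sum zpow \<alpha> \<beta> (1 - p)) UNIV"
proof -
  have "((\<lambda>(k, l). (of_real (signed_binom \<alpha> k) * p ^ k) * (of_real (signed_binom \<beta> l) * cnj p ^ l)) has_sum
      ((1 - p) powr of_real \<alpha> * (1 - cnj p) powr of_real \<beta>)) (UNIV \<times> UNIV)"
    by (intro has_sum_product_complex signed_binom_has_sum) (use p in auto)
  moreover have "(1 - p) powr of_real \<alpha> * (1 - cnj p) powr of_real \<beta> = zpow \<alpha> \<beta> (1 - p)"
  proof -
    have re: "Re (1 - p) > 0" using p abs_Re_le_cmod[of p] by simp
    hence nz: "1 - p \<noteq> 0" "1 - cnj p \<noteq> 0" by (auto simp: complex_eq_iff)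
    have "Ln (1 - cnj p) = cnj (Ln (1 - p))"
      using re by (subst cnj_Ln) (auto simp: complex_nonpos_Reals_iff)
    thus ?thesis using ab nz by (simp add: zpow_exp powr_def exp_add)
  qed
  ultimately show ?thesis by (simp add: mult_ac case_prod_unfold)
qed

text \<open>A weakening of \<open>expands_at_0\<close> to pointwise sums, which makes it easy to
  transport along products, shifts and conjugation. The radius is existential, so only the germ of
  \<open>g\<close> at 0 matters.\<close>

definition expansion :: "(complex \<Rightarrow> complex) \<Rightarrow> complex series2 \<Rightarrow> bool" where
  "expansion g A \<longleftrightarrow> (\<exists>N. \<forall>r s. A r s \<noteq> 0 \<longrightarrow> N \<le> r \<and> N \<le> s) \<and>
     (\<forall>r s. A r s \<noteq> 0 \<longrightarrow> r - s \<in> \<int>) \<and>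
     (\<exists>\<rho>>0. \<forall>p \<in> ball 0 \<rho> - {0}. ((\<lambda>(r, s). A r s * zpow r s p) has_sum g p) UNIV)"

lemma expansionI:
  assumes "\<And>r s. A r s \<noteq> 0 \<Longrightarrow> N \<le> r \<and> N \<le> s" "\<And>r s. A r s \<noteq> 0 \<Longrightarrow> r - s \<in> \<int>" "\<rho> > 0"
    "\<And>p. p \<noteq> 0 \<Longrightarrow> norm p < \<rho> \<Longrightarrow> ((\<lambda>(r, s). A r s * zpow r s p) has_sum g p) UNIV"
  shows "expansion g A"
  unfolding expansion_def
proof (intro conjI)
  show "\<exists>N. \<forall>r s. A r s \<noteq> 0 \<longrightarrow> N \<le> r \<and> N \<le> s" using assms(1) by blast
  show "\<forall>r s. A r s \<noteq> 0 \<longrightarrow> r - s \<in> \<int>" using assms(2) by blast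
  show "\<exists>\<rho>>0. \<forall>p \<in> ball 0 \<rho> - {0}. ((\<lambda>(r, s). A r s * zpow r s p) has_sum g p) UNIV"
    using assms(3,4) by (intro exI[of _ \<rho>]) simp
qed

lemma expansionD:
  assumes "expansion g A"
  shows "\<exists>N \<rho>. (\<forall>r s. A r s \<noteq> 0 \<longrightarrow> N \<le> r) \<and> (\<forall>r s. A r s \<noteq> 0 \<longrightarrow> N \<le> s) \<and>
    (\<forall>r s. A r s \<noteq> 0 \<longrightarrow> r - s \<in> \<int>) \<and> \<rho> > 0 \<and>
    (\<forall>p. p \<noteq> 0 \<longrightarrow> norm p < \<rho> \<longrightarrow> ((\<lambda>(r, s). A r s * zpow r s p) has_sum g p) UNIV)"
proof -
  obtain N \<rho> where "\<forall>r s. A r s \<noteq> 0 \<longrightarrow> N \<le> r \<and> N \<le> s" "\<forall>r s. A r s \<noteq> 0 \<longrightarrow> r - s \<in> \<int>" "\<rho> > 0"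
    "\<forall>p \<in> ball 0 \<rho> - {0}. ((\<lambda>(r, s). A r s * zpow r s p) has_sum g p) UNIV"
    using assms unfolding expansion_def by blast
  thus ?thesis by (intro exI[of _ N] exI[of _ \<rho>]) auto
qed

lemma expansion_cong:
  assumes "expansion g A" "\<rho> > 0" "\<And>p. p \<noteq> 0 \<Longrightarrow> norm p < \<rho> \<Longrightarrow> g p = h p" "\<And>r s. A r s = B r s"
  shows "expansion h B"
proof -
  have AB: "A = B" using assms(4) by blast
  obtain N \<rho>' where 1: "\<And>r s. A r s \<noteq> 0 \<Longrightarrow> N \<le> r" "\<And>r s. A r s \<noteq> 0 \<Longrightarrow> N \<le> s" 
    "\<And>r s. A r s \<noteq> 0 \<Longrightarrow> r - s \<in> \<int>" "\<rho>' > 0"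
    "\<And>p. p \<noteq> 0 \<Longrightarrow> norm p < \<rho>' \<Longrightarrow> ((\<lambda>(r, s). A r s * zpow r s p) has_sum g p) UNIV"
    using expansionD[OF assms(1)] by blast
  show ?thesis unfolding AB[symmetric]
  proof (rule expansionI[of _ N "min \<rho> \<rho>'"])
    fix p :: complex assume "p \<noteq> 0" "norm p < min \<rho> \<rho>'"
    thus "((\<lambda>(r, s). A r s * zpow r s p) has_sum h p) UNIV"
      using 1(5)[of p] assms(3)[of p] by simp
  next
    show "min \<rho> \<rho>' > 0" using 1(4) assms(2) by simp
  qed (use 1 in \<open>blast+\<close>)
qed

text \<open>This goes from the series to the germ of the function. Unknown coefficients are later
  found by evaluating two closed forms at a point.\<close>

lemma expansion_unique_function:
  assumes "expansion g A" "expansion h A"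
  obtains \<rho> where "\<rho> > 0" "\<And>p. p \<noteq> 0 \<Longrightarrow> norm p < \<rho> \<Longrightarrow> g p = h p"
proof -
  obtain \<rho>1 where 1: "\<rho>1 > 0"
    "\<And>p. p \<noteq> 0 \<Longrightarrow> norm p < \<rho>1 \<Longrightarrow> ((\<lambda>(r, s). A r s * zpow r s p) has_sum g p) UNIV"
    using expansionD[OF assms(1)] by blast
  obtain \<rho>2 where 2: "\<rho>2 > 0"
    "\<And>p. p \<noteq> 0 \<Longrightarrow> norm p < \<rho>2 \<Longrightarrow> ((\<lambda>(r, s). A r s * zpow r s p) has_sum h p) UNIV"
    using expansionD[OF assms(2)] by blast
  show ?thesis
  proof (rule that[of "min \<rho>1 \<rho>2"])
    show "min \<rho>1 \<rho>2 > 0" using 1(1) 2(1) by simp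
    show "g p = h p" if "p \<noteq> 0" "norm p < min \<rho>1 \<rho>2" for p
      using 1(2)[of p] 2(2)[of p] that has_sum_unique by auto
  qed
qed

lemma expansion_zero: "expansion (\<lambda>_. 0) (\<lambda>_ _. 0)"
  by (rule expansionI[of _ 0 1]) (auto simp: case_prod_unfold)

lemma expansion_add:
  assumes "expansion g A" "expansion h B"
  shows "expansion (\<lambda>p. g p + h p) (\<lambda>r s. A r s + B r s)"
proof -
  obtain N \<rho> where 1: "\<And>r s. A r s \<noteq> 0 \<Longrightarrow> N \<le> r" "\<And>r s. A r s \<noteq> 0 \<Longrightarrow> N \<le> s" 
    "\<And>r s. A r s \<noteq> 0 \<Longrightarrow> r - s \<in> \<int>" "\<rho> > 0"
    "\<And>p. p \<noteq> 0 \<Longrightarrow> norm p < \<rho> \<Longrightarrow> ((\<lambda>(r, s). A r s * zpow r s p) has_sum g p) UNIV"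
    using expansionD[OF assms(1)] by blast
  obtain N' \<rho>' where 2: "\<And>r s. B r s \<noteq> 0 \<Longrightarrow> N' \<le> r" "\<And>r s. B r s \<noteq> 0 \<Longrightarrow> N' \<le> s" 
    "\<And>r s. B r s \<noteq> 0 \<Longrightarrow> r - s \<in> \<int>" "\<rho>' > 0"
    "\<And>p. p \<noteq> 0 \<Longrightarrow> norm p < \<rho>' \<Longrightarrow> ((\<lambda>(r, s). B r s * zpow r s p) has_sum h p) UNIV"
    using expansionD[OF assms(2)] by blast
  show ?thesis
  proof (rule expansionI[of _ "min N N'" "min \<rho> \<rho>'"])
    fix r s assume "A r s + B r s \<noteq> 0"
    hence *: "A r s \<noteq> 0 \<or> B r s \<noteq> 0" by auto
    show "min N N' \<le> r \<and> min N N' \<le> s" using * 1(1,2)[of r s] 2(1,2)[of r s] by auto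
    show "r - s \<in> \<int>" using * 1 2 by blast
  next
    fix p :: complex assume "p \<noteq> 0" "norm p < min \<rho> \<rho>'"
    thus "((\<lambda>(r, s). (A r s + B r s) * zpow r s p) has_sum (g p + h p)) UNIV"
      using has_sum_add[OF 1(5)[of p] 2(5)[of p]] by (simp add: case_prod_unfold ring_distribs)
  next
    show "min \<rho> \<rho>' > 0" using 1(4) 2(4) by simp
  qed
qed

lemma expansion_scale:
  assumes "expansion g A"
  shows "expansion (\<lambda>p. k * g p) (\<lambda>r s. k * A r s)"
proof -
  obtain N \<rho> where 1: "\<And>r s. A r s \<noteq> 0 \<Longrightarrow> N \<le> r" "\<And>r s. A r s \<noteq> 0 \<Longrightarrow> N \<le> s" 
    "\<And>r s. A r s \<noteq> 0 \<Longrightarrow> r - s \<in> \<int>" "\<rho> > 0"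
    "\<And>p. p \<noteq> 0 \<Longrightarrow> norm p < \<rho> \<Longrightarrow> ((\<lambda>(r, s). A r s * zpow r s p) has_sum g p) UNIV"
    using expansionD[OF assms(1)] by blast
  show ?thesis
  proof (rule expansionI[of _ N \<rho>])
    fix p :: complex assume "p \<noteq> 0" "norm p < \<rho>"
    thus "((\<lambda>(r, s). (k * A r s) * zpow r s p) has_sum (k * g p)) UNIV"
      using has_sum_cmult_right[OF 1(5)[of p], of k] by (simp add: case_prod_unfold mult.assoc)
  next
    fix r s assume "k * A r s \<noteq> 0"
    hence *: "A r s \<noteq> 0" by auto
    show "N \<le> r \<and> N \<le> s" "r - s \<in> \<int>" using 1(1-3)[OF *] by auto
  qed (fact 1(4))
qed

lemma expansion_shift:
  assumes "expansion g A" and ab: "\<alpha> - \<beta> \<in> \<int>"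
  shows "expansion (\<lambda>p. zpow \<alpha> \<beta> p * g p) (\<lambda>r s. A (r - \<alpha>) (s - \<beta>))"
proof -
  obtain N \<rho> where 1: "\<And>r s. A r s \<noteq> 0 \<Longrightarrow> N \<le> r" "\<And>r s. A r s \<noteq> 0 \<Longrightarrow> N \<le> s" 
    "\<And>r s. A r s \<noteq> 0 \<Longrightarrow> r - s \<in> \<int>" "\<rho> > 0"
    "\<And>p. p \<noteq> 0 \<Longrightarrow> norm p < \<rho> \<Longrightarrow> ((\<lambda>(r, s). A r s * zpow r s p) has_sum g p) UNIV"
    using expansionD[OF assms(1)] by blast
  show ?thesis
  proof (rule expansionI[of _ "N + min \<alpha> \<beta>" \<rho>])
    fix r s assume *: "A (r - \<alpha>) (s - \<beta>) \<noteq> 0"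
    show "N + min \<alpha> \<beta> \<le> r \<and> N + min \<alpha> \<beta> \<le> s" using 1(1,2)[OF *] by linarith
    have "(r - \<alpha> - (s - \<beta>)) + (\<alpha> - \<beta>) \<in> \<int>" using 1(3)[OF *] ab by (rule Ints_add)
    thus "r - s \<in> \<int>" by simp
  next
    fix p :: complex assume p: "p \<noteq> 0" "norm p < \<rho>"
    have "((\<lambda>(r, s). zpow \<alpha> \<beta> p * (A r s * zpow r s p)) has_sum zpow \<alpha> \<beta> p * g p) UNIV"
      using has_sum_cmult_right[OF 1(5)[OF p]] by (simp add: case_prod_unfold)
    also have "?this \<longleftrightarrow> ((\<lambda>(r, s). A (r - \<alpha>) (s - \<beta>) * zpow r s p) has_sum (zpow \<alpha> \<beta> p * g p)) UNIV"
    proof (rule has_sum_reindex_bij_witness[of _ "\<lambda>(r, s). (r - \<alpha>, s - \<beta>)" "\<lambda>(r, s). (r + \<alpha>, s + \<beta>)"], goal_cases)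
      case (5 x)
      obtain r s where x: "x = (r, s)" by (cases x)
      have "A r s * zpow (r + \<alpha>) (s + \<beta>) p = zpow \<alpha> \<beta> p * (A r s * zpow r s p)"
        using 1(3)[of r s] ab p by (cases "A r s = 0") (auto simp: zpow_add)
      thus ?case by (simp add: x)
    qed auto
    finally show "((\<lambda>(r, s). A (r - \<alpha>) (s - \<beta>) * zpow r s p) has_sum (zpow \<alpha> \<beta> p * g p)) UNIV" .
  qed (use 1 in \<open>blast+\<close>)
qed

lemma expansion_uminus:
  assumes "expansion g A"
  shows "expansion (\<lambda>p. g (- p)) (\<lambda>r s. (- 1) powi \<lfloor>r - s\<rfloor> * A r s)"
proof -
  obtain N \<rho> where 1: "\<And>r s. A r s \<noteq> 0 \<Longrightarrow> N \<le> r" "\<And>r s. A r s \<noteq> 0 \<Longrightarrow> N \<le> s" 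
    "\<And>r s. A r s \<noteq> 0 \<Longrightarrow> r - s \<in> \<int>" "\<rho> > 0"
    "\<And>p. p \<noteq> 0 \<Longrightarrow> norm p < \<rho> \<Longrightarrow> ((\<lambda>(r, s). A r s * zpow r s p) has_sum g p) UNIV"
    using expansionD[OF assms(1)] by blast
  show ?thesis
  proof (rule expansionI[of _ N \<rho>])
    fix p :: complex assume "p \<noteq> 0" "norm p < \<rho>"
    thus "((\<lambda>(r, s). ((- 1) powi \<lfloor>r - s\<rfloor> * A r s) * zpow r s p) has_sum (g (- p))) UNIV"
      using 1(5)[of "- p"] by (simp add: zpow_uminus mult_ac)
  next
    fix r s assume "(- 1) powi \<lfloor>r - s\<rfloor> * A r s \<noteq> 0"
    hence *: "A r s \<noteq> 0" by auto
    show "N \<le> r \<and> N \<le> s" "r - s \<in> \<int>" using 1(1-3)[OF *] by auto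
  qed (fact 1(4))
qed

lemma expansion_cnj:
  assumes "expansion g A"
  shows "expansion (\<lambda>p. g (cnj p)) (\<lambda>r s. A s r)"
proof -
  obtain N \<rho> where 1: "\<And>r s. A r s \<noteq> 0 \<Longrightarrow> N \<le> r" "\<And>r s. A r s \<noteq> 0 \<Longrightarrow> N \<le> s" 
    "\<And>r s. A r s \<noteq> 0 \<Longrightarrow> r - s \<in> \<int>" "\<rho> > 0"
    "\<And>p. p \<noteq> 0 \<Longrightarrow> norm p < \<rho> \<Longrightarrow> ((\<lambda>(r, s). A r s * zpow r s p) has_sum g p) UNIV"
    using expansionD[OF assms(1)] by blast
  show ?thesis
  proof (rule expansionI[of _ N \<rho>])
    fix r s assume *: "A s r \<noteq> 0"
    show "N \<le> r \<and> N \<le> s" using 1(1,2)[OF *] by auto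
    show "r - s \<in> \<int>" using 1(3)[OF *] Ints_minus by fastforce
  next
    fix p :: complex assume p: "p \<noteq> 0" "norm p < \<rho>"
    have "((\<lambda>(r, s). A r s * zpow r s (cnj p)) has_sum g (cnj p)) UNIV"
      using 1(5)[of "cnj p"] p by simp
    also have "?this \<longleftrightarrow> ((\<lambda>(r, s). A s r * zpow r s p) has_sum (g (cnj p))) UNIV"
    proof (rule has_sum_reindex_bij_witness[of _ "\<lambda>(r, s). (s, r)" "\<lambda>(r, s). (s, r)"], goal_cases)
      case (5 x)
      obtain r s where x: "x = (r, s)" by (cases x)
      have "A r s * zpow s r p = A r s * zpow r s (cnj p)"
        using 1(3)[of r s] p by (cases "A r s = 0") (auto simp: zpow_cnj)
      thus ?case by (simp add: x)
    qed auto
    finally show "((\<lambda>(r, s). A s r * zpow r s p) has_sum (g (cnj p))) UNIV" .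
  qed (use 1 in \<open>blast+\<close>)
qed

lemma expansion_expands_at_0:
  assumes "expands_at_0 g A"
  shows "expansion g A"
proof -
  note * = assms[unfolded expands_at_0_def formal_laurent_def formal_series_def]
  obtain N where N: "\<forall>r s. A r s \<noteq> 0 \<longrightarrow> N \<le> r \<and> N \<le> s"
    using * by meson
  have int: "\<forall>r s. A r s \<noteq> 0 \<longrightarrow> r - s \<in> \<int>"
    using * by meson
  obtain \<rho> where \<rho>: "\<rho> > 0" "\<forall>K. compact K \<and> K \<subseteq> ball 0 \<rho> - {0} \<longrightarrow>
           uniform_limit K (\<lambda>X p. \<Sum>(r, s)\<in>X. A r s * zpow r s p) g (finite_subsets_at_top UNIV)"
    using * by meson
  show ?thesis
  proof (rule expansionI[of _ N \<rho>])
    fix p :: complex assume p: "p \<noteq> 0" "norm p < \<rho>"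
    \<comment> \<open>Compact convergence is used on the one-point set \<open>{p}\<close>.\<close>
    have "uniform_limit {p} (\<lambda>X p. \<Sum>(r, s)\<in>X. A r s * zpow r s p) g (finite_subsets_at_top UNIV)"
      using p by (intro \<rho>(2)[rule_format]) auto
    hence "((\<lambda>X. \<Sum>(r, s)\<in>X. A r s * zpow r s p) \<longlongrightarrow> g p) (finite_subsets_at_top UNIV)"
      by (rule tendsto_uniform_limitI) simp
    thus "((\<lambda>(r, s). A r s * zpow r s p) has_sum g p) UNIV"
      by (simp add: has_sum_def)
  qed (use N int \<rho> in blast)+
qed

text \<open>The product of two absolutely convergent series runs over quadruples. After reindexing
  by the total exponent, the inner sum over \<open>(k, l)\<close> is finite, as \<open>A\<close> is
  truncated from below, and equals \<open>binom_mult\<close>.\<close>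

lemma expansion_binom_mult:
  assumes "expansion g A" and ab: "\<alpha> - \<beta> \<in> \<int>"
  shows "expansion (\<lambda>p. zpow \<alpha> \<beta> (1 - p) * g p) (binom_mult \<alpha> \<beta> A)"
proof -
  obtain N \<rho> where 1: "\<And>r s. A r s \<noteq> 0 \<Longrightarrow> N \<le> r" "\<And>r s. A r s \<noteq> 0 \<Longrightarrow> N \<le> s" 
    "\<And>r s. A r s \<noteq> 0 \<Longrightarrow> r - s \<in> \<int>" "\<rho> > 0"
    "\<And>p. p \<noteq> 0 \<Longrightarrow> norm p < \<rho> \<Longrightarrow> ((\<lambda>(r, s). A r s * zpow r s p) has_sum g p) UNIV"
    using expansionD[OF assms(1)] by blast
  define T where "T = (\<lambda>r s. {(k, l). A (r - real k) (s - real l) \<noteq> 0})"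
  have fin: "finite (T r s)" for r s
  proof (rule finite_subset)
    show "T r s \<subseteq> {..nat \<lceil>r - N\<rceil>} \<times> {..nat \<lceil>s - N\<rceil>}"
    proof
      fix x assume "x \<in> T r s"
      then obtain k l where x: "x = (k, l)" "A (r - real k) (s - real l) \<noteq> 0" by (auto simp: T_def)
      have "real k \<le> r - N" "real l \<le> s - N" using 1(1,2)[OF x(2)] by auto
      thus "x \<in> {..nat \<lceil>r - N\<rceil>} \<times> {..nat \<lceil>s - N\<rceil>}" unfolding x by (auto simp: le_nat_iff) linarith+
    qed
  qed auto
  have bm: "binom_mult \<alpha> \<beta> A r s = 
       (\<Sum>(k, l) \<in> T r s. of_real (signed_binom \<alpha> k * signed_binom \<beta> l) * A (r - real k) (s - real l))" for r s
    unfolding binom_mult_def T_def signed_binom_def by simp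
  have nz: "\<exists>k l. A (r - real k) (s - real l) \<noteq> 0" if "binom_mult \<alpha> \<beta> A r s \<noteq> 0" for r s
  proof (rule ccontr)
    assume "\<not> ?thesis" hence "T r s = {}" by (auto simp: T_def)
    thus False using that by (simp add: bm)
  qed
  show ?thesis
  proof (rule expansionI[of _ N "min \<rho> 1"])
    fix r s assume "binom_mult \<alpha> \<beta> A r s \<noteq> 0"
    then obtain k l where *: "A (r - real k) (s - real l) \<noteq> 0" using nz by blast
    show "N \<le> r \<and> N \<le> s" using 1(1,2)[OF *] by auto
    have kl: "real k - real l \<in> \<int>" by simp
    show "r - s \<in> \<int>" using Ints_add[OF 1(3)[OF *] kl] by (simp add: algebra_simps)
  next
    fix p :: complex assume p: "p \<noteq> 0" "norm p < min \<rho> 1"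
    define h where "h = (\<lambda>((r, s), (k, l)). of_real (signed_binom \<alpha> k * signed_binom \<beta> l) * A (r - real k) (s - real l) * zpow r s p)"
    have "((\<lambda>(x, y). (\<lambda>(r, s). A r s * zpow r s p) x * 
            (\<lambda>(k, l). of_real (signed_binom \<alpha> k * signed_binom \<beta> l) * (p ^ k * cnj p ^ l)) y) has_sum
            g p * zpow \<alpha> \<beta> (1 - p)) (UNIV \<times> UNIV)"
      by (intro has_sum_product_complex zpow_one_minus_has_sum 1 ab) (use p in auto)
    also have "?this \<longleftrightarrow> (h has_sum g p * zpow \<alpha> \<beta> (1 - p)) (UNIV \<times> UNIV)"
    proof (rule has_sum_reindex_bij_witness[of _ "\<lambda>((r, s), (k, l)). ((r - real k, s - real l), (k, l))" 
             "\<lambda>((r, s), (k, l)). ((r + real k, s + real l), (k, l))"], goal_cases)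
      case (5 x)
      obtain r s k l where x: "x = ((r, s), (k, l))" by (metis surj_pair)
      have "A r s * zpow (r + real k) (s + real l) p = A r s * (zpow r s p * (p ^ k * cnj p ^ l))"
      proof (cases "A r s = 0")
        case False
        have kl: "real k - real l \<in> \<int>" by auto
        show ?thesis using p 1(3)[OF False] zpow_add[OF p(1) _ kl] by (simp add: zpow_nat)
      qed auto
      thus ?case by (auto simp: x h_def mult_ac)
    qed auto
    finally have "(h has_sum g p * zpow \<alpha> \<beta> (1 - p)) (UNIV \<times> UNIV)" .
    moreover have "((\<lambda>y. h (x, y)) has_sum (case x of (r, s) \<Rightarrow> binom_mult \<alpha> \<beta> A r s * zpow r s p)) UNIV" for x
    proof -
      obtain r s where x: "x = (r, s)" by (cases x)
      show ?thesis unfolding x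
        by (rule has_sum_finite_neutralI[OF fin[of r s]])
           (auto simp: h_def bm T_def sum_distrib_right case_prod_unfold)
    qed
    ultimately have "((\<lambda>(r, s). binom_mult \<alpha> \<beta> A r s * zpow r s p) has_sum g p * zpow \<alpha> \<beta> (1 - p)) UNIV"
      by (rule has_sum_SigmaD) 
    thus "((\<lambda>(r, s). binom_mult \<alpha> \<beta> A r s * zpow r s p) has_sum (zpow \<alpha> \<beta> (1 - p) * g p)) UNIV"
      by (simp add: mult.commute)
  next
    show "min \<rho> 1 > 0" using 1(4) by simp
  qed
qed

text \<open>
  The function \<open>g\<close> is \<open>p \<mapsto> \<mu> 1 p\<close> for the part of \<open>\<mu>\<close> that is homogeneous of bidegree
  \<open>(d, e)\<close>; homogeneity turns the three expansions of \<open>\<mu>\<close> into expansions of \<open>g\<close> at \<open>0, 1, \<infinity>\<close>.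
\<close>

definition correlator ::
  "real \<Rightarrow> real \<Rightarrow> complex series4 \<Rightarrow> complex series4 \<Rightarrow> complex series4 \<Rightarrow> (complex \<Rightarrow> complex) \<Rightarrow> bool"
where
  "correlator d e E12 E02 E21 g \<longleftrightarrow>
     (\<forall>p\<in>- {0, 1}. ranalytic g p) \<and>
     expansion g (\<lambda>r s. E12 (d - r) (e - s) r s) \<and>
     expansion (\<lambda>q. zpow d e (1 + q) * g (1 / (1 + q))) (\<lambda>r s. E02 r s (d - r) (e - s)) \<and>
     expansion (\<lambda>q. zpow d e q * g (1 / q)) (\<lambda>r s. E21 r s (d - r) (e - s))"

lemma ranalytic_F_01inf: "f \<in> F_01inf \<Longrightarrow> p \<in> - {0, 1} \<Longrightarrow> ranalytic f p"
  unfolding F_01inf_def by (blast intro: ranalytic_if_real_analytic_at)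

lemma zpow_divide:
  assumes "w \<noteq> 0" "r - s \<in> \<int>"
  shows "zpow r s (z / w) = zpow r s z * zpow (- r) (- s) w"
  using zpow_mult[of r s z "1 / w"] zpow_inverse[OF assms] by simp

text \<open>A generator is homogeneous of the bidegree given by the sums of its exponents: for any
  other \<open>(d, e)\<close> its three expansions contribute nothing and \<open>g = 0\<close>
  serves. For the right bidegree, rescaling to \<open>z2 = 1\<close> produces the factors
  \<open>zpow d e (1 + q)\<close> and \<open>zpow d e q\<close> with \<open>z1 = 1 + q\<close> and
  \<open>z1 = q\<close>.\<close>

lemma GCor2_correlator:
  assumes "GCor2 \<mu> E12 E02 E21" "d - e \<in> \<int>"
  shows "\<exists>g. correlator d e E12 E02 E21 g"
  using assms(1)
proof induction
  case (generator f \<alpha>1 \<beta>1 \<alpha>2 \<beta>2 \<alpha>12 \<beta>12 A B C)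
  show ?case
  proof (cases "d = \<alpha>1 + \<alpha>2 + \<alpha>12 \<and> e = \<beta>1 + \<beta>2 + \<beta>12")
    case False
    have "correlator d e (expand_12 \<alpha>1 \<alpha>2 \<alpha>12 \<beta>1 \<beta>2 \<beta>12 A)
          (expand_02 \<alpha>1 \<alpha>2 \<alpha>12 \<beta>1 \<beta>2 \<beta>12 B)
          (expand_21 \<alpha>1 \<alpha>2 \<alpha>12 \<beta>1 \<beta>2 \<beta>12 C) (\<lambda>_. 0)"
      using False expansion_zero 
      unfolding correlator_def expand_12_def expand_02_def expand_21_def by (auto simp: if_distrib cong: if_cong)
    thus ?thesis by blast
  next
    case True
    hence d: "d = \<alpha>1 + \<alpha>2 + \<alpha>12" and e: "e = \<beta>1 + \<beta>2 + \<beta>12" by auto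
    note ints = generator(2-4)
    have cancel1: "x * (a * y) = a * b * c * (inverse b * (x * inverse c * y))"
      and cancel2: "x * (a * (y * y')) = a * b * c * (inverse b * (x * y * inverse c * y'))"
      if "b \<noteq> 0" "c \<noteq> 0" for a b c x y y' :: complex
      using that by (simp_all add: field_simps)
    define g where "g = (\<lambda>p. zpow \<alpha>2 \<beta>2 p * (zpow \<alpha>12 \<beta>12 (1 - p) * f p))"
    have "ranalytic g p" if "p \<in> - {0, 1}" for p
      unfolding g_def using that ints generator(1)
      by (intro ranalytic_mult ranalytic_zpow ranalytic_zpow_one_minus ranalytic_F_01inf) auto
    moreover have "expansion g (\<lambda>r s. expand_12 \<alpha>1 \<alpha>2 \<alpha>12 \<beta>1 \<beta>2 \<beta>12 A (d - r) (e - s) r s)"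
    proof (rule expansion_cong)
      show "expansion g (\<lambda>r s. binom_mult \<alpha>12 \<beta>12 A (r - \<alpha>2) (s - \<beta>2))"
        unfolding g_def using generator(5) ints
        by (intro expansion_shift expansion_binom_mult expansion_expands_at_0) (auto simp: j_0_def)
    qed (auto simp: expand_12_def d e intro: zero_less_one)
    moreover have "expansion (\<lambda>q. zpow d e (1 + q) * g (1 / (1 + q))) 
        (\<lambda>r s. expand_02 \<alpha>1 \<alpha>2 \<alpha>12 \<beta>1 \<beta>2 \<beta>12 B r s (d - r) (e - s))"
    proof (rule expansion_cong[OF _ zero_less_one])
      have "expansion (\<lambda>p. zpow \<alpha>1 \<beta>1 (1 - p) * f (1 / (1 - p))) (binom_mult \<alpha>1 \<beta>1 B)"
        using generator(6) ints by (intro expansion_binom_mult expansion_expands_at_0) (auto simp: j_1_def)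
      \<comment> \<open>The chart at 1 uses \<open>p = - z0 / z2\<close>, whence the change of
        sign.\<close>
      from expansion_shift[OF expansion_uminus[OF this] ints(3)]
      show "expansion (\<lambda>q. zpow \<alpha>12 \<beta>12 q * (zpow \<alpha>1 \<beta>1 (1 + q) * f (1 / (1 + q))))
         (\<lambda>r s. (- 1) powi \<lfloor>(r - \<alpha>12) - (s - \<beta>12)\<rfloor> * binom_mult \<alpha>1 \<beta>1 B (r - \<alpha>12) (s - \<beta>12))"
        by simp
    next
      fix q :: complex assume q: "q \<noteq> 0" "norm q < 1"
      have q1: "1 + q \<noteq> 0" using q(2) by (metis add.inverse_unique less_irrefl norm_minus_cancel norm_one)
      have "1 - 1 / (1 + q) = q * (1 / (1 + q))" using q1 by (simp add: field_simps)
      hence eq1: "g (1 / (1 + q)) = zpow (-\<alpha>2) (-\<beta>2) (1 + q) * (zpow \<alpha>12 \<beta>12 q * zpow (-\<alpha>12) (-\<beta>12) (1 + q) * f (1 / (1 + q)))"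
        using q1 ints by (simp add: g_def zpow_divide zpow_inverse)
      have eq2: "zpow d e (1 + q) = zpow \<alpha>1 \<beta>1 (1 + q) * zpow \<alpha>2 \<beta>2 (1 + q) * zpow \<alpha>12 \<beta>12 (1 + q)"
      proof -
        have "\<alpha>1 + \<alpha>2 - (\<beta>1 + \<beta>2) \<in> \<int>" using Ints_add[OF ints(1,2)] by (simp add: algebra_simps)
        thus ?thesis unfolding d e using ints q1 by (simp add: zpow_add)
      qed
      show "zpow \<alpha>12 \<beta>12 q * (zpow \<alpha>1 \<beta>1 (1 + q) * f (1 / (1 + q))) = zpow d e (1 + q) * g (1 / (1 + q))"
        unfolding eq1 eq2 zpow_minus[OF q1 ints(2)] zpow_minus[OF q1 ints(3)]
        by (rule cancel1; rule zpow_nonzero; rule q1)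
    qed (auto simp: expand_02_def d e)
    moreover have "expansion (\<lambda>q. zpow d e q * g (1 / q)) 
        (\<lambda>r s. expand_21 \<alpha>1 \<alpha>2 \<alpha>12 \<beta>1 \<beta>2 \<beta>12 C r s (d - r) (e - s))"
    proof (rule expansion_cong[OF _ zero_less_one])
      have "expansion (\<lambda>p. zpow \<alpha>12 \<beta>12 (1 - p) * f (1 / p)) (binom_mult \<alpha>12 \<beta>12 C)"
        using generator(7) ints by (intro expansion_binom_mult expansion_expands_at_0) (auto simp: j_inf_def)
      from expansion_scale[OF expansion_shift[OF this ints(1)], of "(-1) powi \<lfloor>\<alpha>12 - \<beta>12\<rfloor>"]
      show "expansion (\<lambda>q. (-1) powi \<lfloor>\<alpha>12 - \<beta>12\<rfloor> * (zpow \<alpha>1 \<beta>1 q * (zpow \<alpha>12 \<beta>12 (1 - q) * f (1 / q))))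
         (\<lambda>r s. (-1) powi \<lfloor>\<alpha>12 - \<beta>12\<rfloor> * binom_mult \<alpha>12 \<beta>12 C (r - \<alpha>1) (s - \<beta>1))" .
    next
      fix q :: complex assume q: "q \<noteq> 0" "norm q < 1"
      have "1 - 1 / q = - (1 - q) * (1 / q)" using q by (simp add: field_simps)
      hence "zpow \<alpha>12 \<beta>12 (1 - 1 / q) = (-1) powi \<lfloor>\<alpha>12 - \<beta>12\<rfloor> * zpow \<alpha>12 \<beta>12 (1 - q) * zpow (-\<alpha>12) (-\<beta>12) q"
        using zpow_inverse[OF q(1) ints(3)] by (simp only: zpow_mult zpow_uminus)
      hence eq1: "g (1 / q) = zpow (-\<alpha>2) (-\<beta>2) q * ((-1) powi \<lfloor>\<alpha>12 - \<beta>12\<rfloor> * zpow \<alpha>12 \<beta>12 (1 - q) * zpow (-\<alpha>12) (-\<beta>12) q * f (1 / q))"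
        using q ints by (simp add: g_def zpow_inverse)
      have eq2: "zpow d e q = zpow \<alpha>1 \<beta>1 q * zpow \<alpha>2 \<beta>2 q * zpow \<alpha>12 \<beta>12 q"
      proof -
        have "\<alpha>1 + \<alpha>2 - (\<beta>1 + \<beta>2) \<in> \<int>" using Ints_add[OF ints(1,2)] by (simp add: algebra_simps)
        thus ?thesis unfolding d e using ints q by (simp add: zpow_add)
      qed
      show "(-1) powi \<lfloor>\<alpha>12 - \<beta>12\<rfloor> * (zpow \<alpha>1 \<beta>1 q * (zpow \<alpha>12 \<beta>12 (1 - q) * f (1 / q))) = zpow d e q * g (1 / q)"
        unfolding eq1 eq2 zpow_minus[OF q(1) ints(2)] zpow_minus[OF q(1) ints(3)]
        by (rule cancel2; rule zpow_nonzero; rule q(1))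
    qed (auto simp: expand_21_def d e)
    ultimately show ?thesis unfolding correlator_def by blast
  qed
next
  case (add \<mu> E12 E02 E21 \<mu>' E12' E02' E21')
  then obtain g g' where "correlator d e E12 E02 E21 g" "correlator d e E12' E02' E21' g'" by blast
  hence "correlator d e (\<lambda>r1 s1 r2 s2. E12 r1 s1 r2 s2 + E12' r1 s1 r2 s2)
          (\<lambda>r0 s0 r2 s2. E02 r0 s0 r2 s2 + E02' r0 s0 r2 s2)
          (\<lambda>r1 s1 r2 s2. E21 r1 s1 r2 s2 + E21' r1 s1 r2 s2) (\<lambda>p. g p + g' p)"
    unfolding correlator_def ring_distribs by (auto intro!: expansion_add ranalytic_add)
  thus ?case by blast
next
  case (scale \<mu> E12 E02 E21 k)
  then obtain g where g: "correlator d e E12 E02 E21 g" by blast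
  have "correlator d e (\<lambda>r1 s1 r2 s2. k * E12 r1 s1 r2 s2) (\<lambda>r0 s0 r2 s2. k * E02 r0 s0 r2 s2)
          (\<lambda>r1 s1 r2 s2. k * E21 r1 s1 r2 s2) (\<lambda>p. k * g p)"
    using g expansion_scale[of _ _ k] ranalytic_mult[OF ranalytic_const] 
    unfolding correlator_def by (auto simp: mult.left_commute[of _ k])
  thus ?case by blast
qed

section \<open>Consequences of the expansions\<close>

text \<open>With this, the axioms on correlators pass to the algebra in which \<open>z\<close> and
  \<open>zb\<close> are exchanged.\<close>

lemma correlator_cnj:
  assumes "correlator d e E12 E02 E21 g" and de: "d - e \<in> \<int>"
  shows "correlator e d (\<lambda>r1 s1 r2 s2. E12 s1 r1 s2 r2) (\<lambda>r1 s1 r2 s2. E02 s1 r1 s2 r2)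
           (\<lambda>r1 s1 r2 s2. E21 s1 r1 s2 r2) (\<lambda>p. g (cnj p))"
  unfolding correlator_def
proof (intro conjI ballI)
  note * = assms(1)[unfolded correlator_def]
  have ed: "e - d \<in> \<int>" using Ints_minus[OF de] by simp
  show "ranalytic (\<lambda>p. g (cnj p)) p" if "p \<in> - {0, 1}" for p
  proof (rule ranalytic_cnj)
    have "cnj p \<in> - {0, 1}" using that by (auto simp: complex_eq_iff)
    thus "ranalytic g (cnj p)" using * by blast
  qed
  show "expansion (\<lambda>p. g (cnj p)) (\<lambda>r s. E12 (d - s) (e - r) s r)"
    using expansion_cnj[of g "\<lambda>r s. E12 (d - r) (e - s) r s"] * by blast
  have "expansion (\<lambda>q. zpow d e (1 + cnj q) * g (1 / (1 + cnj q))) (\<lambda>r s. E02 s r (d - s) (e - r))"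
    using expansion_cnj[of "\<lambda>q. zpow d e (1 + q) * g (1 / (1 + q))"] * by blast
  thus "expansion (\<lambda>q. zpow e d (1 + q) * g (cnj (1 / (1 + q)))) (\<lambda>r s. E02 s r (d - s) (e - r))"
  proof (rule expansion_cong[OF _ zero_less_one _ refl])
    fix q :: complex assume "norm q < 1"
    hence "1 + q \<noteq> 0" by (metis add.inverse_unique less_irrefl norm_minus_cancel norm_one)
    from zpow_cnj[OF this de]
    show "zpow d e (1 + cnj q) * g (1 / (1 + cnj q)) = zpow e d (1 + q) * g (cnj (1 / (1 + q)))"
      by simp
  qed
  have "expansion (\<lambda>q. zpow d e (cnj q) * g (1 / cnj q)) (\<lambda>r s. E21 s r (d - s) (e - r))"
    using expansion_cnj[of "\<lambda>q. zpow d e q * g (1 / q)"] * by blast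
  thus "expansion (\<lambda>q. zpow e d q * g (cnj (1 / q))) (\<lambda>r s. E21 s r (d - s) (e - r))"
    by (rule expansion_cong[OF _ zero_less_one _ refl]) (simp add: zpow_cnj de)
qed

lemma correlator_D:
  assumes "correlator d e E12 E02 E21 g"
  shows "\<And>p. p \<in> - {0, 1} \<Longrightarrow> ranalytic g p"
    "expansion g (\<lambda>r s. E12 (d - r) (e - s) r s)"
    "expansion (\<lambda>q. zpow d e (1 + q) * g (1 / (1 + q))) (\<lambda>r s. E02 r s (d - r) (e - s))"
    "expansion (\<lambda>q. zpow d e q * g (1 / q)) (\<lambda>r s. E21 r s (d - r) (e - s))"
  using assms unfolding correlator_def by blast+

lemma eq_0_if_bounded_by_small:
  fixes x K :: real
  assumes "\<rho> > 0" "\<And>t. 0 < t \<Longrightarrow> t \<le> \<rho> \<Longrightarrow> x \<le> K * t"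
  shows "x \<le> 0"
proof (rule tendsto_le[OF trivial_limit_at_right_real])
  have "((\<lambda>t. K * t) \<longlongrightarrow> K * 0) (at_right 0)"
    by (intro tendsto_intros)
  hence "((\<lambda>t. K * t) \<longlongrightarrow> 0) (at_right 0)" by simp
  thus "((\<lambda>t. K * t) \<longlongrightarrow> 0) (at_right 0)" .
  show "((\<lambda>t. x) \<longlongrightarrow> x) (at_right 0)" by simp
  show "\<forall>\<^sub>F t in at_right 0. x \<le> K * t"
    unfolding eventually_at_right_field using assms by (intro exI[of _ \<rho>]) auto
qed

text \<open>The terms of degree at least 2 are \<open>O(|q|^2)\<close>. Subtracting the values at
  \<open>t w\<close> and \<open>- t w\<close> removes the constant term and leaves
  \<open>c 1 0 * w + c 0 1 * cnj w = O(t)\<close>; the directions \<open>w = 1\<close> and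
  \<open>w = \<i>\<close> separate the two coefficients.\<close>

lemma double_series_linear_coeffs_zero:
  fixes c :: "nat \<Rightarrow> nat \<Rightarrow> complex"
  assumes \<rho>: "\<rho> > 0" and 0: "\<And>q. q \<noteq> 0 \<Longrightarrow> norm q < \<rho> \<Longrightarrow> ((\<lambda>(m, n). c m n * (q ^ m * cnj q ^ n)) has_sum 0) UNIV"
  shows "c 1 0 = 0" "c 0 1 = 0"
proof -
  define \<rho>' where "\<rho>' = \<rho> / 2"
  have \<rho>': "\<rho>' > 0" "\<rho>' < \<rho>" using \<rho> by (auto simp: \<rho>'_def)
  define M where "M = (\<lambda>(m, n). norm (c m n) * \<rho>' ^ (m + n))"
  define R where "R = UNIV - {(0, 0), (1, 0), (0, 1 :: nat) :: nat \<times> nat}"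
  have M: "M summable_on UNIV"
  proof -
    have "(\<lambda>(m, n). c m n * (of_real \<rho>' ^ m * cnj (of_real \<rho>') ^ n)) summable_on UNIV"
      using 0[of "of_real \<rho>'"] \<rho>' has_sum_imp_summable by force
    hence "(\<lambda>x. norm ((\<lambda>(m, n). c m n * (of_real \<rho>' ^ m * cnj (of_real \<rho>') ^ n)) x)) summable_on UNIV"
      using summable_on_iff_abs_summable_on_complex by blast
    also have "(\<lambda>x. norm ((\<lambda>(m, n). c m n * (of_real \<rho>' ^ m * cnj (of_real \<rho>') ^ n)) x)) = M"
      using \<rho>' by (auto simp: M_def norm_mult norm_power power_add)
    finally show ?thesis .
  qed
  have MR: "M summable_on R" by (rule summable_on_subset_banach[OF M]) simp
  define K where "K = infsum M R / \<rho>'\<^sup>2"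
  have bound: "norm (c 0 0 + c 1 0 * q + c 0 1 * cnj q) \<le> K * (norm q)\<^sup>2" if q: "q \<noteq> 0" "norm q \<le> \<rho>'" for q
  proof -
    define f where "f = (\<lambda>(m, n). c m n * (q ^ m * cnj q ^ n))"
    have f: "(f has_sum 0) UNIV" unfolding f_def using q \<rho>' by (intro 0) auto
    have fR: "f summable_on R" by (rule summable_on_subset_banach[OF has_sum_imp_summable[OF f]]) simp
    have "(f has_sum (sum f {(0, 0), (1, 0), (0, 1)} + infsum f R)) ({(0, 0), (1, 0), (0, 1)} \<union> R)"
      by (rule has_sum_Un_disjoint[OF has_sum_finite has_sum_infsum[OF fR]]) (auto simp: R_def)
    also have "{(0, 0), (1, 0), (0, 1)} \<union> R = UNIV" by (auto simp: R_def)
    finally have "sum f {(0, 0), (1, 0), (0, 1)} + infsum f R = 0" using f has_sum_unique by blast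
    hence eq: "c 0 0 + c 1 0 * q + c 0 1 * cnj q = - infsum f R"
      by (simp add: f_def eq_neg_iff_add_eq_0 add.assoc)
    have "norm (infsum f R) \<le> (norm q / \<rho>')\<^sup>2 * infsum M R"
    proof (rule norm_infsum_le)
      show "(f has_sum infsum f R) R" by (rule has_sum_infsum[OF fR])
      show "((\<lambda>x. (norm q / \<rho>')\<^sup>2 * M x) has_sum (norm q / \<rho>')\<^sup>2 * infsum M R) R"
        by (rule has_sum_cmult_right[OF has_sum_infsum[OF MR]])
      fix x assume x: "x \<in> R"
      obtain m n where mn: "x = (m, n)" by (cases x)
      have ge: "m + n \<ge> 2"
        using x by (cases m; cases n) (auto simp: R_def mn)
      have le1: "norm q / \<rho>' \<le> 1" "norm q / \<rho>' \<ge> 0" using q \<rho>' by (auto simp: field_simps)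
      have "norm (f x) = norm (c m n) * norm q ^ (m + n)"
        by (simp add: f_def mn norm_mult norm_power power_add)
      also have "norm q ^ (m + n) = (norm q / \<rho>') ^ (m + n) * \<rho>' ^ (m + n)"
        using \<rho>' by (simp add: power_divide)
      also have "norm (c m n) * ((norm q / \<rho>') ^ (m + n) * \<rho>' ^ (m + n)) \<le> norm (c m n) * ((norm q / \<rho>')\<^sup>2 * \<rho>' ^ (m + n))"
        using \<rho>' by (intro mult_left_mono mult_right_mono power_decreasing[OF ge le1(2,1)]) auto
      finally show "norm (f x) \<le> (norm q / \<rho>')\<^sup>2 * M x"
        by (simp add: M_def mn mult_ac)
    qed
    thus ?thesis unfolding eq K_def by (simp add: power_divide mult_ac)
  qed
  have two: "norm ((a + u) - (a - u)) \<le> 2 * B" if "norm (a + u) \<le> B" "norm (a - u) \<le> B" for a u :: complex and B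
    using norm_triangle_ineq4[of "a + u" "a - u"] that by linarith
  have lin: "norm (c 1 0 * w + c 0 1 * cnj w) \<le> 0" if w: "norm w = 1" for w
  proof (rule eq_0_if_bounded_by_small[OF \<rho>'(1)])
    fix t assume t: "0 < t" "t \<le> \<rho>'"
    have w0: "w \<noteq> 0" using w by auto
    define v where "v = c 1 0 * w + c 0 1 * cnj w"
    define u where "u = of_real t * v"
    have "norm (c 0 0 + u) \<le> K * t\<^sup>2"
      using bound[of "of_real t * w"] t w w0 by (auto simp: u_def v_def norm_mult algebra_simps)
    moreover have "norm (c 0 0 - u) \<le> K * t\<^sup>2"
      using bound[of "- of_real t * w"] t w w0 by (auto simp: u_def v_def norm_mult algebra_simps)
    ultimately have "norm (2 * u) \<le> 2 * (K * t\<^sup>2)" using two[of "c 0 0" u] by (simp add: algebra_simps)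
    hence "t * norm v \<le> t * (K * t)"
      using t by (simp add: u_def norm_mult power2_eq_square mult_ac)
    thus "norm (c 1 0 * w + c 0 1 * cnj w) \<le> K * t" using t by (simp add: v_def)
  qed
  have 1: "c 1 0 + c 0 1 = 0" using lin[of 1] by simp
  have "c 1 0 * \<i> + c 0 1 * cnj \<i> = 0" using lin[OF norm_ii] norm_le_zero_iff by blast
  hence "\<i> * (c 1 0 - c 0 1) = 0" by (simp add: right_diff_distrib mult.commute)
  hence 2: "c 1 0 - c 0 1 = 0" by simp
  have "2 * c 1 0 = (c 1 0 + c 0 1) + (c 1 0 - c 0 1)" by simp
  also have "\<dots> = 0" unfolding 1 2 by simp
  finally show "c 1 0 = 0" by simp
  thus "c 0 1 = 0" using 1 by simp
qed

text \<open>
  The correlator of \<open>Y(a,z1) Y(1,z2) c\<close> is a multiple of \<open>z1^d zb1^e\<close>; comparing linear terms in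
  its expansion in \<open>z1 = z2 + z0\<close> identifies the modes of \<open>D a\<close>.
\<close>

lemma correlator_translation:
  assumes c: "correlator d e E12 E02 E21 g" and de: "d - e \<in> \<int>"
    and E12: "\<And>r1 s1 r2 s2. E12 r1 s1 r2 s2 \<noteq> 0 \<Longrightarrow> r2 = 0 \<and> s2 = 0"
    and E02: "\<And>r0 s0 r2 s2. E02 r0 s0 r2 s2 \<noteq> 0 \<Longrightarrow> r0 \<in> \<nat> \<and> s0 \<in> \<nat>"
  shows "E02 1 0 (d - 1) e = of_real d * E12 d e 0 0"
proof -
  define a where "a = E12 d e 0 0"
  \<comment> \<open>Only the exponent \<open>(0, 0)\<close> occurs in the expansion at 0, so
    \<open>g\<close> is constant there; continuation makes it constant near 1 as well, where
    \<open>E02\<close> is read off.\<close>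
  have g0: "g p = a" if "p \<in> - {0, 1}" for p
  proof -
    obtain \<rho> where \<rho>: "\<rho> > 0" "\<forall>p. p \<noteq> 0 \<longrightarrow> norm p < \<rho> \<longrightarrow> 
        ((\<lambda>(r, s). E12 (d - r) (e - s) r s * zpow r s p) has_sum g p) UNIV"
      using expansionD[OF correlator_D(2)[OF c]] by blast
    have "g p - a = 0"
    proof (rule ranalytic_zero_continuation[OF _ \<rho>(1) _ that])
      show "ranalytic (\<lambda>p. g p - a) p" if "p \<in> - {0, 1}" for p
        using that correlator_D(1)[OF c] by (intro ranalytic_diff) auto
      fix p :: complex assume p: "p \<in> ball 0 \<rho> - {0}"
      have "((\<lambda>(r, s). E12 (d - r) (e - s) r s * zpow r s p) has_sum a) UNIV"
      proof (rule has_sum_finite_neutralI[of "{(0, 0)}"])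
        show "(case x of (r, s) \<Rightarrow> E12 (d - r) (e - s) r s * zpow r s p) = 0" 
          if "x \<in> UNIV - {(0, 0)}" for x
          using that E12 by (cases x) fastforce
      qed (use p in \<open>auto simp: a_def\<close>)
      moreover have "((\<lambda>(r, s). E12 (d - r) (e - s) r s * zpow r s p) has_sum g p) UNIV"
        using \<rho>(2) p by simp
      ultimately show "g p - a = 0" using has_sum_unique by force
    qed
    thus ?thesis by simp
  qed
  obtain \<rho> where \<rho>: "\<rho> > 0" "\<forall>q. q \<noteq> 0 \<longrightarrow> norm q < \<rho> \<longrightarrow> 
        ((\<lambda>(r, s). E02 r s (d - r) (e - s) * zpow r s q) has_sum (zpow d e (1 + q) * g (1 / (1 + q)))) UNIV"
      using expansionD[OF correlator_D(3)[OF c]] by blast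
  \<comment> \<open>The extra sign undoes the one in \<open>signed_binom\<close>: these are the
    coefficients of \<open>(1 + q)^d (1 + qb)^e\<close>, and \<open>b 1 0 = d\<close>.\<close>
  define b where "b = (\<lambda>k l. of_real (signed_binom d k * signed_binom e l) * (- 1) ^ (k + l) :: complex)"
  define C where "C = (\<lambda>k l :: nat. E02 (real k) (real l) (d - real k) (e - real l) - a * b k l)"
  have "C 1 0 = 0"
  proof (rule double_series_linear_coeffs_zero(1))
    show "min \<rho> 1 > 0" using \<rho> by simp
    fix q :: complex assume q: "q \<noteq> 0" "norm q < min \<rho> 1"
    have q1: "1 + q \<noteq> 0" using q(2) by (metis add.inverse_unique less_irrefl min_less_iff_conj norm_minus_cancel norm_one)
    have "1 / (1 + q) \<in> - {0, 1}" using q q1 by (auto simp: field_simps)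
    hence "g (1 / (1 + q)) = a" by (rule g0)
    hence "((\<lambda>(r, s). E02 r s (d - r) (e - s) * zpow r s q) has_sum (zpow d e (1 + q) * a)) UNIV"
      using \<rho>(2)[rule_format, of q] q by simp
    also have "?this \<longleftrightarrow> ((\<lambda>(r, s). E02 r s (d - r) (e - s) * zpow r s q) has_sum (zpow d e (1 + q) * a)) 
        ((\<lambda>(k, l). (real k, real l)) ` UNIV)"
    proof (rule has_sum_cong_neutral)
      fix x :: "real \<times> real" assume x: "x \<in> UNIV - (\<lambda>(k, l). (real k, real l)) ` UNIV"
      obtain r s where rs: "x = (r, s)" by (cases x)
      have "\<not> (r \<in> \<nat> \<and> s \<in> \<nat>)" using x unfolding rs by (auto simp: Nats_def)
      thus "(case x of (r, s) \<Rightarrow> E02 r s (d - r) (e - s) * zpow r s q) = 0" using E02 unfolding rs by auto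
    qed auto
    also have "\<dots> \<longleftrightarrow> (((\<lambda>(r, s). E02 r s (d - r) (e - s) * zpow r s q) \<circ> (\<lambda>(k, l). (real k, real l))) 
          has_sum (zpow d e (1 + q) * a)) UNIV"
      by (rule has_sum_reindex) (auto simp: inj_on_def)
    also have "((\<lambda>(r, s). E02 r s (d - r) (e - s) * zpow r s q) \<circ> (\<lambda>(k, l). (real k, real l))) = 
        (\<lambda>(k, l). E02 (real k) (real l) (d - real k) (e - real l) * (q ^ k * cnj q ^ l))"
      using q by (auto simp: zpow_nat)
    finally have 1: "((\<lambda>(k, l). E02 (real k) (real l) (d - real k) (e - real l) * (q ^ k * cnj q ^ l)) 
      has_sum (zpow d e (1 + q) * a)) UNIV" .
    have "((\<lambda>(k, l). of_real (signed_binom d k * signed_binom e l) * ((- q) ^ k * cnj (- q) ^ l)) has_sum zpow d e (1 + q)) UNIV"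
      using zpow_one_minus_has_sum[of "- q" d e] q de by simp
    hence "((\<lambda>(k, l). b k l * (q ^ k * cnj q ^ l)) has_sum zpow d e (1 + q)) UNIV"
      by (simp add: b_def power_add power_minus[of q] power_minus[of "cnj q"] mult_ac)
    from has_sum_add[OF 1 has_sum_cmult_right[OF this, of "- a"]]
    show "((\<lambda>(k, l). C k l * (q ^ k * cnj q ^ l)) has_sum 0) UNIV"
      by (simp add: C_def case_prod_unfold algebra_simps)
  qed
  thus ?thesis by (simp add: C_def a_def b_def signed_binom_def mult.commute)
qed

section \<open>Residues of functions given by Laurent series\<close>

lemma has_contour_integral_power_int_circlepath:
  assumes "R > 0"
  shows "((\<lambda>x. x powi k) has_contour_integral (if k = -1 then 2 * of_real pi * \<i> else 0)) (circlepath 0 R)"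
proof (cases "k = -1")
  case True
  have "((\<lambda>x. 1 / (x - 0)) has_contour_integral 2 * of_real pi * \<i>) (circlepath 0 R)"
    using Cauchy_integral_circlepath_simple[of "\<lambda>_. 1" 0 R 0] assms by simp
  thus ?thesis using True by (simp add: power_int_minus inverse_eq_divide)
next
  case False
  hence k: "of_int (k + 1) \<noteq> (0 :: complex)" by (metis add.commute add_eq_0_iff2 of_int_eq_0_iff)
  have "((\<lambda>x. x powi k) has_contour_integral 
     (\<lambda>x. x powi (k + 1) / of_int (k + 1)) (pathfinish (circlepath 0 R)) -
     (\<lambda>x. x powi (k + 1) / of_int (k + 1)) (pathstart (circlepath 0 R))) (circlepath 0 R)"
  proof (rule contour_integral_primitive[where S = "- {0}"])
    fix x :: complex assume "x \<in> - {0}"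
    thus "((\<lambda>x. x powi (k + 1) / of_int (k + 1)) has_field_derivative x powi k) (at x within - {0})"
      using k by (auto intro!: derivative_eq_intros)
  qed (use assms in auto)
  thus ?thesis using False by simp
qed

text \<open>Absolute convergence at the point \<open>R\<close> bounds the terms on the whole circle,
  so the partial sums may be integrated. Convergence is asked on the circle alone, so the lemma also
  serves an expansion at infinity.\<close>

lemma has_contour_integral_laurent:
  assumes R: "R > 0" and sum: "\<And>x. norm x = R \<Longrightarrow> ((\<lambda>k::int. a k * x powi k) has_sum G x) UNIV"
  shows "(G has_contour_integral 2 * of_real pi * \<i> * a (-1)) (circlepath 0 R)"
proof -
  define M where "M = (\<lambda>k. norm (a k) * R powi k)"
  define f where "f = (\<lambda>X x. \<Sum>k\<in>X. a k * x powi k)"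
  let ?I = "\<lambda>k. if k = (-1::int) then 2 * of_real pi * \<i> else (0::complex)"
  have "(\<lambda>k. norm (a k * of_real R powi k)) summable_on UNIV"
    using sum[of "of_real R"] R has_sum_imp_summable summable_on_iff_abs_summable_on_complex by force
  hence M: "M summable_on UNIV" using R by (simp add: M_def norm_mult norm_power_int)
  have ul: "uniform_limit (sphere 0 R) f G (finite_subsets_at_top UNIV)"
    unfolding f_def
    by (rule Weierstrass_m_test_general'[OF _ _ M]) (use sum in \<open>auto simp: M_def norm_mult norm_power_int\<close>)
  have int: "(f X has_contour_integral (\<Sum>k\<in>X. a k * ?I k)) (circlepath 0 R)" if "finite X" for X
    unfolding f_def using that R
    by (intro has_contour_integral_sum has_contour_integral_lmul has_contour_integral_power_int_circlepath)
  have ev: "\<forall>\<^sub>F X in finite_subsets_at_top UNIV. f X contour_integrable_on circlepath 0 R"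
    by (rule eventually_finite_subsets_at_top_weakI) (use int contour_integrable_on_def in blast)
  note lim = contour_integral_uniform_limit_circlepath[OF ev ul _ R]
  have "((\<lambda>X. contour_integral (circlepath 0 R) (f X)) \<longlongrightarrow> 2 * of_real pi * \<i> * a (-1)) (finite_subsets_at_top UNIV)"
  proof (rule tendsto_eventually)
    have "contour_integral (circlepath 0 R) (f X) = 2 * of_real pi * \<i> * a (-1)" 
      if X: "finite X" "{-1} \<subseteq> X" for X
    proof -
      have "contour_integral (circlepath 0 R) (f X) = (\<Sum>k\<in>X. a k * ?I k)"
        by (rule contour_integral_unique[OF int[OF X(1)]])
      also have "\<dots> = (\<Sum>k\<in>{-1}. a k * ?I k)"
        using X by (intro sum.mono_neutral_right) auto
      finally show ?thesis by simp
    qed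
    thus "\<forall>\<^sub>F X in finite_subsets_at_top UNIV. contour_integral (circlepath 0 R) (f X) = 2 * of_real pi * \<i> * a (-1)"
      unfolding eventually_finite_subsets_at_top by (intro exI[of _ "{-1}"]) auto
  qed
  with lim(2) have "contour_integral (circlepath 0 R) G = 2 * of_real pi * \<i> * a (-1)"
    by (intro tendsto_unique) auto
  moreover have "G contour_integrable_on circlepath 0 R" by (rule lim(1)) simp
  ultimately show ?thesis using has_contour_integral_integral by metis
qed

text \<open>On an annulus \<open>r1 < |x| < r2\<close> the non-negative powers are dominated by
  their values at \<open>r2\<close>, the negative ones by those at \<open>r1\<close>.\<close>

lemma laurent_holomorphic:
  assumes sum: "\<And>x. x \<noteq> 0 \<Longrightarrow> norm x < \<rho> \<Longrightarrow> ((\<lambda>k::int. a k * x powi k) has_sum G x) UNIV"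
  shows "G holomorphic_on ball 0 \<rho> - {0}"
proof -
  have loc: "G holomorphic_on ball 0 r2 - cball 0 r1" if r: "0 < r1" "r1 < r2" "r2 < \<rho>" for r1 r2
  proof (rule holomorphic_on_uniform_limit)
    define M where "M = (\<lambda>k. norm (a k) * r1 powi k + norm (a k) * r2 powi k)"
    have "(\<lambda>k. norm (a k * of_real r powi k)) summable_on UNIV" if "r > 0" "r < \<rho>" for r
      using sum[of "of_real r"] that has_sum_imp_summable summable_on_iff_abs_summable_on_complex by force
    hence *: "(\<lambda>k. norm (a k) * r powi k) summable_on UNIV" if "r > 0" "r < \<rho>" for r
      using that by (simp add: norm_mult norm_power_int)
    have M: "M summable_on UNIV" unfolding M_def using r by (intro summable_on_add *) auto
    have le: "norm (a k * x powi k) \<le> M k" if x: "r1 < norm x" "norm x < r2" for x k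
    proof (cases "k \<ge> 0")
      case True
      have "norm x powi k \<le> r2 powi k" using x True r by (intro power_int_mono) auto
      hence "norm (a k) * norm x powi k \<le> norm (a k) * r2 powi k" by (rule mult_left_mono) simp
      moreover have "norm (a k) * r1 powi k \<ge> 0" using r by simp
      ultimately show ?thesis unfolding M_def norm_mult norm_power_int by linarith
    next
      case False
      hence "norm x powi k \<le> r1 powi k" using x r by (intro power_int_antimono) auto
      hence "norm (a k) * norm x powi k \<le> norm (a k) * r1 powi k" by (rule mult_left_mono) simp
      moreover have "norm (a k) * r2 powi k \<ge> 0" using r by simp
      ultimately show ?thesis unfolding M_def norm_mult norm_power_int by linarith
    qed
    show "uniform_limit (ball 0 r2 - cball 0 r1) (\<lambda>X x. \<Sum>k\<in>X. a k * x powi k) G (finite_subsets_at_top UNIV)"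
    proof (rule Weierstrass_m_test_general'[OF _ _ M])
      fix x assume x: "x \<in> ball 0 r2 - cball (0 :: complex) r1"
      hence "x \<noteq> 0" using r by auto
      thus "((\<lambda>k. a k * x powi k) has_sum G x) UNIV" using x r by (intro sum) auto
      show "norm (a k * x powi k) \<le> M k" for k using x by (intro le) auto
    qed
    show "(\<lambda>x. \<Sum>k\<in>X. a k * x powi k) holomorphic_on (ball 0 r2 - cball 0 r1)" for X
      using r by (intro holomorphic_intros) auto
  qed auto
  have "\<exists>e>0. G holomorphic_on ball x e" if x: "x \<in> ball 0 \<rho> - {0}" for x
  proof -
    have n: "0 < norm x" "norm x < \<rho>" "0 < \<rho>" using x by (auto intro: le_less_trans[OF norm_ge_zero])
    hence "x \<in> ball 0 ((norm x + \<rho>) / 2) - cball 0 (norm x / 2)" by simp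
    moreover have "open (ball 0 ((norm x + \<rho>) / 2) - cball 0 (norm x / 2) :: complex set)" by (intro open_Diff) auto
    ultimately obtain e where "e > 0" "ball x e \<subseteq> ball 0 ((norm x + \<rho>) / 2) - cball 0 (norm x / 2)"
      using open_contains_ball by blast
    moreover have "G holomorphic_on ball 0 ((norm x + \<rho>) / 2) - cball 0 (norm x / 2)"
    proof (rule loc)
      show "0 < norm x / 2" "norm x / 2 < (norm x + \<rho>) / 2" "(norm x + \<rho>) / 2 < \<rho>"
        using n by (simp_all add: field_simps)
    qed
    ultimately show ?thesis using holomorphic_on_subset by blast
  qed
  thus ?thesis using analytic_imp_holomorphic unfolding analytic_on_def by blast
qed

lemma residue_laurent:
  assumes "\<rho> > 0" and sum: "\<And>x. x \<noteq> 0 \<Longrightarrow> norm x < \<rho> \<Longrightarrow> ((\<lambda>k::int. a k * x powi k) has_sum G x) UNIV"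
  shows "residue G 0 = a (-1)"
proof -
  have "(G has_contour_integral 2 * pi * \<i> * residue G 0) (circlepath 0 (\<rho> / 2))"
    by (rule base_residue[of "ball 0 \<rho>"]) (use assms laurent_holomorphic[OF sum] in auto)
  moreover have "(G has_contour_integral 2 * of_real pi * \<i> * a (-1)) (circlepath 0 (\<rho> / 2))"
    using assms by (intro has_contour_integral_laurent) auto
  ultimately show ?thesis using has_contour_integral_unique by fastforce
qed

lemma has_sum_finite_sum:
  fixes f :: "'i \<Rightarrow> 'x \<Rightarrow> complex"
  assumes "finite I" "\<And>i. i \<in> I \<Longrightarrow> (f i has_sum s i) A"
  shows "((\<lambda>x. \<Sum>i\<in>I. f i x) has_sum (\<Sum>i\<in>I. s i)) A"
  using assms by (induction I rule: finite_induct) (auto intro: has_sum_add)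

lemma laurent_mult_power:
  fixes x S :: complex
  assumes "((\<lambda>k::int. a k * x powi k) has_sum S) UNIV" "x \<noteq> 0"
  shows "((\<lambda>k::int. a (k - int m) * x powi k) has_sum (S * x ^ m)) UNIV"
proof -
  have "((\<lambda>k. a k * x powi k * x ^ m) has_sum (S * x ^ m)) UNIV"
    by (rule has_sum_cmult_left[OF assms(1)])
  also have "(\<lambda>k. a k * x powi k * x ^ m) = (\<lambda>k. a k * x powi (k + int m))"
    using assms(2) by (auto simp: power_int_add mult.assoc)
  also have "(\<dots> has_sum (S * x ^ m)) UNIV \<longleftrightarrow> ((\<lambda>k. a (k - int m) * x powi k) has_sum (S * x ^ m)) UNIV"
    by (rule has_sum_reindex_bij_witness[of _ "\<lambda>k. k - int m" "\<lambda>k. k + int m"]) auto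
  finally show ?thesis .
qed

text \<open>The function \<open>H x * x ^ m\<close> is integrated over a circle around 0 and 1. The
  circle reads off \<open>A\<close>, the residue at 0 reads off \<open>B\<close>, and at 1 the
  expansion of \<open>(1 + x) ^ m\<close> produces the binomial coefficients in front of
  \<open>C\<close>.\<close>

lemma residue_formula:
  fixes H :: "complex \<Rightarrow> complex" and A B C :: "int \<Rightarrow> complex"
  assumes hol: "H holomorphic_on - {0, 1}" and \<rho>: "\<rho> > 0"
    and B: "\<And>x. x \<noteq> 0 \<Longrightarrow> norm x < \<rho> \<Longrightarrow> ((\<lambda>k::int. B k * x powi k) has_sum H x) UNIV"
    and C: "\<And>x. x \<noteq> 0 \<Longrightarrow> norm x < \<rho> \<Longrightarrow> ((\<lambda>k::int. C k * x powi k) has_sum H (1 + x)) UNIV"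
    and A: "\<And>x. norm x > 1 / \<rho> \<Longrightarrow> ((\<lambda>k::int. A k * x powi k) has_sum H x) UNIV"
  shows "A (-1 - int m) - B (-1 - int m) = (\<Sum>i\<le>m. of_nat (m choose i) * C (-1 - int i))"
proof -
  define G where "G = (\<lambda>x. H x * x ^ m)"
  have holG: "G holomorphic_on - {0, 1}" unfolding G_def by (intro holomorphic_intros hol)
  have r0: "residue G 0 = B (-1 - int m)"
  proof (rule residue_laurent[OF \<rho>])
    show "((\<lambda>k. B (k - int m) * x powi k) has_sum G x) UNIV" if "x \<noteq> 0" "norm x < \<rho>" for x
      unfolding G_def by (rule laurent_mult_power[OF B[OF that] that(1)])
  qed
  have "residue G 1 = residue (\<lambda>x. G (1 + x)) 0" by (rule residue_shift_0)
  also have "\<dots> = (\<Sum>i\<le>m. of_nat (m choose i) * C (-1 - int i))"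
  proof (rule residue_laurent[OF \<rho>])
    fix x :: complex assume x: "x \<noteq> 0" "norm x < \<rho>"
    have "((\<lambda>k. \<Sum>i\<le>m. of_nat (m choose i) * (C (k - int i) * x powi k)) has_sum 
        (\<Sum>i\<le>m. of_nat (m choose i) * (H (1 + x) * x ^ i))) UNIV"
      by (intro has_sum_finite_sum has_sum_cmult_right laurent_mult_power C x finite_atMost)
    also have "(\<Sum>i\<le>m. of_nat (m choose i) * (H (1 + x) * x ^ i)) = G (1 + x)"
      using binomial_ring[of x 1 m] by (simp add: G_def sum_distrib_left mult_ac add.commute)
    finally show "((\<lambda>k. (\<Sum>i\<le>m. of_nat (m choose i) * C (k - int i)) * x powi k) has_sum G (1 + x)) UNIV"
      by (simp add: sum_distrib_right mult.assoc)
  qed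
  finally have r1: "residue G 1 = (\<Sum>i\<le>m. of_nat (m choose i) * C (-1 - int i))" .
  \<comment> \<open>Larger than 1 to enclose both poles, and larger than \<open>1 / \<rho>\<close>
    to lie where the expansion at infinity converges.\<close>
  define R where "R = max 1 (1 / \<rho>) + 1"
  have R: "R > 1" "R > 1 / \<rho>" "R > 0" using \<rho> by (auto simp: R_def)
  have "(G has_contour_integral 2 * of_real pi * \<i> * A (-1 - int m)) (circlepath 0 R)"
  proof (rule has_contour_integral_laurent[OF R(3)])
    show "((\<lambda>k. A (k - int m) * x powi k) has_sum G x) UNIV" if "norm x = R" for x
      unfolding G_def by (rule laurent_mult_power[OF A]) (use that R in auto)
  qed
  hence "contour_integral (circlepath 0 R) G = 2 * of_real pi * \<i> * A (-1 - int m)"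
    by (rule contour_integral_unique)
  moreover have "contour_integral (circlepath 0 R) G = 
     of_real (2 * pi) * \<i> * (\<Sum>p\<in>{0, 1}. winding_number (circlepath 0 R) p * residue G p)"
  proof (rule Residue_theorem[of UNIV])
    show "G holomorphic_on UNIV - {0, 1}" using holG by (simp add: Compl_eq_Diff_UNIV)
  qed (use R in auto)
  ultimately have "A (-1 - int m) = (\<Sum>p\<in>{0, 1}. winding_number (circlepath 0 R) p * residue G p)"
    by simp
  thus ?thesis using R r0 r1 by (simp add: winding_number_circlepath)
qed


lemma has_sum_expansion_int:
  assumes "((\<lambda>(r, s). A r s * zpow r s q) has_sum S) UNIV"
    and "\<And>r s. A r s \<noteq> 0 \<Longrightarrow> s = e \<and> r - d \<in> \<int>"
  shows "((\<lambda>k::int. A (d + of_int k) e * zpow (d + of_int k) e q) has_sum S) UNIV"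
proof -
  have "((\<lambda>(r, s). A r s * zpow r s q) has_sum S) (range (\<lambda>k::int. (d + of_int k, e)))"
  proof (rule has_sum_cong_neutral[THEN iffD1, OF _ _ _ assms(1)])
    fix x assume x: "x \<in> UNIV - range (\<lambda>k::int. (d + of_int k, e))"
    obtain r s where rs: "x = (r, s)" by (cases x)
    have "A r s = 0"
    proof (rule ccontr)
      assume "A r s \<noteq> 0"
      then obtain k where "s = e" "r - d = of_int k" using assms(2) by (blast elim: Ints_cases)
      hence "x = (d + of_int k, e)" by (simp add: rs)
      thus False using x by blast
    qed
    thus "(case x of (r, s) \<Rightarrow> A r s * zpow r s q) = 0" by (simp add: rs)
  qed auto
  also have "?this \<longleftrightarrow> (((\<lambda>(r, s). A r s * zpow r s q) \<circ> (\<lambda>k::int. (d + of_int k, e))) has_sum S) UNIV"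
    by (rule has_sum_reindex) (auto simp: inj_on_def)
  finally show ?thesis by (simp add: o_def)
qed

text \<open>
  If the first field is meromorphic in \<open>z1\<close>, then \<open>H x = \<mu> x 1\<close> is a rational function with poles
  at \<open>0, 1, \<infinity>\<close>, and the commutator formula is the residue theorem.
\<close>

lemma correlator_commutator:
  assumes c: "correlator d e E12 E02 E21 g" and de: "d - e \<in> \<int>"
    and E12: "\<And>r1 s1 r2 s2. E12 r1 s1 r2 s2 \<noteq> 0 \<Longrightarrow> s1 = 0 \<and> r1 \<in> \<int>"
    and E21: "\<And>r1 s1 r2 s2. E21 r1 s1 r2 s2 \<noteq> 0 \<Longrightarrow> s1 = 0 \<and> r1 \<in> \<int>"
    and E02: "\<And>r0 s0 r2 s2. E02 r0 s0 r2 s2 \<noteq> 0 \<Longrightarrow> s0 = 0 \<and> r0 \<in> \<int>"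
  shows "E12 (- 1 - real m) 0 (d + 1 + real m) e - E21 (- 1 - real m) 0 (d + 1 + real m) e =
    (\<Sum>i\<le>m. of_nat (m choose i) * E02 (- 1 - real i) 0 (d + 1 + real i) e)"
proof -
  have de': "- d - - e \<in> \<int>" using Ints_minus[OF de] by simp
  \<comment> \<open>By homogeneity this is \<open>\<mu> (1/p) 1\<close>. Only the exponent
    \<open>s = e\<close> occurs in \<open>g\<close>, so the conjugate powers cancel and a Laurent
    series in \<open>p\<close> alone remains.\<close>
  define h where "h = (\<lambda>p. zpow (- d) (- e) p * g p)"
  define H where "H = (\<lambda>x. h (1 / x))"
  define A where "A = (\<lambda>k::int. E12 (of_int k) 0 (d - of_int k) e)"
  define B where "B = (\<lambda>k::int. E21 (of_int k) 0 (d - of_int k) e)"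
  define C where "C = (\<lambda>k::int. E02 (of_int k) 0 (d - of_int k) e)"
  obtain \<rho>1 where \<rho>1: "\<rho>1 > 0" "\<forall>p. p \<noteq> 0 \<longrightarrow> norm p < \<rho>1 \<longrightarrow> 
        ((\<lambda>(r, s). E12 (d - r) (e - s) r s * zpow r s p) has_sum g p) UNIV"
    using expansionD[OF correlator_D(2)[OF c]] by blast
  obtain \<rho>2 where \<rho>2: "\<rho>2 > 0" "\<forall>q. q \<noteq> 0 \<longrightarrow> norm q < \<rho>2 \<longrightarrow> 
        ((\<lambda>(r, s). E02 r s (d - r) (e - s) * zpow r s q) has_sum (zpow d e (1 + q) * g (1 / (1 + q)))) UNIV"
    using expansionD[OF correlator_D(3)[OF c]] by blast
  obtain \<rho>3 where \<rho>3: "\<rho>3 > 0" "\<forall>q. q \<noteq> 0 \<longrightarrow> norm q < \<rho>3 \<longrightarrow> 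
        ((\<lambda>(r, s). E21 r s (d - r) (e - s) * zpow r s q) has_sum (zpow d e q * g (1 / q))) UNIV"
    using expansionD[OF correlator_D(4)[OF c]] by blast
  have h: "((\<lambda>k. A (- k) * p powi k) has_sum h p) UNIV" if p: "p \<noteq> 0" "norm p < \<rho>1" for p
  proof -
    have "((\<lambda>k::int. E12 (d - (d + of_int k)) (e - e) (d + of_int k) e * zpow (d + of_int k) e p) has_sum g p) UNIV"
    proof (rule has_sum_expansion_int[OF \<rho>1(2)[rule_format, OF p]])
      fix r s assume "E12 (d - r) (e - s) r s \<noteq> 0"
      hence *: "e - s = 0" "d - r \<in> \<int>" using E12 by blast+
      thus "s = e \<and> r - d \<in> \<int>" using Ints_minus[OF *(2)] by simp
    qed
    hence "((\<lambda>k. zpow (- d) (- e) p * (A (- k) * zpow (d + of_int k) e p)) has_sum h p) UNIV"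
      unfolding h_def A_def by (intro has_sum_cmult_right) simp
    moreover have "zpow (- d) (- e) p * (A (- k) * zpow (d + of_int k) e p) = A (- k) * p powi k" for k
    proof -
      have "zpow (d + of_int k) (e + 0) p = zpow d e p * zpow (of_int k) 0 p"
        using de p by (intro zpow_add) auto
      thus ?thesis using p de by (simp add: zpow_minus zpow_int zpow_nonzero)
    qed
    ultimately show ?thesis by simp
  qed
  have "h holomorphic_on - {0, 1}"
  proof (rule ranalytic_holomorphic_continuation[OF _ \<rho>1(1)])
    show "ranalytic h p" if "p \<in> - {0, 1}" for p
      unfolding h_def using that correlator_D(1)[OF c] de'
      by (intro ranalytic_mult ranalytic_zpow) auto
    show "h holomorphic_on ball 0 \<rho>1 - {0}" by (rule laurent_holomorphic[OF h])
  qed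
  moreover have "(\<lambda>x::complex. 1 / x) ` (- {0, 1}) \<subseteq> - {0, 1}" by auto
  ultimately have holH: "H holomorphic_on - {0, 1}"
    unfolding H_def
    by (intro holomorphic_on_compose_gen[of "\<lambda>x. 1 / x" "- {0, 1}" h, unfolded o_def]) (auto intro!: holomorphic_intros)
  have HB: "((\<lambda>k. B k * q powi k) has_sum H q) UNIV" if q: "q \<noteq> 0" "norm q < \<rho>3" for q
  proof -
    have "((\<lambda>k::int. E21 (0 + of_int k) 0 (d - (0 + of_int k)) (e - 0) * zpow (0 + of_int k) 0 q) has_sum (zpow d e q * g (1 / q))) UNIV"
      by (rule has_sum_expansion_int[OF \<rho>3(2)[rule_format, OF q]]) (use E21 in auto)
    thus ?thesis using q de' by (simp add: B_def H_def h_def zpow_inverse zpow_int)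
  qed
  have HC: "((\<lambda>k. C k * q powi k) has_sum H (1 + q)) UNIV" if q: "q \<noteq> 0" "norm q < min \<rho>2 1" for q
  proof -
    have q1: "1 + q \<noteq> 0" using q(2) by (metis add.inverse_unique less_irrefl min_less_iff_conj norm_minus_cancel norm_one)
    have q2: "norm q < \<rho>2" using q by simp
    have "((\<lambda>k::int. E02 (0 + of_int k) 0 (d - (0 + of_int k)) (e - 0) * zpow (0 + of_int k) 0 q) has_sum (zpow d e (1 + q) * g (1 / (1 + q)))) UNIV"
      by (rule has_sum_expansion_int[OF \<rho>2(2)[rule_format, OF q(1) q2]]) (use E02 in auto)
    thus ?thesis using q q1 de' by (simp add: C_def H_def h_def zpow_inverse zpow_int)
  qed
  \<comment> \<open>At infinity \<open>H x = h (1 / x)\<close> inherits the expansion of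
    \<open>h\<close> at 0, with the index reversed.\<close>
  have HA: "((\<lambda>k. A k * x powi k) has_sum H x) UNIV" if x: "norm x > 1 / \<rho>1" for x
  proof -
    have nx: "norm x > 0" using x \<rho>1(1) by (meson less_trans zero_less_divide_1_iff)
    hence "x \<noteq> 0" by auto
    moreover have "norm (1 / x) < \<rho>1" using x \<rho>1(1) nx by (simp add: norm_divide field_simps)
    ultimately have "((\<lambda>k. A (- k) * (1 / x) powi k) has_sum H x) UNIV"
      unfolding H_def by (intro h) auto
    also have "?this \<longleftrightarrow> ((\<lambda>k. A k * x powi k) has_sum H x) UNIV"
      by (rule has_sum_reindex_bij_witness[of _ uminus uminus]) (auto simp: power_int_minus power_int_divide_distrib inverse_eq_divide)
    finally show ?thesis .
  qed
  define \<rho> where "\<rho> = min \<rho>1 (min \<rho>3 (min \<rho>2 1))"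
  have \<rho>: "\<rho> > 0" "\<rho> \<le> \<rho>1" "\<rho> \<le> \<rho>3" "\<rho> \<le> min \<rho>2 1" using \<rho>1 \<rho>2 \<rho>3 by (auto simp: \<rho>_def)
  have "1 / \<rho>1 \<le> 1 / \<rho>" using \<rho> by (simp add: frac_le)
  hence "A (-1 - int m) - B (-1 - int m) = (\<Sum>i\<le>m. of_nat (m choose i) * C (-1 - int i))"
    using \<rho> by (intro residue_formula[OF holH \<rho>(1) HB HC HA]) auto
  thus ?thesis by (simp add: A_def B_def C_def algebra_simps)
qed

section \<open>First-order recurrences and binomial series\<close>

lemma signed_binom_Suc:
  "real (Suc k) * signed_binom \<alpha> (Suc k) = (real k - \<alpha>) * signed_binom \<alpha> k"
proof -
  have "real (Suc k) * (\<alpha> gchoose Suc k) = (\<alpha> - real k) * (\<alpha> gchoose k)"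
    by (simp only: gbinomial_absorption gbinomial_absorb_comp)
  hence "(- 1) ^ Suc k * (real (Suc k) * (\<alpha> gchoose Suc k)) = (- 1) ^ Suc k * ((\<alpha> - real k) * (\<alpha> gchoose k))"
    by simp
  thus ?thesis unfolding signed_binom_def by (simp only: power_Suc mult_ac minus_mult_left minus_mult_right mult_1_left) (simp add: algebra_simps)
qed

text \<open>The recurrence is the equation \<open>(1 - q) f' = - \<alpha> f\<close> in coefficients.
  Its left factor vanishes only at \<open>r = 0\<close>, which leaves \<open>f 0\<close> free; any
  other chain of indices starts below \<open>N\<close> with zeros and stays zero until it would
  reach 0.\<close>

lemma first_order_recurrence:
  fixes f :: "real \<Rightarrow> complex"
  assumes lower: "\<And>r. f r \<noteq> 0 \<Longrightarrow> N \<le> r"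
    and rec: "\<And>r. of_real r * f r = of_real (r - 1 - \<alpha>) * f (r - 1)"
  shows "f (real k) = of_real (signed_binom \<alpha> k) * f 0"
    and "r \<notin> \<nat> \<Longrightarrow> f r = 0"
proof -
  show "f (real k) = of_real (signed_binom \<alpha> k) * f 0"
  proof (induction k)
    case (Suc k)
    have "of_real (real (Suc k)) * f (real (Suc k)) = of_real (real k - \<alpha>) * f (real k)"
      using rec[of "real (Suc k)"] by simp
    also have "\<dots> = of_real ((real k - \<alpha>) * signed_binom \<alpha> k) * f 0"
      unfolding Suc.IH by simp
    also have "\<dots> = of_real (real (Suc k)) * (of_real (signed_binom \<alpha> (Suc k)) * f 0)"
      unfolding signed_binom_Suc[symmetric] by simp
    finally show ?case 
      by (metis mult_cancel_left nat.distinct(1) of_nat_eq_0_iff of_real_eq_0_iff)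
  qed auto
  have "f r = 0" if "r \<notin> \<nat>" "r < N + real n" for r n
    using that
  proof (induction n arbitrary: r)
    case 0
    thus ?case using lower[of r] by auto
  next
    case (Suc n)
    have "r - 1 \<notin> \<nat>"
    proof
      assume "r - 1 \<in> \<nat>"
      hence "r - 1 + 1 \<in> \<nat>" by (intro Nats_add Nats_1)
      thus False using Suc.prems by simp
    qed
    hence "f (r - 1) = 0" using Suc by (intro Suc.IH) auto
    moreover have "r \<noteq> 0" using Suc.prems by auto
    ultimately show ?case using rec[of r] by simp
  qed
  moreover obtain n where "r < N + real n" 
    using reals_Archimedean2[of "r - N"] by (auto simp: algebra_simps)
  ultimately show "r \<notin> \<nat> \<Longrightarrow> f r = 0" by blast
qed

text \<open>The one-variable recurrence is solved in each exponent separately, so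
  \<open>c 0 0\<close> determines the double series. The function \<open>F\<close> is arbitrary:
  \<open>exp\<close> supplies truncation and integrality of the support.\<close>

lemma binomial_recurrence:
  fixes c :: "complex series2"
  assumes exp: "expansion F c"
    and rec1: "\<And>r s. of_real r * c r s = of_real (r - 1 - \<alpha>) * c (r - 1) s"
    and rec2: "\<And>r s. of_real s * c r s = of_real (s - 1 - \<beta>) * c r (s - 1)"
    and ab: "\<alpha> - \<beta> \<in> \<int>"
  shows "expansion (\<lambda>q. c 0 0 * zpow \<alpha> \<beta> (1 - q)) c"
    and "r \<notin> \<nat> \<or> s \<notin> \<nat> \<Longrightarrow> c r s = 0"
proof -
  obtain N where N: "\<And>r s. c r s \<noteq> 0 \<Longrightarrow> N \<le> r" "\<And>r s. c r s \<noteq> 0 \<Longrightarrow> N \<le> s"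
    and int: "\<And>r s. c r s \<noteq> 0 \<Longrightarrow> r - s \<in> \<int>"
    using expansionD[OF exp] by blast
  have z1: "c r s = 0" if "r \<notin> \<nat>" for r s
    using first_order_recurrence(2)[of "\<lambda>r. c r s" N \<alpha>, OF N(1) rec1 that] .
  have z2: "c r s = 0" if "s \<notin> \<nat>" for r s
    using first_order_recurrence(2)[of "\<lambda>s. c r s" N \<beta>, OF N(2) rec2 that] .
  show "r \<notin> \<nat> \<or> s \<notin> \<nat> \<Longrightarrow> c r s = 0" using z1 z2 by blast
  have val: "c (real k) (real l) = c 0 0 * of_real (signed_binom \<alpha> k * signed_binom \<beta> l)" for k l
  proof -
    have "c (real k) (real l) = of_real (signed_binom \<alpha> k) * c 0 (real l)"
      using first_order_recurrence(1)[of "\<lambda>r. c r (real l)" N \<alpha>, OF N(1) rec1] .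
    also have "c 0 (real l) = of_real (signed_binom \<beta> l) * c 0 0"
      using first_order_recurrence(1)[of "\<lambda>s. c 0 s" N \<beta>, OF N(2) rec2] .
    finally show ?thesis by simp
  qed
  show "expansion (\<lambda>q. c 0 0 * zpow \<alpha> \<beta> (1 - q)) c"
  proof (rule expansionI[of _ N 1])
    fix q :: complex assume q: "q \<noteq> 0" "norm q < 1"
    have "((\<lambda>(k, l). c 0 0 * (of_real (signed_binom \<alpha> k * signed_binom \<beta> l) * (q ^ k * cnj q ^ l))) 
            has_sum (c 0 0 * zpow \<alpha> \<beta> (1 - q))) UNIV"
      using has_sum_cmult_right[OF zpow_one_minus_has_sum[OF q(2) ab]] by (simp add: case_prod_unfold)
    also have "(\<lambda>(k, l). c 0 0 * (of_real (signed_binom \<alpha> k * signed_binom \<beta> l) * (q ^ k * cnj q ^ l))) =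
        (\<lambda>(r, s). c r s * zpow r s q) \<circ> (\<lambda>(k, l). (real k, real l))"
      using q by (auto simp: val zpow_nat)
    also have "(\<dots> has_sum (c 0 0 * zpow \<alpha> \<beta> (1 - q))) UNIV \<longleftrightarrow> 
       ((\<lambda>(r, s). c r s * zpow r s q) has_sum (c 0 0 * zpow \<alpha> \<beta> (1 - q))) ((\<lambda>(k, l). (real k, real l)) ` UNIV)"
      by (rule has_sum_reindex[symmetric]) (auto simp: inj_on_def)
    also have "\<dots> \<longleftrightarrow> ((\<lambda>(r, s). c r s * zpow r s q) has_sum (c 0 0 * zpow \<alpha> \<beta> (1 - q))) UNIV"
    proof (rule has_sum_cong_neutral)
      fix x :: "real \<times> real" assume x: "x \<in> UNIV - (\<lambda>(k, l). (real k, real l)) ` UNIV"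
      obtain r s where rs: "x = (r, s)" by (cases x)
      have "r \<notin> \<nat> \<or> s \<notin> \<nat>" using x unfolding rs by (auto simp: Nats_def)
      thus "(case x of (r, s) \<Rightarrow> c r s * zpow r s q) = 0" using z1 z2 unfolding rs by auto
    qed auto
    finally show "((\<lambda>(r, s). c r s * zpow r s q) has_sum (c 0 0 * zpow \<alpha> \<beta> (1 - q))) UNIV" .
  next
    show "N \<le> r \<and> N \<le> s" if "c r s \<noteq> 0" for r s using N that by blast
  qed (use int in auto)
qed

lemma expansion_unshift:
  assumes "expansion g A" and ab: "\<alpha> - \<beta> \<in> \<int>"
  shows "expansion (\<lambda>p. zpow (- \<alpha>) (- \<beta>) p * g p) (\<lambda>r s. A (r + \<alpha>) (s + \<beta>))"
  using expansion_shift[OF assms(1), of "- \<alpha>" "- \<beta>"] Ints_minus[OF ab] by simp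

lemma shifted_binomial_recurrence:
  fixes A :: "complex series2"
  assumes exp: "expansion F A"
    and rec1: "\<And>r s. of_real (r - \<gamma>) * A r s = of_real (r - \<gamma> - 1 - \<alpha>) * A (r - 1) s"
    and rec2: "\<And>r s. of_real (s - \<delta>) * A r s = of_real (s - \<delta> - 1 - \<beta>) * A r (s - 1)"
    and ab: "\<alpha> - \<beta> \<in> \<int>" "\<gamma> - \<delta> \<in> \<int>"
  shows "expansion (\<lambda>q. zpow \<gamma> \<delta> q * (A \<gamma> \<delta> * zpow \<alpha> \<beta> (1 - q))) A"
    and "r - \<gamma> \<notin> \<nat> \<or> s - \<delta> \<notin> \<nat> \<Longrightarrow> A r s = 0"
proof -
  define c where "c = (\<lambda>r s. A (r + \<gamma>) (s + \<delta>))"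
  have "of_real r * c r s = of_real (r - 1 - \<alpha>) * c (r - 1) s"
       "of_real s * c r s = of_real (s - 1 - \<beta>) * c r (s - 1)" for r s
    using rec1[of "r + \<gamma>" "s + \<delta>"] rec2[of "s + \<delta>" "r + \<gamma>"] by (simp_all add: c_def algebra_simps)
  note * = binomial_recurrence[OF expansion_unshift[OF exp ab(2), folded c_def] this ab(1)]
  show "expansion (\<lambda>q. zpow \<gamma> \<delta> q * (A \<gamma> \<delta> * zpow \<alpha> \<beta> (1 - q))) A"
    using expansion_shift[OF *(1) ab(2)] by (simp add: c_def)
  show "r - \<gamma> \<notin> \<nat> \<or> s - \<delta> \<notin> \<nat> \<Longrightarrow> A r s = 0"
    using *(2)[of "r - \<gamma>" "s - \<delta>"] by (simp add: c_def)
qed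

lemma powi_minus_one_floor_step:
  assumes "r - s \<in> \<int>"
  shows "(- 1 :: complex) powi \<lfloor>r - 1 - s\<rfloor> = - ((- 1) powi \<lfloor>r - s\<rfloor>)"
    and "(- 1 :: complex) powi \<lfloor>r - (s - 1)\<rfloor> = - ((- 1) powi \<lfloor>r - s\<rfloor>)"
proof -
  obtain k where k: "r - s = of_int k" using assms by (auto elim: Ints_cases)
  have "r - 1 - s = of_int (k - 1)" "r - (s - 1) = of_int (k + 1)" using k by auto
  thus "(- 1 :: complex) powi \<lfloor>r - 1 - s\<rfloor> = - ((- 1) powi \<lfloor>r - s\<rfloor>)"
    and "(- 1 :: complex) powi \<lfloor>r - (s - 1)\<rfloor> = - ((- 1) powi \<lfloor>r - s\<rfloor>)"
    unfolding k by (simp_all only: floor_of_int) (simp_all add: power_int_add power_int_diff)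
qed

text \<open>
  The Ward identities force all three expansions of a three-point function of quasi-primary
  vectors to be binomial series; as the function is the same, so are the constants up to sign.
\<close>

lemma correlator_three_point:
  assumes c: "correlator d e E12 E02 E21 g"
    and ints: "\<alpha>1 - \<beta>1 \<in> \<int>" "\<alpha>2 - \<beta>2 \<in> \<int>" "\<alpha>12 - \<beta>12 \<in> \<int>"
    and d: "d = \<alpha>1 + \<alpha>2 + \<alpha>12" and e: "e = \<beta>1 + \<beta>2 + \<beta>12"
    and A12: "\<And>r s. A12 r s = E12 (d - r) (e - s) r s"
    and A02: "\<And>r s. A02 r s = E02 r s (d - r) (e - s)"
    and A21: "\<And>r s. A21 r s = E21 r s (d - r) (e - s)"
    and rec12: "\<And>r s. of_real (r - \<alpha>2) * A12 r s = of_real (r - \<alpha>2 - 1 - \<alpha>12) * A12 (r - 1) s"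
      "\<And>r s. of_real (s - \<beta>2) * A12 r s = of_real (s - \<beta>2 - 1 - \<beta>12) * A12 r (s - 1)"
    and rec21: "\<And>r s. of_real (r - \<alpha>1) * A21 r s = of_real (r - \<alpha>1 - 1 - \<alpha>12) * A21 (r - 1) s"
      "\<And>r s. of_real (s - \<beta>1) * A21 r s = of_real (s - \<beta>1 - 1 - \<beta>12) * A21 r (s - 1)"
    and rec02: "\<And>r s. of_real (r - \<alpha>12) * A02 r s = - of_real (r - \<alpha>12 - 1 - \<alpha>1) * A02 (r - 1) s"
      "\<And>r s. of_real (s - \<beta>12) * A02 r s = - of_real (s - \<beta>12 - 1 - \<beta>1) * A02 r (s - 1)"
  shows "A02 \<alpha>12 \<beta>12 = A12 \<alpha>2 \<beta>2"
    and "A21 \<alpha>1 \<beta>1 = (- 1) powi \<lfloor>\<alpha>12 - \<beta>12\<rfloor> * A12 \<alpha>2 \<beta>2"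
    and "r - \<alpha>12 \<notin> \<nat> \<or> s - \<beta>12 \<notin> \<nat> \<Longrightarrow> A02 r s = 0"
proof -
  define C where "C = A12 \<alpha>2 \<beta>2"
  have de: "d - e \<in> \<int>" using Ints_add[OF Ints_add[OF ints(1,2)] ints(3)] by (simp add: d e algebra_simps)
  have exp12: "expansion g A12" 
    using correlator_D(2)[OF c] by (rule expansion_cong[OF _ zero_less_one]) (auto simp: A12)
  have exp02: "expansion (\<lambda>q. zpow d e (1 + q) * g (1 / (1 + q))) A02"
    using correlator_D(3)[OF c] by (rule expansion_cong[OF _ zero_less_one]) (auto simp: A02)
  have exp21: "expansion (\<lambda>q. zpow d e q * g (1 / q)) A21"
    using correlator_D(4)[OF c] by (rule expansion_cong[OF _ zero_less_one]) (auto simp: A21)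
  \<comment> \<open>The closed form holds near 0 and is continued to \<open>- {0, 1}\<close>, so
    that it can be confronted with the expansions at infinity and at 1.\<close>
  have g: "g p = zpow \<alpha>2 \<beta>2 p * (C * zpow \<alpha>12 \<beta>12 (1 - p))" if "p \<in> - {0, 1}" for p
  proof -
    obtain \<rho> where \<rho>: "\<rho> > 0" "\<And>p. p \<noteq> 0 \<Longrightarrow> norm p < \<rho> \<Longrightarrow> g p = zpow \<alpha>2 \<beta>2 p * (C * zpow \<alpha>12 \<beta>12 (1 - p))"
      using expansion_unique_function[OF exp12 shifted_binomial_recurrence(1)[OF exp12 rec12 ints(3,2)]] 
      unfolding C_def by blast
    have "g p - zpow \<alpha>2 \<beta>2 p * (C * zpow \<alpha>12 \<beta>12 (1 - p)) = 0"
    proof (rule ranalytic_zero_continuation[OF _ \<rho>(1) _ that])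
      fix p :: complex assume "p \<in> - {0, 1}"
      thus "ranalytic (\<lambda>p. g p - zpow \<alpha>2 \<beta>2 p * (C * zpow \<alpha>12 \<beta>12 (1 - p))) p"
        using correlator_D(1)[OF c] ints
        by (intro ranalytic_diff ranalytic_mult ranalytic_const ranalytic_zpow ranalytic_zpow_one_minus) auto
    qed (use \<rho>(2) in auto)
    thus ?thesis by simp
  qed
  obtain \<rho>1 where \<rho>1: "\<rho>1 > 0" "\<And>q. q \<noteq> 0 \<Longrightarrow> norm q < \<rho>1 \<Longrightarrow> 
       zpow d e q * g (1 / q) = zpow \<alpha>1 \<beta>1 q * (A21 \<alpha>1 \<beta>1 * zpow \<alpha>12 \<beta>12 (1 - q))"
    using expansion_unique_function[OF exp21 shifted_binomial_recurrence(1)[OF exp21 rec21 ints(3,1)]] by blast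
  show "A21 \<alpha>1 \<beta>1 = (- 1) powi \<lfloor>\<alpha>12 - \<beta>12\<rfloor> * A12 \<alpha>2 \<beta>2"
  proof -
    \<comment> \<open>Both closed forms are valid at this point and all powers there are nonzero, so
      one evaluation fixes the constant.\<close>
    define q :: complex where "q = of_real (min \<rho>1 1 / 2)"
    have nq: "norm q = min \<rho>1 1 / 2" unfolding q_def norm_of_real using \<rho>1(1) by simp
    have q: "q \<noteq> 0" "norm q < \<rho>1" "norm q < 1" using \<rho>1(1) nq by auto
    have q1: "1 - q \<noteq> 0" using q(3) by auto
    have "1 / q \<in> - {0, 1}" using q by auto
    hence "g (1 / q) = zpow \<alpha>2 \<beta>2 (1 / q) * (C * zpow \<alpha>12 \<beta>12 (1 - 1 / q))" by (rule g)
    also have "1 - 1 / q = - (1 - q) * (1 / q)" using q by (simp add: field_simps)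
    also have "zpow \<alpha>12 \<beta>12 \<dots> = (- 1) powi \<lfloor>\<alpha>12 - \<beta>12\<rfloor> * zpow \<alpha>12 \<beta>12 (1 - q) * zpow (- \<alpha>12) (- \<beta>12) q"
      using zpow_inverse[OF q(1) ints(3)] by (simp only: zpow_mult zpow_uminus)
    finally have eq1: "g (1 / q) = inverse (zpow \<alpha>2 \<beta>2 q) * (C * ((- 1) powi \<lfloor>\<alpha>12 - \<beta>12\<rfloor> * zpow \<alpha>12 \<beta>12 (1 - q) * inverse (zpow \<alpha>12 \<beta>12 q)))"
      using q ints by (simp add: zpow_inverse zpow_minus)
    have "\<alpha>1 + \<alpha>2 - (\<beta>1 + \<beta>2) \<in> \<int>" using Ints_add[OF ints(1,2)] by (simp add: algebra_simps)
    hence eq2: "zpow d e q = zpow \<alpha>1 \<beta>1 q * zpow \<alpha>2 \<beta>2 q * zpow \<alpha>12 \<beta>12 q"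
      unfolding d e using ints q by (simp add: zpow_add)
    have cancel: "A = s * C" if "x * y * z * (inverse y * (C * (s * w * inverse z))) = x * (A * w)" 
      "x \<noteq> 0" "y \<noteq> 0" "z \<noteq> 0" "w \<noteq> 0" for x y z w s A C :: complex
      using that by (simp add: field_simps)
    show ?thesis unfolding C_def[symmetric]
      by (rule cancel[OF \<rho>1(2)[OF q(1,2), unfolded eq1 eq2]]; rule zpow_nonzero; rule q(1) q1)
  qed
  \<comment> \<open>Passing to \<open>- q\<close> absorbs the minus sign in \<open>rec02\<close>, so
    that \<open>c\<close> satisfies the recurrence of \<open>(1 - q)^\<alpha>1\<close>.\<close>
  define c where "c = (\<lambda>r s. (- 1) powi \<lfloor>r - s\<rfloor> * A02 (r + \<alpha>12) (s + \<beta>12))"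
  have expc: "expansion (\<lambda>q. zpow (- \<alpha>12) (- \<beta>12) (- q) * (zpow d e (1 + (- q)) * g (1 / (1 + (- q))))) c"
    unfolding c_def by (rule expansion_uminus[OF expansion_unshift[OF exp02 ints(3)]])
  have cint: "r - s \<in> \<int>" if "c r s \<noteq> 0" for r s using expansionD[OF expc] that by blast
  have i1: "r - 1 - s \<in> \<int> \<longleftrightarrow> r - s \<in> \<int>" "r - (s - 1) \<in> \<int> \<longleftrightarrow> r - s \<in> \<int>" for r s :: real
  proof -
    have "r - 1 - s = (r - s) - 1" "r - (s - 1) = (r - s) + 1" by simp_all
    thus "r - 1 - s \<in> \<int> \<longleftrightarrow> r - s \<in> \<int>" "r - (s - 1) \<in> \<int> \<longleftrightarrow> r - s \<in> \<int>"
      by (metis Ints_1 Ints_add Ints_diff diff_add_cancel add_diff_cancel_right')+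
  qed
  have sgn: "a * (\<sigma> * x) = b * (- \<sigma> * y)" if "a * x = - b * y" for a b x y \<sigma> :: complex
    using that by (simp add: mult.left_commute[of a \<sigma>])
  have rc1: "of_real r * c r s = of_real (r - 1 - \<alpha>1) * c (r - 1) s" for r s
  proof (cases "r - s \<in> \<int>")
    case True
    have "of_real r * A02 (r + \<alpha>12) (s + \<beta>12) = - of_real (r - 1 - \<alpha>1) * A02 (r - 1 + \<alpha>12) (s + \<beta>12)"
      using rec02(1)[of "r + \<alpha>12" "s + \<beta>12"] by (simp add: algebra_simps)
    thus ?thesis unfolding c_def powi_minus_one_floor_step(1)[OF True] by (rule sgn)
  next
    case False
    \<comment> \<open>Off the integers a unit shift of the floor says nothing about signs, but there
      the coefficients vanish.\<close>
    hence "c r s = 0" "c (r - 1) s = 0" using cint[of r s] cint[of "r - 1" s] i1 by blast+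
    thus ?thesis by simp
  qed
  have rc2: "of_real s * c r s = of_real (s - 1 - \<beta>1) * c r (s - 1)" for r s
  proof (cases "r - s \<in> \<int>")
    case True
    have "of_real s * A02 (r + \<alpha>12) (s + \<beta>12) = - of_real (s - 1 - \<beta>1) * A02 (r + \<alpha>12) (s - 1 + \<beta>12)"
      using rec02(2)[of "s + \<beta>12" "r + \<alpha>12"] by (simp add: algebra_simps)
    thus ?thesis unfolding c_def powi_minus_one_floor_step(2)[OF True] by (rule sgn)
  next
    case False
    hence "c r s = 0" "c r (s - 1) = 0" using cint[of r s] cint[of r "s - 1"] i1 by blast+
    thus ?thesis by simp
  qed
  note bin = binomial_recurrence[OF expc rc1 rc2 ints(1)]
  show "r - \<alpha>12 \<notin> \<nat> \<or> s - \<beta>12 \<notin> \<nat> \<Longrightarrow> A02 r s = 0"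
    using bin(2)[of "r - \<alpha>12" "s - \<beta>12"] by (simp add: c_def)
  obtain \<rho>2 where \<rho>2: "\<rho>2 > 0" "\<And>q. q \<noteq> 0 \<Longrightarrow> norm q < \<rho>2 \<Longrightarrow> 
      zpow (- \<alpha>12) (- \<beta>12) (- q) * (zpow d e (1 + (- q)) * g (1 / (1 + (- q)))) = c 0 0 * zpow \<alpha>1 \<beta>1 (1 - q)"
    using expansion_unique_function[OF expc bin(1)] by blast
  have c00: "c 0 0 = A02 \<alpha>12 \<beta>12" by (simp add: c_def)
  show "A02 \<alpha>12 \<beta>12 = A12 \<alpha>2 \<beta>2"
  proof -
    define q :: complex where "q = of_real (min \<rho>2 1 / 2)"
    have nq: "norm q = min \<rho>2 1 / 2" unfolding q_def norm_of_real using \<rho>2(1) by simp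
    have q: "q \<noteq> 0" "norm q < \<rho>2" "norm q < 1" using \<rho>2(1) nq by auto
    have q': "- q \<noteq> 0" using q by simp
    have q1: "1 + (- q) \<noteq> 0" using q(3) by auto
    have "1 / (1 + (- q)) \<in> - {0, 1}" using q q1 by (auto simp: field_simps)
    hence "g (1 / (1 + (- q))) = zpow \<alpha>2 \<beta>2 (1 / (1 + (- q))) * (C * zpow \<alpha>12 \<beta>12 (1 - 1 / (1 + (- q))))" by (rule g)
    also have "1 - 1 / (1 + (- q)) = (- q) * (1 / (1 + (- q)))" using q1 by (simp add: field_simps)
    also have "zpow \<alpha>12 \<beta>12 \<dots> = zpow \<alpha>12 \<beta>12 (- q) * zpow (- \<alpha>12) (- \<beta>12) (1 + (- q))"
      using zpow_inverse[OF q1 ints(3)] by (simp only: zpow_mult)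
    finally have eq1: "g (1 / (1 + (- q))) = inverse (zpow \<alpha>2 \<beta>2 (1 + (- q))) * (C * (zpow \<alpha>12 \<beta>12 (- q) * inverse (zpow \<alpha>12 \<beta>12 (1 + (- q)))))"
      unfolding zpow_inverse[OF q1 ints(2)] zpow_minus[OF q1 ints(2)] zpow_minus[OF q1 ints(3)] .
    have "\<alpha>1 + \<alpha>2 - (\<beta>1 + \<beta>2) \<in> \<int>" using Ints_add[OF ints(1,2)] by (simp add: algebra_simps)
    hence eq2: "zpow d e (1 + (- q)) = zpow \<alpha>1 \<beta>1 (1 + (- q)) * zpow \<alpha>2 \<beta>2 (1 + (- q)) * zpow \<alpha>12 \<beta>12 (1 + (- q))"
      unfolding d e using ints zpow_add[OF q1] by metis
    have cancel: "A = C" if "inverse w * (x * y * z * (inverse y * (C * (w * inverse z)))) = A * x" 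
      "x \<noteq> 0" "y \<noteq> 0" "z \<noteq> 0" "w \<noteq> 0" for x y z w A C :: complex
      using that by (simp add: field_simps)
    have eq3: "1 - q = 1 + (- q)" by simp
    show ?thesis unfolding C_def[symmetric] c00[symmetric]
      by (rule cancel[OF \<rho>2(2)[OF q(1,2), unfolded eq1 eq2 eq3 zpow_minus[OF q' ints(3)]]]; rule zpow_nonzero; rule q1 q')
  qed
qed

section \<open>Full vertex algebras without convergence\<close>

text \<open>
  The assumptions are invariant under exchanging \<open>z\<close> and \<open>zb\<close>, so that every lemma on the
  holomorphic structure has an antiholomorphic counterpart, obtained from the interpretation \<open>bar\<close>.
  The space \<open>F = 0\<close> is excluded by \<open>vac_nonzero\<close>.
\<close>

locale fvoa_core = vector_space sc
  for sc :: "complex \<Rightarrow> 'a::ab_group_add \<Rightarrow> 'a" +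
  fixes F :: "real \<Rightarrow> real \<Rightarrow> 'a set"
    and Y :: "'a vertex_op"
    and vac \<omega> \<omega>b :: 'a
  assumes grading: "graded_by sc F"
    and Y_linear1: "Vector_Spaces.linear sc sc (\<lambda>a. Y a r s b)"
    and Y_linear2: "Vector_Spaces.linear sc sc (Y a r s)"
    and Y_int: "Y a r s b \<noteq> 0 \<Longrightarrow> r - s \<in> \<int>"
    and vac_weight: "vac \<in> F 0 0"
    and vac_nonzero: "vac \<noteq> 0"
    and Y_lower: "\<exists>N. \<forall>r s. r \<ge> N \<or> s \<ge> N \<longrightarrow> Y a r s b = 0"
    and weight_int: "h - hb \<notin> \<int> \<Longrightarrow> F h hb = {0}"
    and Y_vac: "\<not> (- r - 1 \<in> \<nat> \<and> - s - 1 \<in> \<nat>) \<Longrightarrow> Y a r s vac = 0"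
    and Y_vac_const: "Y a (-1) (-1) vac = a"
    and vac_Y: "Y vac r s a = (if r = -1 \<and> s = -1 then a else 0)"
    and correlators: "u \<in> restricted_dual sc F \<Longrightarrow> d - e \<in> \<int> \<Longrightarrow>
       \<exists>g. correlator d e
         (\<lambda>r1 s1 r2 s2. u (Y a (- r1 - 1) (- s1 - 1) (Y b (- r2 - 1) (- s2 - 1) c)))
         (\<lambda>r0 s0 r2 s2. u (Y (Y a (- r0 - 1) (- s0 - 1) b) (- r2 - 1) (- s2 - 1) c))
         (\<lambda>r1 s1 r2 s2. u (Y b (- r2 - 1) (- s2 - 1) (Y a (- r1 - 1) (- s1 - 1) c))) g"
    and Y_weight: "\<lbrakk>a \<in> F h hb; b \<in> F h' hb'\<rbrakk> \<Longrightarrow> Y a r s b \<in> F (h + h' - r - 1) (hb + hb' - s - 1)"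
    and omega_Dbar: "Y \<omega> (-1) (-2) vac = 0"
    and omegab_D: "Y \<omega>b (-2) (-1) vac = 0"
    and virasoro_L: "\<exists>c. virasoro sc c (\<lambda>n. Y \<omega> (of_int n + 1) (-1))"
    and virasoro_Lb: "\<exists>c. virasoro sc c (\<lambda>n. Y \<omega>b (-1) (of_int n + 1))"
    and D_eq: "Y a (-2) (-1) vac = Y \<omega> 0 (-1) a"
    and Db_eq: "Y a (-1) (-2) vac = Y \<omega>b (-1) 0 a"
    and L0: "v \<in> F h hb \<Longrightarrow> Y \<omega> 1 (-1) v = sc (of_real h) v"
    and Lb0: "v \<in> F h hb \<Longrightarrow> Y \<omega>b (-1) 1 v = sc (of_real hb) v"
    and bounded_below: "\<exists>N. \<forall>h hb. h \<le> N \<or> hb \<le> N \<longrightarrow> F h hb = {0}"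
    and F00: "F 0 0 = {sc k vac | k. True}"
    and negative_weight: "of_int k = 2 * h \<Longrightarrow> h < 0 \<Longrightarrow> F h hb = {0}"
    and negative_weight_bar: "of_int k = 2 * hb \<Longrightarrow> hb < 0 \<Longrightarrow> F h hb = {0}"
    and Lp_F1: "v \<in> F 1 hb \<Longrightarrow> Y \<omega> 2 (-1) v = 0"
    and Lpb_F1: "v \<in> F h 1 \<Longrightarrow> Y \<omega>b (-1) 2 v = 0"
begin

lemma linearD:
  assumes "Vector_Spaces.linear sc s2 f"
  shows "f (x + y) = f x + f y" "f (x - y) = f x - f y" "f (sc k x) = s2 k (f x)" "f 0 = 0" "f (- x) = - f x"
    "f (sum g A) = (\<Sum>i\<in>A. f (g i))"
proof -
  interpret Vector_Spaces.linear sc s2 f by fact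
  show "f (x + y) = f x + f y" "f (x - y) = f x - f y" "f (sc k x) = s2 k (f x)" "f 0 = 0" "f (- x) = - f x"
    "f (sum g A) = (\<Sum>i\<in>A. f (g i))"
    by (simp_all add: add diff scale neg sum)
qed

lemmas Y_left = linearD[OF Y_linear1]
lemmas Y_right = linearD[OF Y_linear2]

section \<open>Homogeneous components and the restricted dual\<close>

lemma F_subspace: "subspace (F h hb)"
  using grading unfolding graded_by_def by blast

lemmas F_0 [simp] = subspace_0[OF F_subspace]
lemmas F_add = subspace_add[OF F_subspace]
lemmas F_scale = subspace_scale[OF F_subspace]

definition comp :: "real \<times> real \<Rightarrow> 'a \<Rightarrow> 'a" where
  "comp x v = (THE c. (\<forall>h hb. c (h, hb) \<in> F h hb) \<and> finite {x. c x \<noteq> 0} \<and> v = sum c {x. c x \<noteq> 0}) x"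

lemma comp_unique:
  assumes "\<And>h hb. c (h, hb) \<in> F h hb" "finite X" "\<And>x. x \<notin> X \<Longrightarrow> c x = 0" "v = sum c X"
  shows "comp x v = c x"
proof -
  have X: "{x. c x \<noteq> 0} \<subseteq> X" using assms(3) by blast
  have "v = sum c {x. c x \<noteq> 0}"
    unfolding assms(4) by (rule sum.mono_neutral_right[OF assms(2) X]) auto
  moreover have "finite {x. c x \<noteq> 0}" using X assms(2) finite_subset by blast
  ultimately have "(\<forall>h hb. c (h, hb) \<in> F h hb) \<and> finite {x. c x \<noteq> 0} \<and> v = sum c {x. c x \<noteq> 0}"
    using assms(1) by blast
  moreover have "\<exists>!c. (\<forall>h hb. c (h, hb) \<in> F h hb) \<and> finite {x. c x \<noteq> 0} \<and> v = sum c {x. c x \<noteq> 0}"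
    using grading unfolding graded_by_def by blast
  ultimately have "(THE c. (\<forall>h hb. c (h, hb) \<in> F h hb) \<and> finite {x. c x \<noteq> 0} \<and> v = sum c {x. c x \<noteq> 0}) = c"
    by (intro the1_equality)
  thus ?thesis by (simp add: comp_def)
qed

lemma comp_props:
  "comp (h, hb) v \<in> F h hb" "finite {x. comp x v \<noteq> 0}" "v = (\<Sum>x | comp x v \<noteq> 0. comp x v)"
proof -
  have ex: "\<exists>!c. (\<forall>h hb. c (h, hb) \<in> F h hb) \<and> finite {x. c x \<noteq> 0} \<and> v = sum c {x. c x \<noteq> 0}"
    using grading unfolding graded_by_def by blast
  have "(\<lambda>x. comp x v) = (THE c. (\<forall>h hb. c (h, hb) \<in> F h hb) \<and> finite {x. c x \<noteq> 0} \<and> v = sum c {x. c x \<noteq> 0})"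
    by (simp add: comp_def)
  note * = theI'[OF ex, folded this]
  show "comp (h, hb) v \<in> F h hb" using * by blast
  show "finite {x. comp x v \<noteq> 0}" using * by blast
  show "v = (\<Sum>x | comp x v \<noteq> 0. comp x v)" using * by blast
qed

lemma comp_homogeneous: "v \<in> F h hb \<Longrightarrow> comp x v = (if x = (h, hb) then v else 0)"
  by (rule comp_unique[of _ "{(h, hb)}"]) auto

lemma comp_add: "comp x (v + w) = comp x v + comp x w"
proof (rule comp_unique[of _ "{x. comp x v \<noteq> 0} \<union> {x. comp x w \<noteq> 0}"])
  let ?X = "{x. comp x v \<noteq> 0} \<union> {x. comp x w \<noteq> 0}"
  have fin: "finite ?X" using comp_props(2) by blast
  have v: "v = (\<Sum>x\<in>?X. comp x v)"
    by (rule trans[OF comp_props(3) sum.mono_neutral_left[OF fin]]) auto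
  have w: "w = (\<Sum>x\<in>?X. comp x w)"
    by (rule trans[OF comp_props(3) sum.mono_neutral_left[OF fin]]) auto
  show "v + w = (\<Sum>x\<in>?X. comp x v + comp x w)"
    using arg_cong2[OF v w, of "(+)"] by (simp only: sum.distrib)
qed (use comp_props(1,2) F_add in auto)

lemma comp_scale: "comp x (sc k v) = sc k (comp x v)"
proof (rule comp_unique[of _ "{x. comp x v \<noteq> 0}"])
  show "sc k v = (\<Sum>x | comp x v \<noteq> 0. sc k (comp x v))"
    using arg_cong[OF comp_props(3)[of v], of "sc k"] by (simp only: scale_sum_right)
qed (use comp_props(1,2) F_scale in auto)

lemma comp_linear: "Vector_Spaces.linear sc sc (comp x)"
  unfolding Vector_Spaces.linear_iff by (auto simp: comp_add comp_scale intro: vector_space_axioms)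

lemma homogeneous_induct [case_names homogeneous add]:
  assumes "\<And>h hb v. v \<in> F h hb \<Longrightarrow> P v" "\<And>v w. P v \<Longrightarrow> P w \<Longrightarrow> P (v + w)"
  shows "P v"
proof -
  have "P (sum (\<lambda>x. comp x v) X)" if "finite X" for X
    using that
  proof (induction X)
    case empty
    show ?case using assms(1)[OF F_0] by simp
  next
    case (insert x X)
    have "P (comp x v)" using assms(1) comp_props(1) by (cases x) blast
    from assms(2)[OF this insert.IH] show ?case using insert.hyps by simp
  qed
  thus ?thesis using comp_props(2,3)[of v] by metis
qed

lemma comp_all_0: "(\<And>x. comp x v = 0) \<Longrightarrow> v = 0"
  by (rule trans[OF comp_props(3)]) simp

text \<open>A nonzero vector has a nonzero component; a functional equal to 1 on it, composed with
  the projection, lies in the restricted dual. Hence identities between vectors may be tested on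
  correlators.\<close>

lemma restricted_dual_separates:
  assumes "v \<noteq> 0"
  shows "\<exists>u\<in>restricted_dual sc F. u v \<noteq> 0"
proof -
  obtain h hb where nz: "comp (h, hb) v \<noteq> 0" using comp_all_0 assms by (metis surj_pair)
  have vs: "vector_space ((*) :: complex \<Rightarrow> complex \<Rightarrow> complex)"
    by unfold_locales (auto simp: algebra_simps)
  interpret vp: vector_space_pair sc "(*) :: complex \<Rightarrow> complex \<Rightarrow> complex"
    by (intro vector_space_pair.intro vs vector_space_axioms)
  have "independent {comp (h, hb) v}" using nz by simp
  from vp.linear_independent_extend[OF this, of "\<lambda>_. 1"]
  obtain f where f: "Vector_Spaces.linear sc (*) f" "f (comp (h, hb) v) = 1" by auto
  have "(\<lambda>w. f (comp (h, hb) w)) \<in> restricted_dual sc F"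
    unfolding restricted_dual_def
  proof (intro CollectI conjI)
    show "Vector_Spaces.linear sc (*) (\<lambda>w. f (comp (h, hb) w))"
      using Vector_Spaces.linear_compose[OF comp_linear f(1)] by (simp add: o_def)
    have "{(h', hb'). \<exists>w\<in>F h' hb'. f (comp (h, hb) w) \<noteq> 0} \<subseteq> {(h, hb)}"
      using linearD(4)[OF f(1)] by (auto simp: comp_homogeneous split: if_splits)
    thus "finite {(h', hb'). \<exists>w\<in>F h' hb'. f (comp (h, hb) w) \<noteq> 0}"
      by (rule finite_subset) simp
  qed
  thus ?thesis using f(2) by (intro bexI) auto
qed

lemma restricted_dual_linear: "u \<in> restricted_dual sc F \<Longrightarrow> Vector_Spaces.linear sc (*) u"
  unfolding restricted_dual_def by blast

lemmas rd_simps = linearD[OF restricted_dual_linear]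

lemma restricted_dual_eqI:
  assumes "\<And>u. u \<in> restricted_dual sc F \<Longrightarrow> u v = u w"
  shows "v = w"
  using restricted_dual_separates[of "v - w"] assms by (auto simp: rd_simps)

lemma swap: "fvoa_core sc (\<lambda>h hb. F hb h) (\<lambda>a r s. Y a s r) vac \<omega>b \<omega>"
proof unfold_locales
  have bij: "sum (\<lambda>(h, hb). c (hb, h)) {x. (case x of (h, hb) \<Rightarrow> c (hb, h)) \<noteq> 0} = sum c {x. c x \<noteq> 0}"
    and fin: "finite {x. (case x of (h, hb) \<Rightarrow> c (hb, h)) \<noteq> 0} \<longleftrightarrow> finite {x. c x \<noteq> 0}" for c :: "real \<times> real \<Rightarrow> 'a"
  proof -
    have img: "{x. (case x of (h, hb) \<Rightarrow> c (hb, h)) \<noteq> 0} = prod.swap ` {x. c x \<noteq> 0}" by force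
    show "sum (\<lambda>(h, hb). c (hb, h)) {x. (case x of (h, hb) \<Rightarrow> c (hb, h)) \<noteq> 0} = sum c {x. c x \<noteq> 0}"
      unfolding img by (subst sum.reindex) (auto intro!: sum.cong)
    show "finite {x. (case x of (h, hb) \<Rightarrow> c (hb, h)) \<noteq> 0} \<longleftrightarrow> finite {x. c x \<noteq> 0}"
      unfolding img by (simp add: finite_image_iff)
  qed
  show "graded_by sc (\<lambda>h hb. F hb h)" unfolding graded_by_def
  proof (intro conjI allI)
    fix v
    show "\<exists>!c. (\<forall>h hb. c (h, hb) \<in> F hb h) \<and> finite {x. c x \<noteq> 0} \<and> v = sum c {x. c x \<noteq> 0}"
    proof (rule ex1I[of _ "\<lambda>(h, hb). comp (hb, h) v"])
      show "(\<forall>h hb. (case (h, hb) of (h, hb) \<Rightarrow> comp (hb, h) v) \<in> F hb h) \<and>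
         finite {x. (case x of (h, hb) \<Rightarrow> comp (hb, h) v) \<noteq> 0} \<and>
         v = (\<Sum>x | (case x of (h, hb) \<Rightarrow> comp (hb, h) v) \<noteq> 0. case x of (h, hb) \<Rightarrow> comp (hb, h) v)"
      proof (intro conjI allI)
        show "(case (h, hb) of (h, hb) \<Rightarrow> comp (hb, h) v) \<in> F hb h" for h hb by (simp add: comp_props(1))
        show "finite {x. (case x of (h, hb) \<Rightarrow> comp (hb, h) v) \<noteq> 0}"
          by (rule fin[of "\<lambda>x. comp x v", THEN iffD2, OF comp_props(2)])
        show "v = (\<Sum>x | (case x of (h, hb) \<Rightarrow> comp (hb, h) v) \<noteq> 0. case x of (h, hb) \<Rightarrow> comp (hb, h) v)"
          by (rule trans[OF comp_props(3) bij[of "\<lambda>x. comp x v", symmetric]])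
      qed
    next
      fix c assume c: "(\<forall>h hb. c (h, hb) \<in> F hb h) \<and> finite {x. c x \<noteq> 0} \<and> v = sum c {x. c x \<noteq> 0}"
      define c' where "c' = (\<lambda>(h, hb). c (hb, h))"
      have "comp x v = c' x" for x
      proof (rule comp_unique[of c' "{x. c' x \<noteq> 0}"])
        show "finite {x. c' x \<noteq> 0}" "v = sum c' {x. c' x \<noteq> 0}"
          using c fin[of c] bij[of c] by (simp_all add: c'_def)
      qed (use c in \<open>auto simp: c'_def\<close>)
      thus "c = (\<lambda>(h, hb). comp (hb, h) v)" by (auto simp: c'_def)
    qed
  qed (rule F_subspace)
  show "\<exists>g. correlator d e
       (\<lambda>r1 s1 r2 s2. u (Y a (- s1 - 1) (- r1 - 1) (Y b (- s2 - 1) (- r2 - 1) c)))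
       (\<lambda>r0 s0 r2 s2. u (Y (Y a (- s0 - 1) (- r0 - 1) b) (- s2 - 1) (- r2 - 1) c))
       (\<lambda>r1 s1 r2 s2. u (Y b (- s2 - 1) (- r2 - 1) (Y a (- s1 - 1) (- r1 - 1) c))) g"
    if u: "u \<in> restricted_dual sc (\<lambda>h hb. F hb h)" and de: "d - e \<in> \<int>" for u d e a b c
  proof -
    have ed: "e - d \<in> \<int>" using Ints_minus[OF de] by simp
    have "{(h, hb). \<exists>v\<in>F h hb. u v \<noteq> 0} = prod.swap ` {(h, hb). \<exists>v\<in>F hb h. u v \<noteq> 0}" by force
    hence "u \<in> restricted_dual sc F" using u unfolding restricted_dual_def by simp
    from correlators[OF this ed] correlator_cnj[OF _ ed] show ?thesis by blast
  qed
  show "\<exists>N. \<forall>r s. N \<le> r \<or> N \<le> s \<longrightarrow> Y a s r b = 0" for a b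
    using Y_lower[of a b] by blast
  show "r - s \<in> \<int>" if "Y a s r b \<noteq> 0" for a r s b
    using Ints_minus[OF Y_int[OF that]] by simp
  show "F hb h = {0}" if "h - hb \<notin> \<int>" for h hb
    using weight_int[of hb h] that Ints_minus[of "hb - h"] by fastforce
  show "\<exists>N. \<forall>h hb. h \<le> N \<or> hb \<le> N \<longrightarrow> F hb h = {0}" using bounded_below by blast
qed (use Y_left(1,3) Y_right(1,3) vac_weight vac_nonzero Y_vac Y_vac_const vac_Y Y_weight omega_Dbar omegab_D virasoro_L virasoro_Lb
     D_eq Db_eq L0 Lb0 F00 negative_weight negative_weight_bar Lp_F1 Lpb_F1 in \<open>auto\<close>)

section \<open>Translation and commutators with the modes of the conformal vectors\<close>

lemma translation: "Y (Y a (-2) (-1) vac) r s b = sc (of_real (- r)) (Y a (r - 1) s b)"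
proof (cases "r - s \<in> \<int>")
  case False
  have "r - 1 - s \<notin> \<int>" using False Ints_add[of "r - 1 - s" 1] by (auto simp: algebra_simps)
  thus ?thesis using False Y_int by (metis scale_zero_right)
next
  case True
  \<comment> \<open>The bidegree \<open>(- r, - s - 1)\<close> selects the mode
    \<open>(r - 1, s)\<close> of \<open>a\<close> in \<open>correlator_translation\<close>; its
    first entry is the factor \<open>- r\<close>.\<close>
  have de: "- r - (- s - 1) \<in> \<int>" using Ints_diff[OF Ints_1 True] by (simp add: algebra_simps)
  show ?thesis
  proof (rule restricted_dual_eqI)
    fix u assume u: "u \<in> restricted_dual sc F"
    from correlators[OF this de] obtain g where g: "correlator (- r) (- s - 1)
         (\<lambda>r1 s1 r2 s2. u (Y a (- r1 - 1) (- s1 - 1) (Y vac (- r2 - 1) (- s2 - 1) b)))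
         (\<lambda>r0 s0 r2 s2. u (Y (Y a (- r0 - 1) (- s0 - 1) vac) (- r2 - 1) (- s2 - 1) b))
         (\<lambda>r1 s1 r2 s2. u (Y vac (- r2 - 1) (- s2 - 1) (Y a (- r1 - 1) (- s1 - 1) b))) g"
      by blast
    have "u (Y (Y a (- 1 - 1) (- 0 - 1) vac) (- (- r - 1) - 1) (- (- s - 1) - 1) b) =
        of_real (- r) * u (Y a (- (- r) - 1) (- (- s - 1) - 1) (Y vac (- 0 - 1) (- 0 - 1) b))"
    proof (rule correlator_translation[OF g de])
      show "r2 = 0 \<and> s2 = 0" if "u (Y a (- r1 - 1) (- s1 - 1) (Y vac (- r2 - 1) (- s2 - 1) b)) \<noteq> 0" for r1 s1 r2 s2
        using that rd_simps(4)[OF u] by (auto simp: vac_Y Y_right split: if_splits)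
      show "r0 \<in> \<nat> \<and> s0 \<in> \<nat>" if "u (Y (Y a (- r0 - 1) (- s0 - 1) vac) (- r2 - 1) (- s2 - 1) b) \<noteq> 0" for r0 s0 r2 s2
      proof (rule ccontr)
        assume "\<not> (r0 \<in> \<nat> \<and> s0 \<in> \<nat>)"
        hence "Y a (- r0 - 1) (- s0 - 1) vac = 0" by (intro Y_vac) simp
        thus False using that rd_simps(4)[OF u] by (simp add: Y_left)
      qed
    qed
    thus "u (Y (Y a (-2) (-1) vac) r s b) = u (sc (of_real (- r)) (Y a (r - 1) s b))"
      by (simp add: vac_Y rd_simps(3,5)[OF u])
  qed
qed

end

context fvoa_core begin

interpretation bar: fvoa_core sc "\<lambda>h hb. F hb h" "\<lambda>a r s. Y a s r" vac \<omega>b \<omega> by (rule swap)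

lemma translation_bar: "Y (Y a (-1) (-2) vac) r s b = sc (of_real (- s)) (Y a r (s - 1) b)"
  by (rule bar.translation)

text \<open>\<open>Dbar \<omega> = 0\<close>, so antiholomorphic translation multiplies the mode
  \<open>(r, s)\<close> by \<open>- (s + 1)\<close> and gives 0. For \<open>s = - 1\<close>,
  integrality of \<open>r - s\<close> leaves only integral \<open>r\<close>.\<close>

lemma omega_modes: "Y \<omega> r s b = 0" if "s \<noteq> -1 \<or> r \<notin> \<int>"
proof (cases "s = -1")
  case False
  have "Y (Y \<omega> (-1) (-2) vac) r (s + 1) b = sc (of_real (- (s + 1))) (Y \<omega> r s b)"
    using translation_bar[of \<omega> r "s + 1" b] by simp
  hence "sc (of_real (- (s + 1))) (Y \<omega> r s b) = 0" by (simp add: omega_Dbar Y_left)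
  hence "s + 1 = 0 \<or> Y \<omega> r s b = 0" by (simp only: scale_eq_0_iff of_real_eq_0_iff neg_equal_0_iff_equal)
  thus ?thesis using False by auto
next
  case True
  hence r: "r \<notin> \<int>" using that by blast
  show ?thesis
  proof (rule ccontr)
    assume "Y \<omega> r s b \<noteq> 0"
    hence "r - (-1) \<in> \<int>" using Y_int True by blast
    hence "r - (-1) - 1 \<in> \<int>" by (rule Ints_diff) simp
    thus False using r by simp
  qed
qed

text \<open>By \<open>omega_modes\<close> the field of \<open>\<omega>\<close> is meromorphic, so
  \<open>correlator_commutator\<close> applies. The modes \<open>m = 0, 1, 2\<close> are
  \<open>L(-1)\<close>, \<open>L(0)\<close> and \<open>L(1)\<close>.\<close>

lemma omega_commutator:
  "Y \<omega> (real m) (-1) (Y a r s b) = Y a r s (Y \<omega> (real m) (-1) b) +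
     (\<Sum>i\<le>m. sc (of_nat (m choose i)) (Y (Y \<omega> (real i) (-1) a) (r + real m - real i) s b))"
proof (cases "r - s \<in> \<int>")
  case False
  have "r + real m - real i - s \<notin> \<int>" for i
  proof
    assume "r + real m - real i - s \<in> \<int>"
    moreover have "real m - real i \<in> \<int>" by simp
    ultimately have "(r + real m - real i - s) - (real m - real i) \<in> \<int>" by (rule Ints_diff)
    moreover have "(r + real m - real i - s) - (real m - real i) = r - s" by simp
    ultimately show False using False by metis
  qed
  hence "Y w (r + real m - real i) s b = 0" for w i using Y_int by blast
  moreover have "Y a r s w = 0" for w using False Y_int by blast
  ultimately show ?thesis by (simp add: Y_right)
next
  case True
  \<comment> \<open>Chosen so that the second field enters \<open>correlator_commutator\<close> with
    the mode \<open>(r, s)\<close>.\<close>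
  define d e where "d = - r - 2 - real m" and "e = - s - 1"
  have "- (r - s) - real m - 1 \<in> \<int>" by (rule Ints_diff[OF Ints_diff[OF Ints_minus[OF True]]]) auto
  hence de: "d - e \<in> \<int>" by (simp add: d_def e_def algebra_simps)
  show ?thesis
  proof (rule restricted_dual_eqI)
    fix u assume u: "u \<in> restricted_dual sc F"
    from correlators[OF this de] obtain g where g: "correlator d e
         (\<lambda>r1 s1 r2 s2. u (Y \<omega> (- r1 - 1) (- s1 - 1) (Y a (- r2 - 1) (- s2 - 1) b)))
         (\<lambda>r0 s0 r2 s2. u (Y (Y \<omega> (- r0 - 1) (- s0 - 1) a) (- r2 - 1) (- s2 - 1) b))
         (\<lambda>r1 s1 r2 s2. u (Y a (- r2 - 1) (- s2 - 1) (Y \<omega> (- r1 - 1) (- s1 - 1) b))) g"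
      by blast
    have om: "s1 = 0 \<and> r1 \<in> \<int>" if "Y \<omega> (- r1 - 1) (- s1 - 1) w \<noteq> 0" for r1 s1 w
    proof -
      have *: "- s1 - 1 = -1" "- r1 - 1 \<in> \<int>" using omega_modes[of "- s1 - 1" "- r1 - 1" w] that by blast+
      have "- (- r1 - 1) - 1 \<in> \<int>" using *(2) by (intro Ints_diff Ints_minus) auto
      thus ?thesis using *(1) by simp
    qed
    have "u (Y \<omega> (- (- 1 - real m) - 1) (- 0 - 1) (Y a (- (d + 1 + real m) - 1) (- e - 1) b)) -
          u (Y a (- (d + 1 + real m) - 1) (- e - 1) (Y \<omega> (- (- 1 - real m) - 1) (- 0 - 1) b)) =
       (\<Sum>i\<le>m. of_nat (m choose i) * u (Y (Y \<omega> (- (- 1 - real i) - 1) (- 0 - 1) a) (- (d + 1 + real i) - 1) (- e - 1) b))"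
      by (rule correlator_commutator[OF g de])
         (use om rd_simps(4)[OF u] Y_left(4) Y_right(4) in \<open>metis+\<close>)
    moreover have "- (d + 1 + real i) - 1 = r + real m - real i" for i by (simp add: d_def)
    moreover have "- e - 1 = s" by (simp add: e_def)
    ultimately show "u (Y \<omega> (real m) (-1) (Y a r s b)) = u (Y a r s (Y \<omega> (real m) (-1) b) +
     (\<Sum>i\<le>m. sc (of_nat (m choose i)) (Y (Y \<omega> (real i) (-1) a) (r + real m - real i) s b)))"
      by (simp add: rd_simps[OF u] algebra_simps)
  qed
qed


section \<open>The two actions of \<open>sl2\<close> and the weights of the conformal
  vectors\<close>

abbreviation "Lp \<equiv> Y \<omega> 2 (-1)"
abbreviation "Lm \<equiv> Y \<omega> 0 (-1)"
abbreviation "Lpb \<equiv> Y \<omega>b (-1) 2"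
abbreviation "Lmb \<equiv> Y \<omega>b (-1) 0"

lemma Lm_translation: "Y (Lm a) r s b = sc (of_real (- r)) (Y a (r - 1) s b)"
  using translation[of a r s b] by (simp add: D_eq)

lemma Lm_comm: "Lm (Y a r s b) = Y a r s (Lm b) + sc (of_real (- r)) (Y a (r - 1) s b)"
  using omega_commutator[of 0 a r s b] by (simp add: Lm_translation)

lemma virasoro_instances:
  "Lp (Lm v) = Lm (Lp v) + sc 2 (Y \<omega> 1 (-1) v)"
  "Y \<omega> 1 (-1) (Lp v) = Lp (Y \<omega> 1 (-1) v) - Lp v"
  "Y \<omega> 1 (-1) (Y \<omega> (-1) (-1) v) = Y \<omega> (-1) (-1) (Y \<omega> 1 (-1) v) + sc 2 (Y \<omega> (-1) (-1) v)"
proof -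
  obtain c where c: "virasoro sc c (\<lambda>n. Y \<omega> (of_int n + 1) (-1))" using virasoro_L by blast
  note * = c[unfolded virasoro_def, rule_format]
  show "Lp (Lm v) = Lm (Lp v) + sc 2 (Y \<omega> 1 (-1) v)"
    using *[of 1 "-1" v] by (simp add: algebra_simps)
  show "Y \<omega> 1 (-1) (Lp v) = Lp (Y \<omega> 1 (-1) v) - Lp v"
    using *[of 0 1 v] by (simp add: algebra_simps)
  show "Y \<omega> 1 (-1) (Y \<omega> (-1) (-1) v) = Y \<omega> (-1) (-1) (Y \<omega> 1 (-1) v) + sc 2 (Y \<omega> (-1) (-1) v)"
    using *[of 0 "-2" v] by (simp add: algebra_simps)
qed

lemma L0_eigenvector_comp:
  assumes "Y \<omega> 1 (-1) v = sc (of_real k) v" "h \<noteq> k"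
  shows "comp (h, hb) v = 0"
proof -
  have L0c: "Y \<omega> 1 (-1) (comp (h, hb) v) = comp (h, hb) (Y \<omega> 1 (-1) v)" for h hb v
  proof (induction v rule: homogeneous_induct)
    case (homogeneous h' hb' v)
    thus ?case by (simp add: L0 comp_homogeneous comp_scale Y_right)
  next
    case (add v w)
    thus ?case by (simp add: comp_add Y_right)
  qed
  have "sc (of_real h) (comp (h, hb) v) = sc (of_real k) (comp (h, hb) v)"
    using L0c[of h hb v] L0[OF comp_props(1), of h hb v] by (simp add: assms(1) comp_scale)
  hence "sc (of_real h - of_real k) (comp (h, hb) v) = 0" by (simp add: scale_left_diff_distrib)
  thus ?thesis using assms(2) by (simp add: scale_eq_0_iff)
qed

lemma L0_eigenvector_eq_0:
  assumes "Y \<omega> 1 (-1) v = sc (of_real k) v" "\<And>hb. F k hb = {0}"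
  shows "v = 0"
proof (rule comp_all_0)
  fix x :: "real \<times> real"
  obtain h hb where "x = (h, hb)" by (cases x)
  thus "comp x v = 0" using L0_eigenvector_comp[OF assms(1)] assms(2) comp_props(1)[of h hb v]
    by (cases "h = k") auto
qed

text \<open>
  A vector of positive half-integral weight \<open>h\<close> killed by \<open>L(-1)\<close> generates under \<open>L(1)\<close> a finite
  dimensional representation of \<open>sl2\<close>, whose lowest weight is then \<open>- h\<close>.
\<close>

lemma Lm_injective:
  assumes v: "v \<in> F h hb" and h: "of_int n = 2 * h" "h > 0" and Lm: "Lm v = 0"
  shows "v = 0"
proof (rule ccontr)
  assume "v \<noteq> 0"
  define w where "w = (\<lambda>k. (Lp ^^ k) v)"
  have w_Suc: "w (Suc k) = Lp (w k)" for k by (simp add: w_def)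
  have eig: "Y \<omega> 1 (-1) (w k) = sc (of_real (h - real k)) (w k)" for k
  proof (induction k)
    case 0
    show ?case using L0[OF v] by (simp add: w_def)
  next
    case (Suc k)
    show ?case unfolding w_Suc virasoro_instances(2) Suc by (simp add: Y_right algebra_simps)
  qed
  have desc: "Lm (w (Suc k)) = sc (- of_real ((real k + 1) * (2 * h - real k))) (w k)" for k
  proof (induction k)
    case 0
    have "Lm (Lp v) = Lp (Lm v) - sc 2 (Y \<omega> 1 (-1) v)" by (simp add: virasoro_instances(1))
    thus ?case using L0[OF v] by (simp add: w_def Lm Y_right)
  next
    case (Suc k)
    have "Lm (w (Suc (Suc k))) = Lp (Lm (w (Suc k))) - sc 2 (Y \<omega> 1 (-1) (w (Suc k)))"
      by (simp add: w_Suc virasoro_instances(1))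
    also have "\<dots> = sc (- of_real ((real k + 1) * (2 * h - real k)) - 2 * of_real (h - real (Suc k))) (w (Suc k))"
      by (simp only: Suc.IH Y_right w_Suc[symmetric] eig scale_scale scale_left_diff_distrib)
    also have "- of_real ((real k + 1) * (2 * h - real k)) - 2 * of_real (h - real (Suc k)) = 
       (- of_real ((real (Suc k) + 1) * (2 * h - real (Suc k))) :: complex)"
      by (simp add: algebra_simps)
    finally show ?case .
  qed
  obtain N where N: "\<And>h hb. h \<le> N \<or> hb \<le> N \<Longrightarrow> F h hb = {0}" using bounded_below by blast
  obtain m where "h - N < real m" using reals_Archimedean2 by blast
  hence "w m = 0" by (intro L0_eigenvector_eq_0[OF eig] N) auto
  hence ex: "\<exists>m. w m = 0" by blast
  define m where "m = (LEAST m. w m = 0)"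
  have m: "w m = 0" unfolding m_def using ex by (rule LeastI_ex)
  have "w 0 \<noteq> 0" using \<open>v \<noteq> 0\<close> by (simp add: w_def)
  hence "m \<noteq> 0" using m by metis
  then obtain k where k: "m = Suc k" by (cases m) auto
  have wk: "w k \<noteq> 0" using not_less_Least[of k "\<lambda>m. w m = 0"] k m_def by auto
  have "sc (- of_real ((real k + 1) * (2 * h - real k))) (w k) = 0"
    using desc[of k] m k by (simp add: Y_right)
  hence "(real k + 1) * (2 * h - real k) = 0" 
    using wk by (simp only: scale_eq_0_iff neg_equal_0_iff_equal of_real_eq_0_iff) simp
  hence "real k = 2 * h" by (simp add: add_eq_0_iff2)
  hence "Y \<omega> 1 (-1) (w k) = sc (of_real (- h)) (w k)" using eig[of k] by simp
  hence "w k = 0"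
    by (rule L0_eigenvector_eq_0) (rule negative_weight[of "- n"]; use h in simp)
  thus False using wk by contradiction
qed

end

context fvoa_core begin

text \<open>Interpreted afresh in every block, so that \<open>bar\<close> also carries the facts of
  the blocks before; \<open>omega_weight\<close> relies on \<open>bar.Lm_injective\<close>.\<close>

interpretation bar: fvoa_core sc "\<lambda>h hb. F hb h" "\<lambda>a r s. Y a s r" vac \<omega>b \<omega> by (rule swap)

text \<open>As \<open>\<omega> = L(-2) vac\<close>, the relation
  \<open>[L(0), L(-2)] = 2 L(-2)\<close> gives the holomorphic weight 2. Each component is killed by
  \<open>Lmb\<close>; a component with \<open>hb \<noteq> 0\<close> has integral \<open>hb\<close>,
  which is excluded by PN2 if negative and by injectivity of \<open>Lmb\<close> if positive.\<close>

lemma omega_weight: "\<omega> \<in> F 2 0"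
proof -
  have om: "\<omega> = Y \<omega> (-1) (-1) vac" by (simp add: Y_vac_const)
  have "Y \<omega> 1 (-1) vac = 0" using L0[OF vac_weight] by simp
  hence "Y \<omega> 1 (-1) (Y \<omega> (-1) (-1) vac) = sc 2 (Y \<omega> (-1) (-1) vac)"
    using virasoro_instances(3)[of vac] by (simp add: Y_right)
  hence eig: "Y \<omega> 1 (-1) \<omega> = sc (of_real 2) \<omega>" by (simp add: Y_vac_const)
  \<comment> \<open>The weight of \<open>\<omega>b\<close> is not known at this point, so
    \<open>Lmb v\<close> is rewritten by \<open>Db_eq\<close> as a mode of \<open>v\<close> applied
    to the vacuum.\<close>
  have Lmb_comp: "Lmb (comp (h, hb) v) = comp (h, hb + 1) (Lmb v)" for h hb v
  proof (induction v rule: homogeneous_induct)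
    case (homogeneous h' hb' v)
    have "Lmb v \<in> F h' (hb' + 1)"
      using Y_weight[OF homogeneous vac_weight, of "-1" "-2"] by (simp add: Db_eq algebra_simps)
    thus ?case using homogeneous by (simp add: comp_homogeneous Y_right)
  next
    case (add v w)
    thus ?case by (simp add: comp_add Y_right)
  qed
  have "Lmb \<omega> = 0" using Db_eq[of \<omega>] omega_Dbar by simp
  hence Lmb0: "Lmb (comp (h, hb) \<omega>) = 0" for h hb
    using Lmb_comp[of h hb \<omega>] linearD(4)[OF comp_linear] by simp
  have zero: "comp (h, hb) \<omega> = 0" if "(h, hb) \<noteq> (2, 0)" for h hb
  proof (cases "h = 2")
    case False
    thus ?thesis using L0_eigenvector_comp[OF eig] by blast
  next
    case True
    hence hb: "hb \<noteq> 0" using that by simp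
    show ?thesis
    proof (cases "2 - hb \<in> \<int>")
      case False
      thus ?thesis using weight_int comp_props(1)[of 2 hb \<omega>] True by auto
    next
      case i: True
      from i obtain n where "2 - hb = of_int n" by (rule Ints_cases)
      hence n: "of_int (4 - 2 * n) = 2 * hb" by simp
      show ?thesis
      proof (cases "hb < 0")
        case True
        thus ?thesis using negative_weight_bar[OF n] comp_props(1)[of h hb \<omega>] by auto
      next
        case False
        show ?thesis
          by (rule bar.Lm_injective[OF comp_props(1) n _ Lmb0]) (use False hb in simp)
      qed
    qed
  qed
  have "\<omega> = (\<Sum>x\<in>{(2, 0)}. comp x \<omega>)"
    by (rule trans[OF comp_props(3) sum.mono_neutral_left]) (use zero in auto)
  thus ?thesis using comp_props(1)[of 2 0 \<omega>] by simp
qed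

end

context fvoa_core begin

interpretation bar: fvoa_core sc "\<lambda>h hb. F hb h" "\<lambda>a r s. Y a s r" vac \<omega>b \<omega> by (rule swap)

lemma omegab_weight: "\<omega>b \<in> F 0 2"
  using bar.omega_weight .

lemma Lp_weight: "v \<in> F h hb \<Longrightarrow> Lp v \<in> F (h - 1) hb"
  using Y_weight[OF omega_weight, of v h hb 2 "-1"] by simp

lemma Lm_weight: "v \<in> F h hb \<Longrightarrow> Lm v \<in> F (h + 1) hb"
  using Y_weight[OF omega_weight, of v h hb 0 "-1"] by (simp add: algebra_simps)

lemma Lpb_weight: "v \<in> F h hb \<Longrightarrow> Lpb v \<in> F h (hb - 1)"
  using Y_weight[OF omegab_weight, of v h hb "-1" 2] by simp

lemma Lmb_weight: "v \<in> F h hb \<Longrightarrow> Lmb v \<in> F h (hb + 1)"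
  using Y_weight[OF omegab_weight, of v h hb "-1" 0] by (simp add: algebra_simps)

lemma Lp_Lm: "v \<in> F h hb \<Longrightarrow> Lp (Lm v) = Lm (Lp v) + sc (of_real (2 * h)) v"
  by (simp add: virasoro_instances(1) L0)

lemma Lp_comm:
  assumes "a \<in> F h hb"
  shows "Lp (Y a r s b) = Y a r s (Lp b) + Y (Lp a) r s b + sc (of_real (2 * h - r - 2)) (Y a (r + 1) s b)"
proof -
  have "Lp (Y a r s b) = Y a r s (Lp b) + (Y (Lm a) (r + 2) s b + 
     (sc 2 (Y (Y \<omega> 1 (-1) a) (r + 1) s b) + Y (Lp a) r s b))"
    using omega_commutator[of 2 a r s b] by (simp add: numeral_2_eq_2 add.assoc add.commute[of r 1])
  also have "Y (Lm a) (r + 2) s b = sc (of_real (- r - 2)) (Y a (r + 1) s b)"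
    using Lm_translation[of a "r + 2" s b] by (simp add: algebra_simps)
  also have "Y (Y \<omega> 1 (-1) a) (r + 1) s b = sc (of_real h) (Y a (r + 1) s b)"
    using assms by (simp add: L0 Y_left)
  finally show ?thesis by (simp add: algebra_simps)
qed

lemma omegab_modes: "s \<noteq> -1 \<or> r \<notin> \<int> \<Longrightarrow> Y \<omega>b s r b = 0"
  by (rule bar.omega_modes)

lemma Lm_omegab_comm: "Lm (Y \<omega>b (-1) s b) = Y \<omega>b (-1) s (Lm b)"
  using Lm_comm[of \<omega>b "-1" s b] omegab_modes[of "-2" s b] by (simp add: Y_right)

text \<open>In \<open>Lp_comm\<close> for \<open>\<omega>b\<close> the correction terms vanish:
  \<open>L(1) \<omega>b\<close> lies in \<open>F (-1) 2 = {0}\<close>, and the other term contains a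
  mode of \<open>\<omega>b\<close> with holomorphic index 0 instead of \<open>- 1\<close>.\<close>

lemma Lp_omegab_comm: "Lp (Y \<omega>b (-1) s b) = Y \<omega>b (-1) s (Lp b)"
proof -
  have "F (-1) 2 = {0}" using negative_weight[of "-2" "-1"] by simp
  hence "Lp \<omega>b = 0" using Lp_weight[OF omegab_weight] by simp
  thus ?thesis using Lp_comm[OF omegab_weight, of "-1" s b] omegab_modes[of 0 s b] by (simp add: Y_left Y_right)
qed

end

section \<open>Quasi-primary vectors\<close>

context fvoa_core begin

interpretation bar: fvoa_core sc "\<lambda>h hb. F hb h" "\<lambda>a r s. Y a s r" vac \<omega>b \<omega> by (rule swap)

lemma Lp_Lpb: "Lp (Lpb v) = Lpb (Lp v)" and Lp_Lmb: "Lp (Lmb v) = Lmb (Lp v)"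
  and Lm_Lpb: "Lm (Lpb v) = Lpb (Lm v)"
  by (rule Lp_omegab_comm Lm_omegab_comm)+

lemma Lp_powers_weight: "v \<in> F h hb \<Longrightarrow> (Lp ^^ m) v \<in> F (h - real m) hb"
proof (induction m)
  case (Suc m)
  thus ?case using Lp_weight[OF Suc.IH[OF Suc.prems]] by (simp add: algebra_simps)
qed simp

lemma Lm_powers_weight: "v \<in> F h hb \<Longrightarrow> (Lm ^^ m) v \<in> F (h + real m) hb"
proof (induction m)
  case (Suc m)
  thus ?case using Lm_weight[OF Suc.IH[OF Suc.prems]] by (simp add: algebra_simps)
qed simp

lemma Lp_powers_0: "(Lp ^^ m) 0 = 0" and Lm_powers_0: "(Lm ^^ m) 0 = 0"
  by (induction m) (simp_all add: Y_right)

lemma Lp_nilpotent: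
  assumes "v \<in> F h hb"
  obtains K where "\<And>m. m \<ge> K \<Longrightarrow> (Lp ^^ m) v = 0"
proof -
  obtain N where N: "\<And>h hb. h \<le> N \<or> hb \<le> N \<Longrightarrow> F h hb = {0}" using bounded_below by blast
  obtain K where K: "h - N < real K" using reals_Archimedean2 by blast
  show ?thesis
  proof (rule that[of K])
    fix m assume "m \<ge> K"
    hence "h - real m \<le> N" using K by linarith
    hence "F (h - real m) hb = {0}" using N by blast
    thus "(Lp ^^ m) v = 0" using Lp_powers_weight[OF assms, of m] by simp
  qed
qed

lemma Lp_Lm_power:
  assumes "w \<in> F h hb" "Lp w = 0"
  shows "Lp ((Lm ^^ Suc m) w) = sc (of_real ((real m + 1) * (2 * h + real m))) ((Lm ^^ m) w)"
proof (induction m)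
  case 0
  show ?case using assms by (simp add: Lp_Lm Y_right)
next
  case (Suc m)
  have "Lp ((Lm ^^ Suc (Suc m)) w) = Lm (Lp ((Lm ^^ Suc m) w)) + sc (of_real (2 * (h + real (Suc m)))) ((Lm ^^ Suc m) w)"
    using Lp_Lm[OF Lm_powers_weight[OF assms(1), of "Suc m"]] by simp
  also have "\<dots> = sc (of_real ((real m + 1) * (2 * h + real m)) + of_real (2 * (h + real (Suc m)))) ((Lm ^^ Suc m) w)"
    unfolding Suc.IH by (simp add: Y_right scale_left_distrib)
  also have "of_real ((real m + 1) * (2 * h + real m)) + of_real (2 * (h + real (Suc m))) = 
      (of_real ((real (Suc m) + 1) * (2 * h + real (Suc m))) :: complex)"
    by (simp add: algebra_simps)
  finally show ?case .
qed

text \<open>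
  As there are no negative half-integral weights, the obstruction to inverting \<open>L(1)\<close> on the image of
  \<open>L(-1)\<close> only occurs between the weights \<open>0\<close> and \<open>1\<close>, where \<open>L(1)\<close> vanishes by assumption.
\<close>

lemma sl2_decomposition:
  fixes V :: "real \<Rightarrow> 'a set"
  assumes sub: "\<And>h. subspace (V h)" and VF: "\<And>h. V h \<subseteq> F h hb"
    and VLp: "\<And>h v. v \<in> V h \<Longrightarrow> Lp v \<in> V (h - 1)" and VLm: "\<And>h v. v \<in> V h \<Longrightarrow> Lm v \<in> V (h + 1)"
    and v: "v \<in> V h"
  shows "v \<in> span {(Lm ^^ m) w | m w. w \<in> V (h - real m) \<and> Lp w = 0}"
proof -
  define S where "S = (\<lambda>h. {(Lm ^^ m) w | m w. w \<in> V (h - real m) \<and> Lp w = 0})"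
  have VLm_pow: "(Lm ^^ m) w \<in> V (h + real m)" if "w \<in> V h" for m w h
    using that
  proof (induction m)
    case (Suc m)
    thus ?case using VLm[OF Suc.IH[OF Suc.prems]] by (simp add: algebra_simps)
  qed simp
  have SV: "S h \<subseteq> V h" for h
  proof
    fix u assume "u \<in> S h"
    then obtain m w where "u = (Lm ^^ m) w" "w \<in> V (h - real m)" unfolding S_def by blast
    thus "u \<in> V h" using VLm_pow[of w "h - real m" m] by simp
  qed
  have spanV: "span (S h) \<subseteq> V h" for h by (rule span_minimal[OF SV sub])
  obtain N where N: "\<And>h hb. h \<le> N \<or> hb \<le> N \<Longrightarrow> F h hb = {0}" using bounded_below by blast
  \<comment> \<open>Weights are real, so the induction runs over a natural number bounding the
    distance from the lower bound \<open>N\<close>.\<close>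
  have "v \<in> span (S h)" if "v \<in> V h" "h \<le> N + real n" for n h v
    using that
  proof (induction n arbitrary: h v)
    case 0
    hence "v = 0" using N[of h hb] VF by auto
    thus ?case by (simp add: span_zero)
  next
    case (Suc n)
    have ker: "w \<in> span (S h)" if "w \<in> V h" "Lp w = 0" for w
      using that unfolding S_def by (intro span_base CollectI exI[of _ 0] exI[of _ w]) simp
    show ?case
    proof (cases "h = 1")
      case True
      hence "Lp v = 0" using Suc.prems VF Lp_F1 by blast
      thus ?thesis using ker Suc.prems by blast
    next
      case h1: False
      define T where "T = {u. \<exists>x\<in>span (S h). Lp x = u}"
      have T: "subspace T" unfolding T_def
      proof (rule subspaceI; clarsimp)
        show "\<exists>x\<in>span (S h). Lp x = 0" using span_zero by (intro bexI[of _ 0]) (simp_all add: Y_right)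
        show "\<exists>z\<in>span (S h). Lp z = Lp x + Lp y" if "x \<in> span (S h)" "y \<in> span (S h)" for x y
          using that span_add by (intro bexI[of _ "x + y"]) (simp_all add: Y_right)
        show "\<exists>z\<in>span (S h). Lp z = sc c (Lp x)" if "x \<in> span (S h)" for x c
          using that span_scale by (intro bexI[of _ "sc c x"]) (simp_all add: Y_right)
      qed
      have "S (h - 1) \<subseteq> T"
      proof
        fix u assume "u \<in> S (h - 1)"
        then obtain m w where u: "u = (Lm ^^ m) w" and w: "w \<in> V (h - 1 - real m)" "Lp w = 0"
          unfolding S_def by blast
        show "u \<in> T"
        proof (cases "w = 0")
          case True
          hence "u = 0" by (simp add: u Lm_powers_0)
          thus ?thesis using subspace_0[OF T] by simp
        next
          case False
          define k where "k = (real m + 1) * (2 * (h - 1 - real m) + real m)"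
          \<comment> \<open>For \<open>m = 0\<close> the factor vanishes only if
            \<open>h = 1\<close>, which is excluded here; for \<open>m > 0\<close> it would give
            \<open>w\<close> the weight \<open>- m/2\<close>, where there are no nonzero
            vectors.\<close>
          have k: "k \<noteq> 0"
          proof
            assume "k = 0"
            hence "2 * (h - 1 - real m) + real m = 0" by (simp add: k_def add_eq_0_iff2)
            hence *: "2 * (h - 1 - real m) = of_int (- int m)" by simp
            have "m \<noteq> 0" using * h1 by auto
            hence "h - 1 - real m < 0" using * by simp
            hence "F (h - 1 - real m) hb = {0}" using negative_weight[OF *[symmetric]] by blast
            thus False using w(1) VF False by blast
          qed
          define x where "x = sc (of_real (inverse k)) ((Lm ^^ Suc m) w)"
          have "(Lm ^^ Suc m) w \<in> S h" unfolding S_def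
            using w by (intro CollectI exI[of _ "Suc m"] exI[of _ w]) (simp add: algebra_simps)
          hence "x \<in> span (S h)" unfolding x_def by (intro span_scale span_base)
          moreover have "Lp x = u"
          proof -
            have "Lp x = sc (of_real (inverse k)) (Lp ((Lm ^^ Suc m) w))" unfolding x_def by (rule Y_right)
            also have "Lp ((Lm ^^ Suc m) w) = sc (of_real k) u"
              unfolding u k_def by (rule Lp_Lm_power[OF _ w(2)]) (use w VF in blast)
            also have "sc (of_real (inverse k)) (sc (of_real k) u) = sc (of_real (inverse k * k)) u"
              by (simp only: scale_scale of_real_mult)
            also have "\<dots> = u" using k by simp
            finally show ?thesis .
          qed
          ultimately show ?thesis unfolding T_def by blast
        qed
      qed
      hence "span (S (h - 1)) \<subseteq> T" by (rule span_minimal[OF _ T])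
      \<comment> \<open>By induction \<open>Lp v\<close> is a combination of descendants and so has
        a preimage \<open>x\<close> in the span; \<open>v - x\<close> is then killed by
        \<open>Lp\<close> and is itself a generator.\<close>
      moreover have "Lp v \<in> span (S (h - 1))"
        using Suc.prems by (intro Suc.IH VLp) auto
      ultimately obtain x where x: "x \<in> span (S h)" "Lp x = Lp v" unfolding T_def by blast
      have "v - x \<in> V h" using Suc.prems(1) x(1) spanV subspace_diff[OF sub] by blast
      moreover have "Lp (v - x) = 0" using x(2) by (simp add: Y_right)
      ultimately have "v - x \<in> span (S h)" by (rule ker)
      hence "(v - x) + x \<in> span (S h)" using x(1) by (rule span_add)
      thus ?thesis by simp
    qed
  qed
  moreover obtain n where "h - N < real n" using reals_Archimedean2 by blast
  hence "h \<le> N + real n" by simp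
  ultimately show ?thesis using v unfolding S_def by blast
qed

end

context fvoa_core begin

interpretation bar: fvoa_core sc "\<lambda>h hb. F hb h" "\<lambda>a r s. Y a s r" vac \<omega>b \<omega> by (rule swap)

definition quasiprimary :: "'a \<Rightarrow> bool" where
  "quasiprimary v \<longleftrightarrow> Lp v = 0 \<and> Lpb v = 0"

text \<open>Formulated for subspaces so that the decomposition applies inside the radical as well as
  in \<open>F\<close>.\<close>

definition stable_family :: "(real \<Rightarrow> real \<Rightarrow> 'a set) \<Rightarrow> bool" where
  "stable_family V \<longleftrightarrow> (\<forall>h hb. subspace (V h hb) \<and> V h hb \<subseteq> F h hb) \<and>
     (\<forall>h hb. \<forall>v\<in>V h hb. Lp v \<in> V (h - 1) hb \<and> Lm v \<in> V (h + 1) hb \<and>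
        Lpb v \<in> V h (hb - 1) \<and> Lmb v \<in> V h (hb + 1))"

lemma stable_family_F: "stable_family F"
  unfolding stable_family_def using F_subspace Lp_weight Lm_weight Lpb_weight Lmb_weight by blast

text \<open>The holomorphic decomposition comes first. The kernel of \<open>Lp\<close> is stable
  under \<open>Lpb\<close> and \<open>Lmb\<close> because they commute with \<open>Lp\<close>, so
  the antiholomorphic decomposition can be carried out inside it.\<close>

lemma quasiprimary_decomposition:
  assumes V: "stable_family V" and v: "v \<in> V h hb"
  shows "v \<in> span {(Lm ^^ m) ((Lmb ^^ n) w) | m n w. w \<in> V (h - real m) (hb - real n) \<and> quasiprimary w}"
    (is "_ \<in> span ?S")
proof -
  have 1: "v \<in> span {(Lm ^^ m) w | m w. w \<in> V (h - real m) hb \<and> Lp w = 0}"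
    by (rule sl2_decomposition[of "\<lambda>h. V h hb" hb]) (use V v in \<open>auto simp: stable_family_def\<close>)
  have "(Lm ^^ m) w \<in> span ?S" if w: "w \<in> V (h - real m) hb" "Lp w = 0" for m w
  proof -
    define U where "U = (\<lambda>hb'. {w \<in> V (h - real m) hb'. Lp w = 0})"
    have U: "subspace (U hb')" for hb'
      unfolding U_def using V unfolding stable_family_def
      by (intro subspaceI) (auto simp: Y_right subspace_0 subspace_add subspace_scale)
    have "w \<in> span {(Lmb ^^ n) x | n x. x \<in> U (hb - real n) \<and> Lpb x = 0}"
    proof (rule bar.sl2_decomposition[of U "h - real m", OF U])
      show "U hb' \<subseteq> F (h - real m) hb'" for hb' using V unfolding U_def stable_family_def by blast
      show "Lpb v \<in> U (hb' - 1)" if "v \<in> U hb'" for v hb'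
        using that V unfolding U_def stable_family_def by (auto simp: Lp_Lpb Y_right)
      show "Lmb v \<in> U (hb' + 1)" if "v \<in> U hb'" for v hb'
        using that V unfolding U_def stable_family_def by (auto simp: Lp_Lmb Y_right)
      show "w \<in> U hb" using w by (simp add: U_def)
    qed
    moreover have "subspace {x. (Lm ^^ m) x \<in> span ?S}"
    proof -
      have lin: "(Lm ^^ m) (x + y) = (Lm ^^ m) x + (Lm ^^ m) y" "(Lm ^^ m) (sc k x) = sc k ((Lm ^^ m) x)" for x y k
        by (induction m) (simp_all add: Y_right)
      show ?thesis by (intro subspaceI) (auto simp: lin Lm_powers_0 span_zero span_add span_scale)
    qed
    moreover have "{(Lmb ^^ n) x | n x. x \<in> U (hb - real n) \<and> Lpb x = 0} \<subseteq> {x. (Lm ^^ m) x \<in> span ?S}"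
    proof clarify
      fix n x assume "x \<in> U (hb - real n)" "Lpb x = 0"
      hence "(Lm ^^ m) ((Lmb ^^ n) x) \<in> ?S" unfolding U_def quasiprimary_def by blast
      thus "(Lm ^^ m) ((Lmb ^^ n) x) \<in> span ?S" by (rule span_base)
    qed
    ultimately show ?thesis using span_minimal by blast
  qed
  hence "{(Lm ^^ m) w | m w. w \<in> V (h - real m) hb \<and> Lp w = 0} \<subseteq> span ?S" by blast
  hence "span {(Lm ^^ m) w | m w. w \<in> V (h - real m) hb \<and> Lp w = 0} \<subseteq> span ?S"
    by (rule span_minimal[OF _ subspace_span])
  thus ?thesis using 1 by blast
qed

text \<open>The predicate carries the weight, because the adjoint of a mode depends on it.\<close>

lemma quasiprimary_induct [consumes 2, case_names quasiprimary Lm Lmb add scale]: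
  assumes V: "stable_family V" and v: "v \<in> V h hb"
    and qp: "\<And>h hb w. w \<in> V h hb \<Longrightarrow> quasiprimary w \<Longrightarrow> P h hb w"
    and Lm: "\<And>h hb w. w \<in> V h hb \<Longrightarrow> P h hb w \<Longrightarrow> P (h + 1) hb (Lm w)"
    and Lmb: "\<And>h hb w. w \<in> V h hb \<Longrightarrow> P h hb w \<Longrightarrow> P h (hb + 1) (Lmb w)"
    and add: "\<And>h hb w x. w \<in> V h hb \<Longrightarrow> x \<in> V h hb \<Longrightarrow> P h hb w \<Longrightarrow> P h hb x \<Longrightarrow> P h hb (w + x)"
    and scale: "\<And>h hb w k. w \<in> V h hb \<Longrightarrow> P h hb w \<Longrightarrow> P h hb (sc k w)"
  shows "P h hb v"
proof -
  have sub: "subspace (V h hb)" for h hb using V unfolding stable_family_def by blast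
  have 1: "(Lmb ^^ n) w \<in> V h (hb + real n) \<and> P h (hb + real n) ((Lmb ^^ n) w)" 
    if "w \<in> V h hb" "quasiprimary w" for n w h hb
  proof (induction n)
    case 0
    thus ?case using that qp by simp
  next
    case (Suc n)
    hence "(Lmb ^^ Suc n) w \<in> V h ((hb + real n) + 1) \<and> P h ((hb + real n) + 1) ((Lmb ^^ Suc n) w)"
      using V Lmb unfolding stable_family_def by simp
    thus ?case by (simp add: algebra_simps)
  qed
  have 2: "(Lm ^^ m) w \<in> V (h + real m) hb \<and> P (h + real m) hb ((Lm ^^ m) w)" 
    if "w \<in> V h hb" "P h hb w" for m w h hb
  proof (induction m)
    case 0
    thus ?case using that by simp
  next
    case (Suc m)
    hence "(Lm ^^ Suc m) w \<in> V ((h + real m) + 1) hb \<and> P ((h + real m) + 1) hb ((Lm ^^ Suc m) w)"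
      using V Lm unfolding stable_family_def by simp
    thus ?case by (simp add: algebra_simps)
  qed
  have "span {(Lm ^^ m) ((Lmb ^^ n) w) | m n w. w \<in> V (h - real m) (hb - real n) \<and> quasiprimary w}
      \<subseteq> {v \<in> V h hb. P h hb v}"
  proof (rule span_minimal)
    show "{(Lm ^^ m) ((Lmb ^^ n) w) | m n w. w \<in> V (h - real m) (hb - real n) \<and> quasiprimary w}
      \<subseteq> {v \<in> V h hb. P h hb v}"
    proof clarify
      fix m n w assume "w \<in> V (h - real m) (hb - real n)" "quasiprimary w"
      from 1[OF this, of n] have "(Lmb ^^ n) w \<in> V (h - real m) hb" "P (h - real m) hb ((Lmb ^^ n) w)" by simp_all
      from 2[OF this, of m] show "(Lm ^^ m) ((Lmb ^^ n) w) \<in> V h hb \<and> P h hb ((Lm ^^ m) ((Lmb ^^ n) w))" by simp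
    qed
    have "quasiprimary 0" by (simp add: quasiprimary_def Y_right)
    hence "P h hb 0" using qp subspace_0[OF sub] by blast
    thus "subspace {v \<in> V h hb. P h hb v}"
      using sub add scale by (intro subspaceI) (auto simp: subspace_0 subspace_add subspace_scale)
  qed
  thus ?thesis using quasiprimary_decomposition[OF V v] by blast
qed

section \<open>The functional dual to the vacuum\<close>

definition vacuum_functional :: "'a \<Rightarrow> complex" where
  "vacuum_functional v = (THE k. comp (0, 0) v = sc k vac)"

abbreviation "\<theta> \<equiv> vacuum_functional"

lemma vacuum_functional: "comp (0, 0) v = sc (\<theta> v) vac"
proof -
  have "\<exists>k. comp (0, 0) v = sc k vac" using comp_props(1)[of 0 0 v] F00 by auto
  moreover have "sc k vac = sc k' vac \<Longrightarrow> k = k'" for k k' using vac_nonzero by simp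
  ultimately have "\<exists>!k. comp (0, 0) v = sc k vac" by metis
  thus ?thesis unfolding vacuum_functional_def by (rule theI')
qed

lemma vacuum_functional_eqI: "comp (0, 0) v = sc k vac \<Longrightarrow> \<theta> v = k"
  using vacuum_functional[of v] vac_nonzero by simp

lemma theta_linear: "Vector_Spaces.linear sc (*) \<theta>"
proof -
  have vs: "vector_space ((*) :: complex \<Rightarrow> complex \<Rightarrow> complex)"
    by unfold_locales (auto simp: algebra_simps)
  have "\<theta> (v + w) = \<theta> v + \<theta> w" for v w
    by (rule vacuum_functional_eqI) (simp add: comp_add vacuum_functional scale_left_distrib)
  moreover have "\<theta> (sc k v) = k * \<theta> v" for k v
    by (rule vacuum_functional_eqI) (simp add: comp_scale vacuum_functional)
  ultimately show ?thesis unfolding Vector_Spaces.linear_iff using vs vector_space_axioms by blast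
qed

lemmas theta_simps = linearD[OF theta_linear]

lemma theta_vac: "\<theta> vac = 1"
  by (rule vacuum_functional_eqI) (simp add: comp_homogeneous[OF vac_weight])

lemma theta_weight: "v \<in> F h hb \<Longrightarrow> h \<noteq> 0 \<or> hb \<noteq> 0 \<Longrightarrow> \<theta> v = 0"
  by (rule vacuum_functional_eqI) (auto simp: comp_homogeneous)

lemma theta_restricted_dual: "\<theta> \<in> restricted_dual sc F"
  unfolding restricted_dual_def
proof (intro CollectI conjI theta_linear)
  have "{(h, hb). \<exists>v\<in>F h hb. \<theta> v \<noteq> 0} \<subseteq> {(0, 0)}" using theta_weight by blast
  thus "finite {(h, hb). \<exists>v\<in>F h hb. \<theta> v \<noteq> 0}" by (rule finite_subset) simp
qed

text \<open>\<open>L(1)\<close> reaches weight 0 only from weight 1, where it vanishes by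
  assumption.\<close>

lemma theta_Lp: "\<theta> (Lp v) = 0"
proof (induction v rule: homogeneous_induct)
  case (homogeneous h hb v)
  show ?case
  proof (cases "h = 1")
    case True
    thus ?thesis using homogeneous Lp_F1 theta_simps(4) by simp
  next
    case False
    thus ?thesis using theta_weight[OF Lp_weight[OF homogeneous]] by simp
  qed
qed (simp add: Y_right theta_simps)

text \<open>\<open>L(-1)\<close> reaches weight 0 only from weight \<open>- 1\<close>, where the
  space is zero.\<close>

lemma theta_Lm: "\<theta> (Lm v) = 0"
proof (induction v rule: homogeneous_induct)
  case (homogeneous h hb v)
  show ?case
  proof (cases "h = -1")
    case True
    have "F (-1) hb = {0}" using negative_weight[of "-2" "-1"] by simp
    hence "v = 0" using homogeneous True by simp
    thus ?thesis using theta_simps(4) by (simp add: Y_right)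
  next
    case False
    thus ?thesis using theta_weight[OF Lm_weight[OF homogeneous]] by auto
  qed
qed (simp add: Y_right theta_simps)

lemma bar_comp: "bar.comp (hb, h) v = comp (h, hb) v"
proof (induction v rule: homogeneous_induct)
  case (homogeneous h' hb' v)
  thus ?case using bar.comp_homogeneous[OF homogeneous] by (auto simp: comp_homogeneous)
qed (simp add: comp_add bar.comp_add)

end

context fvoa_core begin

interpretation bar: fvoa_core sc "\<lambda>h hb. F hb h" "\<lambda>a r s. Y a s r" vac \<omega>b \<omega> by (rule swap)

lemma theta_bar: "bar.vacuum_functional = \<theta>"
  by (rule ext, rule bar.vacuum_functional_eqI) (simp add: bar_comp vacuum_functional)

end

section \<open>The adjoint action\<close>

context fvoa_core begin

interpretation bar: fvoa_core sc "\<lambda>h hb. F hb h" "\<lambda>a r s. Y a s r" vac \<omega>b \<omega> by (rule swap)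

lemma Lp_powers_add: "(Lp ^^ m) (x + y) = (Lp ^^ m) x + (Lp ^^ m) y"
  and Lp_powers_scale: "(Lp ^^ m) (sc k x) = sc k ((Lp ^^ m) x)"
  by (induction m) (simp_all add: Y_right)

lemma Lp_powers_Lp: "(Lp ^^ m) (Lp x) = (Lp ^^ Suc m) x"
  by (simp add: funpow_swap1)

lemma Lpb_powers_Lp: "(Lpb ^^ n) (Lp x) = Lp ((Lpb ^^ n) x)"
  and Lpb_powers_Lm: "(Lpb ^^ n) (Lm x) = Lm ((Lpb ^^ n) x)"
  and Lpb_powers_Lp_powers: "(Lpb ^^ n) ((Lp ^^ m) x) = (Lp ^^ m) ((Lpb ^^ n) x)"
proof -
  show 1: "(Lpb ^^ n) (Lp x) = Lp ((Lpb ^^ n) x)" "(Lpb ^^ n) (Lm x) = Lm ((Lpb ^^ n) x)" for x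
    by (induction n) (simp_all add: Lp_Lpb Lm_Lpb)
  show "(Lpb ^^ n) ((Lp ^^ m) x) = (Lp ^^ m) ((Lpb ^^ n) x)"
    by (induction m) (simp_all add: 1)
qed

lemma Lp_powers_Lm:
  assumes "x \<in> F h hb"
  shows "(Lp ^^ Suc m) (Lm x) = Lm ((Lp ^^ Suc m) x) + sc (of_real ((real m + 1) * (2 * h - real m))) ((Lp ^^ m) x)"
proof (induction m)
  case 0
  show ?case using assms by (simp add: Lp_Lm)
next
  case (Suc m)
  have "(Lp ^^ Suc (Suc m)) (Lm x) = Lp (Lm ((Lp ^^ Suc m) x)) + sc (of_real ((real m + 1) * (2 * h - real m))) ((Lp ^^ Suc m) x)"
    using arg_cong[OF Suc, of Lp] by (simp add: Y_right)
  also have "Lp (Lm ((Lp ^^ Suc m) x)) = Lm ((Lp ^^ Suc (Suc m)) x) + sc (of_real (2 * (h - real (Suc m)))) ((Lp ^^ Suc m) x)"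
    using Lp_Lm[OF Lp_powers_weight[OF assms, of "Suc m"]] by simp
  also have "Lm ((Lp ^^ Suc (Suc m)) x) + sc (of_real (2 * (h - real (Suc m)))) ((Lp ^^ Suc m) x) + 
        sc (of_real ((real m + 1) * (2 * h - real m))) ((Lp ^^ Suc m) x)
      = Lm ((Lp ^^ Suc (Suc m)) x) + 
        sc (of_real (2 * (h - real (Suc m))) + of_real ((real m + 1) * (2 * h - real m))) ((Lp ^^ Suc m) x)"
    by (simp only: add.assoc scale_left_distrib)
  also have "of_real (2 * (h - real (Suc m))) + of_real ((real m + 1) * (2 * h - real m)) = 
      (of_real ((real (Suc m) + 1) * (2 * h - real (Suc m))) :: complex)"
    by (simp add: algebra_simps)
  finally show ?case .
qed

text \<open>The exponential series is its own derivative: a factor \<open>m\<close> in front of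
  \<open>1 / m!\<close> shifts the index by one.\<close>

lemma sum_inverse_fact_shift:
  fixes f :: "nat \<Rightarrow> 'a"
  shows "(\<Sum>m<Suc K. sc (of_nat m / fact m) (f m)) = (\<Sum>m<K. sc (1 / fact m) (f (Suc m)))"
proof -
  have "(\<Sum>m<Suc K. sc (of_nat m / fact m) (f m)) = (\<Sum>m<K. sc (of_nat (Suc m) / fact (Suc m)) (f (Suc m)))"
    by (subst sum.lessThan_Suc_shift) simp
  also have "\<dots> = (\<Sum>m<K. sc (1 / fact m) (f (Suc m)))"
    by (intro sum.cong refl arg_cong2[where f = sc]) (simp add: field_simps del: of_nat_Suc)
  finally show ?thesis .
qed

text \<open>
  \<open>chiral_adjoint h a r s\<close> collects the terms of \<open>Y(exp(z L(1)) z^(-2h) a, 1/z)\<close> with exponent \<open>r\<close>;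
  together with its antiholomorphic analogue and the sign it gives the adjoint of \<open>Y a (-r-1) (-s-1)\<close>.
\<close>

definition chiral_adjoint :: "real \<Rightarrow> 'a \<Rightarrow> real \<Rightarrow> real \<Rightarrow> 'a \<Rightarrow> 'a" where
  "chiral_adjoint h a r s c = 
     (\<Sum>m | (Lp ^^ m) a \<noteq> 0. sc (1 / fact m) (Y ((Lp ^^ m) a) (r - real m + 2 * h - 1) s c))"

lemma chiral_adjoint_eq:
  assumes "\<forall>m\<ge>K. (Lp ^^ m) a = 0"
  shows "chiral_adjoint h a r s c = (\<Sum>m<K. sc (1 / fact m) (Y ((Lp ^^ m) a) (r - real m + 2 * h - 1) s c))"
  unfolding chiral_adjoint_def
proof (rule sum.mono_neutral_left)
  show "{m. (Lp ^^ m) a \<noteq> 0} \<subseteq> {..<K}" using assms not_le by auto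
qed (auto simp: Y_left)

lemma chiral_adjoint_add_left:
  assumes "a \<in> F h hb" "b \<in> F h hb"
  shows "chiral_adjoint h' (a + b) r s c = chiral_adjoint h' a r s c + chiral_adjoint h' b r s c"
proof -
  obtain K1 where K1: "\<And>m. m \<ge> K1 \<Longrightarrow> (Lp ^^ m) a = 0" using Lp_nilpotent[OF assms(1)] by blast
  obtain K2 where K2: "\<And>m. m \<ge> K2 \<Longrightarrow> (Lp ^^ m) b = 0" using Lp_nilpotent[OF assms(2)] by blast
  have *: "\<forall>m\<ge>max K1 K2. (Lp ^^ m) a = 0" "\<forall>m\<ge>max K1 K2. (Lp ^^ m) b = 0" 
    "\<forall>m\<ge>max K1 K2. (Lp ^^ m) (a + b) = 0"
    using K1 K2 by (auto simp: Lp_powers_add)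
  show ?thesis
    unfolding chiral_adjoint_eq[of "max K1 K2" a, OF *(1)] chiral_adjoint_eq[of "max K1 K2" b, OF *(2)]
      chiral_adjoint_eq[of "max K1 K2" "a + b", OF *(3)]
    by (simp add: Lp_powers_add Y_left scale_right_distrib sum.distrib)
qed

lemma chiral_adjoint_scale_left: "chiral_adjoint h (sc k a) r s c = sc k (chiral_adjoint h a r s c)"
proof (cases "k = 0")
  case True
  thus ?thesis by (simp add: chiral_adjoint_def Lp_powers_0)
next
  case False
  thus ?thesis unfolding chiral_adjoint_def
    by (simp add: Lp_powers_scale Y_left scale_sum_right scale_left_commute)
qed

lemma chiral_adjoint_add_right: "chiral_adjoint h a r s (c + d) = chiral_adjoint h a r s c + chiral_adjoint h a r s d"
  unfolding chiral_adjoint_def by (simp add: Y_right scale_right_distrib sum.distrib)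

lemma chiral_adjoint_scale_right: "chiral_adjoint h a r s (sc k c) = sc k (chiral_adjoint h a r s c)"
  unfolding chiral_adjoint_def by (simp add: Y_right scale_sum_right scale_left_commute)

lemma chiral_adjoint_weight:
  assumes "a \<in> F h hb" "c \<in> F h' hb'"
  shows "chiral_adjoint h a r s c \<in> F (h' - h - r) (hb + hb' - s - 1)"
  unfolding chiral_adjoint_def
proof (intro subspace_sum[OF F_subspace] F_scale)
  fix m
  have "Y ((Lp ^^ m) a) (r - real m + 2 * h - 1) s c \<in> F (h - real m + h' - (r - real m + 2 * h - 1) - 1) (hb + hb' - s - 1)"
    by (rule Y_weight[OF Lp_powers_weight[OF assms(1)] assms(2)])
  thus "Y ((Lp ^^ m) a) (r - real m + 2 * h - 1) s c \<in> F (h' - h - r) (hb + hb' - s - 1)"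
    by (simp add: algebra_simps)
qed

text \<open>Moving \<open>L(-1)\<close> through the powers of \<open>L(1)\<close> contributes
  \<open>2 h - m\<close> after a shift of the index. This cancels the dependence on \<open>m\<close>
  of the translation factor \<open>- (r - m + 2 h + 1)\<close>, leaving \<open>- (r + 1)\<close> for
  every term.\<close>

lemma chiral_adjoint_Lm:
  assumes a: "a \<in> F h hb"
  shows "chiral_adjoint (h + 1) (Lm a) r s c = sc (- of_real (r + 1)) (chiral_adjoint h a (r + 1) s c)"
proof -
  obtain K where K: "\<forall>m\<ge>K. (Lp ^^ m) a = 0" using Lp_nilpotent[OF a] by blast
  define x where "x = (\<lambda>m. (Lp ^^ m) a)"
  define y where "y = (\<lambda>m. Y (x m) (r - real m + 2 * h) s c)"
  have yK: "y m = 0" if "m \<ge> K" for m using K that by (simp add: y_def x_def Y_left)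
  \<comment> \<open>Commutator terms, indexed to fit \<open>sum_inverse_fact_shift\<close>; the
    entry at 0 is a dummy, as it is always multiplied by \<open>of_nat 0\<close>.\<close>
  define z where "z = (\<lambda>m. case m of 0 \<Rightarrow> 0 | Suc k \<Rightarrow> sc (of_real (2 * h - real k)) (y k))"
  have Lm_pow: "(Lp ^^ m) (Lm a) = Lm (x m) + (case m of 0 \<Rightarrow> 0 | Suc k \<Rightarrow> sc (of_real ((real k + 1) * (2 * h - real k))) (x k))" for m
    using Lp_powers_Lm[OF a] by (cases m) (simp_all add: x_def)
  have "\<forall>m\<ge>Suc K. (Lp ^^ m) (Lm a) = 0"
    using K unfolding Lm_pow by (auto simp: x_def Y_right split: nat.split)
  hence "chiral_adjoint (h + 1) (Lm a) r s c = 
      (\<Sum>m<Suc K. sc (1 / fact m) (Y ((Lp ^^ m) (Lm a)) (r - real m + 2 * (h + 1) - 1) s c))"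
    by (rule chiral_adjoint_eq)
  also have "\<dots> = (\<Sum>m<Suc K. sc (1 / fact m) (sc (- of_real (r - real m + 2 * h + 1)) (y m)) + sc (of_nat m / fact m) (z m))"
  proof (rule sum.cong[OF refl])
    fix m
    have idx: "r - real m + 2 * (h + 1) - 1 = r - real m + 2 * h + 1" by simp
    have "Y ((Lp ^^ m) (Lm a)) (r - real m + 2 * h + 1) s c = sc (- of_real (r - real m + 2 * h + 1)) (y m) + sc (of_nat m) (z m)"
    proof (cases m)
      case 0
      thus ?thesis using Lm_translation[of a "r + 2 * h + 1" s c] by (simp add: Lm_pow z_def y_def x_def algebra_simps)
    next
      case (Suc k)
      have "Y (Lm (x m)) (r - real m + 2 * h + 1) s c = sc (- of_real (r - real m + 2 * h + 1)) (y m)"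
        using Lm_translation[of "x m" "r - real m + 2 * h + 1" s c] by (simp add: y_def)
      moreover have "Y (sc (of_real ((real k + 1) * (2 * h - real k))) (x k)) (r - real m + 2 * h + 1) s c = sc (of_nat m) (z m)"
        by (simp add: Suc z_def y_def Y_left algebra_simps)
      moreover have "(Lp ^^ m) (Lm a) = Lm (x m) + sc (of_real ((real k + 1) * (2 * h - real k))) (x k)"
        unfolding Lm_pow[of m] by (simp only: Suc nat.case)
      ultimately show ?thesis by (simp only: Y_left(1))
    qed
    thus "sc (1 / fact m) (Y ((Lp ^^ m) (Lm a)) (r - real m + 2 * (h + 1) - 1) s c) = 
       sc (1 / fact m) (sc (- of_real (r - real m + 2 * h + 1)) (y m)) + sc (of_nat m / fact m) (z m)"
      unfolding idx by (simp add: scale_right_distrib)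
  qed
  also have "\<dots> = (\<Sum>m<K. sc (1 / fact m) (sc (- of_real (r - real m + 2 * h + 1)) (y m))) + (\<Sum>m<K. sc (1 / fact m) (z (Suc m)))"
    unfolding sum.distrib sum_inverse_fact_shift by (simp add: yK)
  also have "\<dots> = (\<Sum>m<K. sc (- of_real (r + 1)) (sc (1 / fact m) (y m)))"
    unfolding sum.distrib[symmetric]
  proof (rule sum.cong[OF refl])
    fix m
    have "sc (1 / fact m) (sc (- of_real (r - real m + 2 * h + 1)) (y m)) + sc (1 / fact m) (z (Suc m)) = 
      sc (1 / fact m) (sc (- of_real (r - real m + 2 * h + 1) + of_real (2 * h - real m)) (y m))"
      by (simp only: z_def nat.case scale_left_distrib scale_right_distrib)
    also have "- of_real (r - real m + 2 * h + 1) + of_real (2 * h - real m) = (- of_real (r + 1) :: complex)" by simp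
    finally show "sc (1 / fact m) (sc (- of_real (r - real m + 2 * h + 1)) (y m)) + sc (1 / fact m) (z (Suc m)) = 
      sc (- of_real (r + 1)) (sc (1 / fact m) (y m))" by (simp only: scale_left_commute)
  qed
  also have "\<dots> = sc (- of_real (r + 1)) (chiral_adjoint h a (r + 1) s c)"
    unfolding chiral_adjoint_eq[of K a, OF K] scale_sum_right
    by (intro sum.cong refl) (simp add: y_def x_def algebra_simps)
  finally show ?thesis .
qed

text \<open>The terms with \<open>Lp\<close> applied to \<open>(Lp ^^ m) a\<close> are the next
  terms of the exponential series; shifted back they carry a factor \<open>m\<close>, which cancels
  the part \<open>- m\<close> of the commutator coefficient.\<close>

lemma Lp_chiral_adjoint:
  assumes a: "a \<in> F h hb"
  shows "Lp (chiral_adjoint h a r s c) = chiral_adjoint h a r s (Lp c) - sc (of_real (r + 1)) (chiral_adjoint h a (r + 1) s c)"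
proof -
  obtain K where K: "\<forall>m\<ge>K. (Lp ^^ m) a = 0" using Lp_nilpotent[OF a] by blast
  define x where "x = (\<lambda>m. (Lp ^^ m) a)"
  define y where "y = (\<lambda>m. Y (x m) (r - real m + 2 * h) s c)"
  have yK: "y m = 0" if "m \<ge> K" for m using K that by (simp add: y_def x_def Y_left)
  have step: "Lp (Y (x m) (r - real m + 2 * h - 1) s c) = 
      Y (x m) (r - real m + 2 * h - 1) s (Lp c) + y (Suc m) + sc (- of_nat m - of_real (r + 1)) (y m)" for m
  proof -
    have "Lp (Y (x m) (r - real m + 2 * h - 1) s c) = Y (x m) (r - real m + 2 * h - 1) s (Lp c) + 
       Y (Lp (x m)) (r - real m + 2 * h - 1) s c + 
       sc (of_real (2 * (h - real m) - (r - real m + 2 * h - 1) - 2)) (Y (x m) (r - real m + 2 * h - 1 + 1) s c)"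
      unfolding x_def by (rule Lp_comm[OF Lp_powers_weight[OF a]])
    moreover have "Y (Lp (x m)) (r - real m + 2 * h - 1) s c = y (Suc m)" by (simp add: y_def x_def algebra_simps)
    moreover have "of_real (2 * (h - real m) - (r - real m + 2 * h - 1) - 2) = (- of_nat m - of_real (r + 1) :: complex)" by simp
    ultimately show ?thesis by (simp add: y_def)
  qed
  have "Lp (chiral_adjoint h a r s c) = (\<Sum>m<K. sc (1 / fact m) (Lp (Y (x m) (r - real m + 2 * h - 1) s c)))"
    unfolding chiral_adjoint_eq[of K a, OF K] by (simp add: Y_right x_def)
  also have "\<dots> = chiral_adjoint h a r s (Lp c) + (\<Sum>m<K. sc (1 / fact m) (y (Suc m))) 
      + (\<Sum>m<K. sc (1 / fact m) (sc (- of_nat m - of_real (r + 1)) (y m)))"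
    unfolding chiral_adjoint_eq[of K a, OF K] step scale_right_distrib sum.distrib by (simp add: x_def)
  also have "(\<Sum>m<K. sc (1 / fact m) (y (Suc m))) = (\<Sum>m<K. sc (of_nat m / fact m) (y m))"
    unfolding sum_inverse_fact_shift[symmetric] by (simp add: yK)
  also have "(\<Sum>m<K. sc (1 / fact m) (sc (- of_nat m - of_real (r + 1)) (y m))) = 
      - (\<Sum>m<K. sc (of_nat m / fact m) (y m)) - sc (of_real (r + 1)) (\<Sum>m<K. sc (1 / fact m) (y m))"
    unfolding scale_sum_right sum_negf[symmetric] sum_subtractf[symmetric]
  proof (rule sum.cong[OF refl])
    fix m
    have "sc (1 / fact m) (sc (- of_nat m - of_real (r + 1)) (y m)) = sc (- (of_nat m / fact m) - of_real (r + 1) * (1 / fact m)) (y m)"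
      unfolding scale_scale by (rule arg_cong[where f = "\<lambda>k. sc k (y m)"]) (simp add: field_simps)
    also have "\<dots> = - sc (of_nat m / fact m) (y m) - sc (of_real (r + 1)) (sc (1 / fact m) (y m))"
      by (simp only: scale_left_diff_distrib scale_minus_left scale_scale)
    finally show "sc (1 / fact m) (sc (- of_nat m - of_real (r + 1)) (y m)) = 
      - sc (of_nat m / fact m) (y m) - sc (of_real (r + 1)) (sc (1 / fact m) (y m))" .
  qed
  also have "(\<Sum>m<K. sc (1 / fact m) (y m)) = chiral_adjoint h a (r + 1) s c"
    unfolding chiral_adjoint_eq[of K a, OF K] by (intro sum.cong refl) (simp add: y_def x_def algebra_simps)
  finally show ?thesis by simp
qed

text \<open>The translation factor depends on \<open>m\<close>; by the index shift its part
  \<open>m\<close> becomes the exponential series of \<open>Lp a\<close>, a vector of weight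
  \<open>h - 1\<close>.\<close>

lemma Lm_chiral_adjoint:
  assumes a: "a \<in> F h hb"
  shows "Lm (chiral_adjoint h a r s c) = chiral_adjoint h a r s (Lm c) 
     - sc (of_real (r + 2 * h - 1)) (chiral_adjoint h a (r - 1) s c) + chiral_adjoint (h - 1) (Lp a) r s c"
proof -
  obtain K where K: "\<forall>m\<ge>K. (Lp ^^ m) a = 0" using Lp_nilpotent[OF a] by blast
  define x where "x = (\<lambda>m. (Lp ^^ m) a)"
  define y where "y = (\<lambda>m. Y (x m) (r - real m + 2 * h - 2) s c)"
  have yK: "y m = 0" if "m \<ge> K" for m using K that by (simp add: y_def x_def Y_left)
  have step: "Lm (Y (x m) (r - real m + 2 * h - 1) s c) = 
      Y (x m) (r - real m + 2 * h - 1) s (Lm c) + sc (of_nat m - of_real (r + 2 * h - 1)) (y m)" for m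
    using Lm_comm[of "x m" "r - real m + 2 * h - 1" s c] by (simp add: y_def algebra_simps)
  have "Lm (chiral_adjoint h a r s c) = (\<Sum>m<K. sc (1 / fact m) (Lm (Y (x m) (r - real m + 2 * h - 1) s c)))"
    unfolding chiral_adjoint_eq[of K a, OF K] by (simp add: Y_right x_def)
  also have "\<dots> = chiral_adjoint h a r s (Lm c)
      + (\<Sum>m<K. sc (1 / fact m) (sc (of_nat m - of_real (r + 2 * h - 1)) (y m)))"
    unfolding chiral_adjoint_eq[of K a, OF K] step scale_right_distrib sum.distrib by (simp add: x_def)
  also have "(\<Sum>m<K. sc (1 / fact m) (sc (of_nat m - of_real (r + 2 * h - 1)) (y m))) = 
      (\<Sum>m<K. sc (of_nat m / fact m) (y m)) - sc (of_real (r + 2 * h - 1)) (\<Sum>m<K. sc (1 / fact m) (y m))"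
    unfolding scale_sum_right sum_subtractf[symmetric]
  proof (rule sum.cong[OF refl])
    fix m
    have "sc (1 / fact m) (sc (of_nat m - of_real (r + 2 * h - 1)) (y m)) = sc (of_nat m / fact m - of_real (r + 2 * h - 1) * (1 / fact m)) (y m)"
      unfolding scale_scale by (rule arg_cong[where f = "\<lambda>k. sc k (y m)"]) (simp add: field_simps)
    also have "\<dots> = sc (of_nat m / fact m) (y m) - sc (of_real (r + 2 * h - 1)) (sc (1 / fact m) (y m))"
      by (simp only: scale_left_diff_distrib scale_scale)
    finally show "sc (1 / fact m) (sc (of_nat m - of_real (r + 2 * h - 1)) (y m)) = 
      sc (of_nat m / fact m) (y m) - sc (of_real (r + 2 * h - 1)) (sc (1 / fact m) (y m))" .
  qed
  also have "(\<Sum>m<K. sc (of_nat m / fact m) (y m)) = (\<Sum>m<K. sc (1 / fact m) (y (Suc m)))"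
    unfolding sum_inverse_fact_shift[symmetric] by (simp add: yK)
  also have "\<dots> = chiral_adjoint (h - 1) (Lp a) r s c"
  proof -
    have "\<forall>m\<ge>K. (Lp ^^ m) (Lp a) = 0"
      unfolding Lp_powers_Lp using K by (meson le_SucI)
    from chiral_adjoint_eq[of K "Lp a", OF this] show ?thesis
      unfolding Lp_powers_Lp by (simp add: y_def x_def algebra_simps)
  qed
  also have "(\<Sum>m<K. sc (1 / fact m) (y m)) = chiral_adjoint h a (r - 1) s c"
    unfolding chiral_adjoint_eq[of K a, OF K] by (intro sum.cong refl) (simp add: y_def x_def algebra_simps)
  finally show ?thesis by simp
qed

lemma chiral_adjoint_quasiprimary:
  assumes "Lp a = 0"
  shows "chiral_adjoint h a r s c = Y a (r + 2 * h - 1) s c"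
proof -
  have "(Lp ^^ Suc m) a = 0" for m
    unfolding Lp_powers_Lp[symmetric] assms by (rule Lp_powers_0)
  hence "\<forall>m\<ge>1. (Lp ^^ m) a = 0" by (metis One_nat_def Suc_le_D)
  from chiral_adjoint_eq[of 1 a, OF this] show ?thesis by simp
qed

end

section \<open>The bilinear form\<close>

definition parity :: "real \<Rightarrow> real \<Rightarrow> complex" where
  "parity h hb = (- 1) powi \<lfloor>h - hb\<rfloor>"

lemma parity_steps:
  assumes "h - hb \<in> \<int>"
  shows "parity (h + 1) hb = - parity h hb" "parity (h - 1) hb = - parity h hb"
    "parity hb h = parity h hb" "parity h hb * parity h hb = 1"
proof -
  obtain k where k: "h - hb = of_int k" using assms by (auto elim: Ints_cases)
  have "h + 1 - hb = of_int (k + 1)" "h - 1 - hb = of_int (k - 1)" "hb - h = of_int (- k)" using k by auto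
  thus "parity (h + 1) hb = - parity h hb" "parity (h - 1) hb = - parity h hb"
    "parity hb h = parity h hb" "parity h hb * parity h hb = 1"
    unfolding parity_def k 
    by (simp_all only: floor_of_int) (simp_all add: power_int_add power_int_diff power_int_minus_left flip: power_int_mult_distrib)
qed

context fvoa_core begin

interpretation bar: fvoa_core sc "\<lambda>h hb. F hb h" "\<lambda>a r s. Y a s r" vac \<omega>b \<omega> by (rule swap)

lemma weight_diff_int: "a \<in> F h hb \<Longrightarrow> a \<noteq> 0 \<Longrightarrow> h - hb \<in> \<int>"
  using weight_int by blast

text \<open>The coefficient of \<open>z^r zb^s\<close> in \<open>Y(S_z a, 1/z)\<close> for
  \<open>a\<close> of weight \<open>(h, hb)\<close>; the operator \<open>R x\<close> of the overview
  is the case \<open>r = s = 0\<close>. The weight is an argument because the sign and the exponents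
  depend on it.\<close>

definition adjoint :: "real \<Rightarrow> real \<Rightarrow> 'a \<Rightarrow> real \<Rightarrow> real \<Rightarrow> 'a \<Rightarrow> 'a" where
  "adjoint h hb a r s c = sc (parity h hb) (\<Sum>n | (Lpb ^^ n) a \<noteq> 0. 
      sc (1 / fact n) (chiral_adjoint h ((Lpb ^^ n) a) r (s - real n + 2 * hb - 1) c))"

lemma chiral_adjoint_0_left: "chiral_adjoint h 0 r s c = 0"
  by (simp add: chiral_adjoint_def Lp_powers_0)

lemma adjoint_eq:
  assumes "\<forall>n\<ge>K. (Lpb ^^ n) a = 0"
  shows "adjoint h hb a r s c = sc (parity h hb) (\<Sum>n<K. 
      sc (1 / fact n) (chiral_adjoint h ((Lpb ^^ n) a) r (s - real n + 2 * hb - 1) c))"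
  unfolding adjoint_def
proof (rule arg_cong[where f = "sc _"], rule sum.mono_neutral_left)
  show "{n. (Lpb ^^ n) a \<noteq> 0} \<subseteq> {..<K}" using assms not_le by auto
qed (auto simp: chiral_adjoint_0_left)

lemma Lpb_nilpotent:
  assumes "v \<in> F h hb"
  shows "\<exists>K. \<forall>n\<ge>K. (Lpb ^^ n) v = 0"
  using bar.Lp_nilpotent[OF assms] by blast

lemma adjoint_double_sum:
  assumes m: "\<forall>m\<ge>K. (Lp ^^ m) a = 0" and n: "\<forall>n\<ge>K'. (Lpb ^^ n) a = 0"
  shows "adjoint h hb a r s c = sc (parity h hb) (\<Sum>n<K'. \<Sum>m<K. 
      sc (1 / (fact m * fact n)) (Y ((Lp ^^ m) ((Lpb ^^ n) a)) (r - real m + 2 * h - 1) (s - real n + 2 * hb - 1) c))"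
proof -
  have "\<forall>m\<ge>K. (Lp ^^ m) ((Lpb ^^ n) a) = 0" for n
    unfolding Lpb_powers_Lp_powers[symmetric] using m by (simp add: bar.Lp_powers_0)
  thus ?thesis unfolding adjoint_eq[OF n]
    by (simp add: chiral_adjoint_eq[of K] scale_sum_right mult.commute)
qed

lemma adjoint_0_left: "adjoint h hb 0 r s c = 0"
  by (simp add: adjoint_def bar.Lp_powers_0)

lemma adjoint_add_left:
  assumes "a \<in> F h hb" "b \<in> F h hb"
  shows "adjoint h hb (a + b) r s c = adjoint h hb a r s c + adjoint h hb b r s c"
proof -
  obtain K1 where K1: "\<forall>n\<ge>K1. (Lpb ^^ n) a = 0" using Lpb_nilpotent[OF assms(1)] by blast
  obtain K2 where K2: "\<forall>n\<ge>K2. (Lpb ^^ n) b = 0" using Lpb_nilpotent[OF assms(2)] by blast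
  have *: "\<forall>m\<ge>max K1 K2. (Lpb ^^ m) a = 0" "\<forall>m\<ge>max K1 K2. (Lpb ^^ m) b = 0" 
    "\<forall>m\<ge>max K1 K2. (Lpb ^^ m) (a + b) = 0"
    using K1 K2 by (auto simp: bar.Lp_powers_add)
  have "chiral_adjoint h ((Lpb ^^ n) (a + b)) r t c = 
     chiral_adjoint h ((Lpb ^^ n) a) r t c + chiral_adjoint h ((Lpb ^^ n) b) r t c" for n t
    unfolding bar.Lp_powers_add 
    by (rule chiral_adjoint_add_left[OF bar.Lp_powers_weight[OF assms(1)] bar.Lp_powers_weight[OF assms(2)]])
  thus ?thesis
    unfolding adjoint_eq[OF *(1)] adjoint_eq[OF *(2)] adjoint_eq[OF *(3)]
    by (simp add: scale_right_distrib sum.distrib)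
qed

lemma adjoint_scale_left: "adjoint h hb (sc k a) r s c = sc k (adjoint h hb a r s c)"
proof (cases "k = 0")
  case True
  thus ?thesis by (simp add: adjoint_0_left)
next
  case False
  thus ?thesis unfolding adjoint_def
    by (simp add: bar.Lp_powers_scale chiral_adjoint_scale_left scale_sum_right mult_ac)
qed

lemma adjoint_add_right: "adjoint h hb a r s (c + d) = adjoint h hb a r s c + adjoint h hb a r s d"
  unfolding adjoint_def by (simp add: chiral_adjoint_add_right scale_right_distrib sum.distrib)

lemma adjoint_scale_right: "adjoint h hb a r s (sc k c) = sc k (adjoint h hb a r s c)"
  unfolding adjoint_def by (simp add: chiral_adjoint_scale_right scale_sum_right mult_ac)

lemma adjoint_0_right: "adjoint h hb a r s 0 = 0"
  using adjoint_scale_right[of h hb a r s 0 0] by simp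

lemma adjoint_weight:
  assumes "a \<in> F h hb" "c \<in> F h' hb'"
  shows "adjoint h hb a r s c \<in> F (h' - h - r) (hb' - hb - s)"
  unfolding adjoint_def
proof (intro F_scale subspace_sum[OF F_subspace])
  fix n
  have "chiral_adjoint h ((Lpb ^^ n) a) r (s - real n + 2 * hb - 1) c
     \<in> F (h' - h - r) ((hb - real n) + hb' - (s - real n + 2 * hb - 1) - 1)"
    by (rule chiral_adjoint_weight[OF bar.Lp_powers_weight[OF assms(1)] assms(2)])
  thus "chiral_adjoint h ((Lpb ^^ n) a) r (s - real n + 2 * hb - 1) c \<in> F (h' - h - r) (hb' - hb - s)"
    by (simp add: algebra_simps)
qed

lemma adjoint_quasiprimary:
  assumes "Lp a = 0" "Lpb a = 0"
  shows "adjoint h hb a r s c = sc (parity h hb) (Y a (r + 2 * h - 1) (s + 2 * hb - 1) c)"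
proof -
  have "(Lpb ^^ Suc n) a = 0" for n
    unfolding bar.Lp_powers_Lp[symmetric] assms by (rule bar.Lp_powers_0)
  hence "\<forall>n\<ge>1. (Lpb ^^ n) a = 0" by (metis One_nat_def Suc_le_D)
  from adjoint_eq[OF this] show ?thesis by (simp add: chiral_adjoint_quasiprimary assms)
qed

text \<open>The minus sign of \<open>chiral_adjoint_Lm\<close> is absorbed by the parity, which
  changes when \<open>h\<close> becomes \<open>h + 1\<close>.\<close>

lemma adjoint_Lm:
  assumes a: "a \<in> F h hb"
  shows "adjoint (h + 1) hb (Lm a) r s c = sc (of_real (r + 1)) (adjoint h hb a (r + 1) s c)"
proof (cases "a = 0")
  case True
  thus ?thesis by (simp add: Y_right adjoint_0_left)
next
  case False
  note par = parity_steps[OF weight_diff_int[OF a False]]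
  obtain K where K: "\<forall>n\<ge>K. (Lpb ^^ n) a = 0" using Lpb_nilpotent[OF a] by blast
  hence K': "\<forall>n\<ge>K. (Lpb ^^ n) (Lm a) = 0" by (simp add: Lpb_powers_Lm Y_right)
  show ?thesis unfolding adjoint_eq[OF K] adjoint_eq[OF K'] Lpb_powers_Lm par
    by (simp only: chiral_adjoint_Lm[OF bar.Lp_powers_weight[OF a]] scale_sum_right scale_scale)
       (intro sum.cong refl arg_cong[where f = "\<lambda>k. sc k _"], simp add: field_simps)
qed

lemma Lp_adjoint:
  assumes a: "a \<in> F h hb"
  shows "Lp (adjoint h hb a r s c) = adjoint h hb a r s (Lp c) - sc (of_real (r + 1)) (adjoint h hb a (r + 1) s c)"
proof -
  obtain K where K: "\<forall>n\<ge>K. (Lpb ^^ n) a = 0" using Lpb_nilpotent[OF a] by blast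
  show ?thesis unfolding adjoint_eq[OF K] Y_right(3,6) Lp_chiral_adjoint[OF bar.Lp_powers_weight[OF a]]
    by (simp add: scale_right_diff_distrib sum_subtractf scale_sum_right mult_ac)
qed

lemma Lm_adjoint:
  assumes a: "a \<in> F h hb"
  shows "Lm (adjoint h hb a r s c) = adjoint h hb a r s (Lm c) 
     - sc (of_real (r + 2 * h - 1)) (adjoint h hb a (r - 1) s c) - adjoint (h - 1) hb (Lp a) r s c"
proof (cases "a = 0")
  case True
  thus ?thesis by (simp add: Y_right adjoint_0_left)
next
  case False
  note par = parity_steps[OF weight_diff_int[OF a False]]
  obtain K where K: "\<forall>n\<ge>K. (Lpb ^^ n) a = 0" using Lpb_nilpotent[OF a] by blast
  hence K': "\<forall>n\<ge>K. (Lpb ^^ n) (Lp a) = 0" by (simp add: Lpb_powers_Lp Y_right)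
  show ?thesis unfolding adjoint_eq[OF K] adjoint_eq[OF K'] Y_right(3,6) Lpb_powers_Lp par
      Lm_chiral_adjoint[OF bar.Lp_powers_weight[OF a]]
    by (simp add: scale_right_diff_distrib scale_right_distrib sum.distrib sum_subtractf sum_negf scale_sum_right mult_ac)
qed

end

context fvoa_core begin

interpretation bar: fvoa_core sc "\<lambda>h hb. F hb h" "\<lambda>a r s. Y a s r" vac \<omega>b \<omega> by (rule swap)

lemma adjoint_bar:
  assumes a: "a \<in> F h hb"
  shows "bar.adjoint hb h a s r c = adjoint h hb a r s c"
proof (cases "a = 0")
  case True
  thus ?thesis by (simp add: adjoint_0_left bar.adjoint_0_left)
next
  case False
  note par = parity_steps[OF weight_diff_int[OF a False]]
  obtain K where K: "\<forall>m\<ge>K. (Lp ^^ m) a = 0" using Lp_nilpotent[OF a] by blast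
  obtain K' where K': "\<forall>n\<ge>K'. (Lpb ^^ n) a = 0" using Lpb_nilpotent[OF a] by blast
  show ?thesis unfolding adjoint_double_sum[OF K K'] bar.adjoint_double_sum[OF K' K] par
    by (subst sum.swap) (simp add: Lpb_powers_Lp_powers mult.commute)
qed

text \<open>\<open>L(1)\<close> is nilpotent on \<open>c\<close> and annihilated by \<open>\<theta>\<close>.\<close>

lemma theta_adjoint_negative:
  assumes a: "a \<in> F h hb" and c: "c \<in> F h' hb'"
  shows "\<theta> (adjoint h hb a (-1) s c) = 0"
proof -
  \<comment> \<open>All negative integers are treated at once: \<open>Lp_adjoint\<close> at
    \<open>r = - j - 2\<close> relates this coefficient for \<open>c\<close> to one for
    \<open>Lp c\<close>, with the nonzero factor \<open>- (j + 1)\<close>.\<close>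
  have "\<theta> (adjoint h hb a (- real (Suc j)) s c) = 0" if "(Lp ^^ n) c = 0" for n c j
    using that
  proof (induction n arbitrary: c j)
    case 0
    thus ?case by (simp add: adjoint_0_right theta_simps)
  next
    case (Suc n)
    have "(Lp ^^ n) (Lp c) = 0" using Suc.prems by (simp add: funpow_swap1)
    hence "\<theta> (adjoint h hb a (- real (Suc (Suc j))) s (Lp c)) = 0" by (rule Suc.IH)
    moreover have "0 = \<theta> (adjoint h hb a (- real (Suc (Suc j))) s (Lp c)) 
       - of_real (- real (Suc (Suc j)) + 1) * \<theta> (adjoint h hb a (- real (Suc (Suc j)) + 1) s c)"
      using arg_cong[OF Lp_adjoint[OF a, of "- real (Suc (Suc j))" s c], of \<theta>]
      by (simp only: theta_Lp theta_simps)
    ultimately have "of_real (- real (Suc j)) * \<theta> (adjoint h hb a (- real (Suc j)) s c) = 0" by simp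
    hence "of_real (- real (Suc j)) = (0 :: complex) \<or> \<theta> (adjoint h hb a (- real (Suc j)) s c) = 0" 
      by (simp only: mult_eq_0_iff)
    moreover have "of_real (- real (Suc j)) \<noteq> (0 :: complex)" unfolding of_real_eq_0_iff by simp
    ultimately show ?case by blast
  qed
  moreover obtain K where "(Lp ^^ K) c = 0" using Lp_nilpotent[OF c] by blast
  ultimately show ?thesis by (metis One_nat_def of_nat_1)
qed

text \<open>Summed over components, since \<open>adjoint\<close> needs the weight of its
  argument.\<close>

definition form :: "'a \<Rightarrow> 'a \<Rightarrow> complex" where
  "form x y = (\<Sum>p | comp p x \<noteq> 0. \<theta> (adjoint (fst p) (snd p) (comp p x) 0 0 y))"

lemma form_homogeneous:
  assumes "x \<in> F h hb"
  shows "form x y = \<theta> (adjoint h hb x 0 0 y)"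
proof (cases "x = 0")
  case True
  have "comp p 0 = 0" for p using linearD(4)[OF comp_linear] .
  thus ?thesis using True by (simp add: form_def adjoint_0_left theta_simps)
next
  case False
  hence "{p. comp p x \<noteq> 0} = {(h, hb)}" using comp_homogeneous[OF assms] by auto
  thus ?thesis by (simp add: form_def comp_homogeneous[OF assms])
qed

lemma form_add_left: "form (x + x') y = form x y + form x' y"
proof -
  let ?X = "{p. comp p x \<noteq> 0} \<union> {p. comp p x' \<noteq> 0}"
  let ?f = "\<lambda>x p. \<theta> (adjoint (fst p) (snd p) (comp p x) 0 0 y)"
  have fin: "finite ?X" using comp_props(2) by blast
  have *: "form z y = sum (?f z) ?X" if "{p. comp p z \<noteq> 0} \<subseteq> ?X" for z
    unfolding form_def by (rule sum.mono_neutral_left[OF fin that]) (auto simp: adjoint_0_left theta_simps)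
  have "?f (x + x') p = ?f x p + ?f x' p" for p
  proof -
    have "comp p x \<in> F (fst p) (snd p)" "comp p x' \<in> F (fst p) (snd p)" 
      using comp_props(1)[of "fst p" "snd p"] by simp_all
    thus ?thesis by (simp add: comp_add adjoint_add_left theta_simps)
  qed
  moreover have "form (x + x') y = sum (?f (x + x')) ?X" by (rule *) (auto simp: comp_add)
  moreover have "form x y = sum (?f x) ?X" "form x' y = sum (?f x') ?X" by (rule *; blast)+
  ultimately show ?thesis by (simp only: sum.distrib)
qed

lemma form_scale_left: "form (sc k x) y = k * form x y"
proof (cases "k = 0")
  case True
  have "comp p 0 = 0" for p using linearD(4)[OF comp_linear] .
  thus ?thesis using True by (simp add: form_def)
next
  case False
  thus ?thesis unfolding form_def by (simp add: comp_scale adjoint_scale_left theta_simps sum_distrib_left)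
qed

lemma form_add_right: "form x (y + y') = form x y + form x y'"
  unfolding form_def by (simp add: adjoint_add_right theta_simps sum.distrib)

lemma form_scale_right: "form x (sc k y) = k * form x y"
  unfolding form_def by (simp add: adjoint_scale_right theta_simps sum_distrib_left)

lemma form_linear: "Vector_Spaces.linear sc (*) (\<lambda>x. form x y)" "Vector_Spaces.linear sc (*) (form x)"
proof -
  have vs: "vector_space ((*) :: complex \<Rightarrow> complex \<Rightarrow> complex)"
    by unfold_locales (auto simp: algebra_simps)
  show "Vector_Spaces.linear sc (*) (\<lambda>x. form x y)" "Vector_Spaces.linear sc (*) (form x)"
    unfolding Vector_Spaces.linear_iff using vs vector_space_axioms
    by (auto simp: form_add_left form_add_right form_scale_left form_scale_right)
qed

lemmas form_left = linearD[OF form_linear(1)]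
lemmas form_right = linearD[OF form_linear(2)]

lemma form_weight:
  assumes "x \<in> F h hb" "y \<in> F h' hb'" "h \<noteq> h' \<or> hb \<noteq> hb'"
  shows "form x y = 0"
  using theta_weight[OF adjoint_weight[OF assms(1,2), of 0 0]] assms(3)
  by (auto simp: form_homogeneous[OF assms(1)])

text \<open>Apply \<open>\<theta>\<close> to \<open>Lp_adjoint\<close> at \<open>r = 0\<close>: the
  left-hand side dies, and the term with \<open>r + 1\<close> is the adjoint of
  \<open>Lm x\<close>.\<close>

lemma form_Lm_left: "form (Lm x) y = form x (Lp y)"
proof (induction x rule: homogeneous_induct)
  case (homogeneous h hb x)
  show ?case
    using arg_cong[OF Lp_adjoint[OF homogeneous, of 0 0 y], of \<theta>]
    by (simp add: form_homogeneous[OF homogeneous] form_homogeneous[OF Lm_weight[OF homogeneous]]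
        adjoint_Lm[OF homogeneous] theta_Lp theta_simps)
qed (simp add: Y_right form_left)

text \<open>Apply \<open>\<theta>\<close> to \<open>Lm_adjoint\<close> at \<open>r = 0\<close>. The
  term with index \<open>- 1\<close> has no counterpart in the claim;
  \<open>theta_adjoint_negative\<close> removes it.\<close>

lemma form_Lp_left: "form (Lp x) y = form x (Lm y)"
proof (induction x rule: homogeneous_induct)
  case (homogeneous h hb x)
  show ?case
  proof (induction y rule: homogeneous_induct)
    case (homogeneous h' hb' y)
    show ?case
      using arg_cong[OF Lm_adjoint[OF \<open>x \<in> F h hb\<close>, of 0 0 y], of \<theta>] theta_adjoint_negative[OF \<open>x \<in> F h hb\<close> homogeneous]
      by (simp add: form_homogeneous[OF \<open>x \<in> F h hb\<close>] form_homogeneous[OF Lp_weight[OF \<open>x \<in> F h hb\<close>]] theta_Lm theta_simps)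
  qed (simp add: Y_right form_right)
qed (simp add: Y_right form_left)

end

context fvoa_core begin

interpretation bar: fvoa_core sc "\<lambda>h hb. F hb h" "\<lambda>a r s. Y a s r" vac \<omega>b \<omega> by (rule swap)

lemma form_bar: "bar.form x y = form x y"
proof (induction x rule: homogeneous_induct)
  case (homogeneous h hb x)
  show ?case
    unfolding form_homogeneous[OF homogeneous] bar.form_homogeneous[OF homogeneous] adjoint_bar[OF homogeneous] theta_bar ..
qed (simp add: form_left bar.form_left)

lemma form_Lmb_left: "form (Lmb x) y = form x (Lpb y)" and form_Lpb_left: "form (Lpb x) y = form x (Lmb y)"
  using bar.form_Lm_left[of x y] bar.form_Lp_left[of x y] by (simp_all add: form_bar)

lemma form_vac: "form vac vac = 1"
proof -
  have "Lp vac = 0" "Lpb vac = 0"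
    by (rule Y_vac; (auto simp: Nats_def; fail)?; simp add: Nats_altdef1)+
  hence "adjoint 0 0 vac 0 0 vac = vac"
    by (simp add: adjoint_quasiprimary parity_def vac_Y)
  thus ?thesis by (simp add: form_homogeneous[OF vac_weight] theta_vac)
qed

end

section \<open>Invariance and nondegeneracy\<close>

context fvoa_core begin

interpretation bar: fvoa_core sc "\<lambda>h hb. F hb h" "\<lambda>a r s. Y a s r" vac \<omega>b \<omega> by (rule swap)

lemma Lp_quasiprimary_comm:
  assumes "a \<in> F h hb" "Lp a = 0" "Lp b = 0"
  shows "Lp (Y a r s b) = sc (of_real (2 * h - r - 2)) (Y a (r + 1) s b)"
  using Lp_comm[OF assms(1), of r s b] assms by (simp add: Y_left Y_right)

text \<open>\<open>\<theta>\<close> kills the image of \<open>L(1)\<close>, and \<open>L(1)\<close>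
  kills \<open>c\<close>, so only the commutators with the two fields survive. Homogeneity apart,
  this is the symmetry that does not move \<open>c\<close> from 0.\<close>

lemma ward_12:
  assumes "a \<in> F h1 k1" "b \<in> F h2 k2" "Lp a = 0" "Lp b = 0" "Lp c = 0"
  shows "of_real (2 * h1 - i - 2) * \<theta> (Y a (i + 1) s (Y b j s' c)) 
     = - of_real (2 * h2 - j - 2) * \<theta> (Y a i s (Y b (j + 1) s' c))"
proof -
  have "0 = \<theta> (Lp (Y a i s (Y b j s' c)))" by (rule theta_Lp[symmetric])
  also have "\<dots> = of_real (2 * h2 - j - 2) * \<theta> (Y a i s (Y b (j + 1) s' c)) + of_real (2 * h1 - i - 2) * \<theta> (Y a (i + 1) s (Y b j s' c))"
    unfolding Lp_comm[OF assms(1)] Lp_quasiprimary_comm[OF assms(2,4,5)] assms(3)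
    by (simp only: theta_simps Y_left Y_right add_0_right add_0_left)
  finally show ?thesis
    unfolding mult_minus_left by (metis add.commute eq_neg_iff_add_eq_0)
qed

lemma ward_02:
  assumes "a \<in> F h1 k1" "b \<in> F h2 k2" "Lp a = 0" "Lp b = 0" "Lp c = 0"
  shows "of_real (2 * (h1 + h2 - i - 1) - n - 2) * \<theta> (Y (Y a i s b) (n + 1) s' c)
     = - of_real (2 * h1 - i - 2) * \<theta> (Y (Y a (i + 1) s b) n s' c)"
proof -
  have "0 = \<theta> (Lp (Y (Y a i s b) n s' c))" by (rule theta_Lp[symmetric])
  also have "\<dots> = of_real (2 * h1 - i - 2) * \<theta> (Y (Y a (i + 1) s b) n s' c) 
       + of_real (2 * (h1 + h2 - i - 1) - n - 2) * \<theta> (Y (Y a i s b) (n + 1) s' c)"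
    unfolding Lp_comm[OF Y_weight[OF assms(1,2)]] Lp_quasiprimary_comm[OF assms(1,3,4)] assms(5)
    by (simp only: theta_simps Y_left Y_right add_0_right add_0_left)
  finally show ?thesis
    unfolding mult_minus_left by (metis add.commute eq_neg_iff_add_eq_0)
qed

text \<open>The coefficient at the leading exponents of the expansion in \<open>|z1| > |z2|\<close>,
  which for quasi-primary vectors determines the whole three-point function.\<close>

definition structure_constant :: "real \<times> real \<Rightarrow> real \<times> real \<Rightarrow> real \<times> real \<Rightarrow> 'a \<Rightarrow> 'a \<Rightarrow> 'a \<Rightarrow> complex" where
  "structure_constant p1 p2 p3 a b c = 
     \<theta> (Y a (2 * fst p1 - 1) (2 * snd p1 - 1) 
          (Y b (fst p2 + fst p3 - fst p1 - 1) (snd p2 + snd p3 - snd p1 - 1) c))"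

end

context fvoa_core begin

interpretation bar: fvoa_core sc "\<lambda>h hb. F hb h" "\<lambda>a r s. Y a s r" vac \<omega>b \<omega> by (rule swap)

text \<open>The first two parts compare the expansion in \<open>|z1| > |z2|\<close> with the other
  two. The third holds because the expansion in \<open>z0\<close> starts at the exponents
  \<open>(\<alpha>12, \<beta>12)\<close>; it disposes of the higher terms of the adjoint in
  \<open>form_three_point\<close>.\<close>

lemma three_point:
  assumes a: "a \<in> F h1 k1" "quasiprimary a" and b: "b \<in> F h2 k2" "quasiprimary b" and c: "c \<in> F h3 k3" "quasiprimary c"
    and nz: "a \<noteq> 0" "b \<noteq> 0" "c \<noteq> 0"
  shows "\<theta> (Y (Y a (h1 + h2 - h3 - 1) (k1 + k2 - k3 - 1) b) (2 * h3 - 1) (2 * k3 - 1) c) 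
       = structure_constant (h1, k1) (h2, k2) (h3, k3) a b c"
    and "structure_constant (h2, k2) (h1, k1) (h3, k3) b a c = 
      parity h1 k1 * parity h2 k2 * parity h3 k3 * structure_constant (h1, k1) (h2, k2) (h3, k3) a b c"
    and "m \<noteq> 0 \<or> n \<noteq> 0 \<Longrightarrow> \<theta> (Y (Y a (h1 + h2 - h3 - 1 + real m) (k1 + k2 - k3 - 1 + real n) b) 
          (2 * h3 - 1 - real m) (2 * k3 - 1 - real n) c) = 0"
proof -
  have Lp: "Lp a = 0" "Lp b = 0" "Lp c = 0" and Lpb: "Lpb a = 0" "Lpb b = 0" "Lpb c = 0"
    using a b c by (auto simp: quasiprimary_def)
  obtain i1 i2 i3 where i: "h1 - k1 = of_int i1" "h2 - k2 = of_int i2" "h3 - k3 = of_int i3"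
    using weight_diff_int[OF a(1) nz(1)] weight_diff_int[OF b(1) nz(2)] weight_diff_int[OF c(1) nz(3)]
    by (metis Ints_cases)
  define d e where "d = - (h1 + h2 + h3)" and "e = - (k1 + k2 + k3)"
  \<comment> \<open>The exponents of \<open>z1\<close>, \<open>z2\<close> and \<open>z1 - z2\<close>
    in the conformal three-point function with third point 0.\<close>
  define \<alpha>1 \<beta>1 \<alpha>2 \<beta>2 \<alpha>12 \<beta>12 where "\<alpha>1 = h2 - h1 - h3" and "\<beta>1 = k2 - k1 - k3" 
    and "\<alpha>2 = h1 - h2 - h3" and "\<beta>2 = k1 - k2 - k3" and "\<alpha>12 = h3 - h1 - h2" and "\<beta>12 = k3 - k1 - k2"
  note defs = d_def e_def \<alpha>1_def \<beta>1_def \<alpha>2_def \<beta>2_def \<alpha>12_def \<beta>12_def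
  have ints': "\<alpha>1 - \<beta>1 = of_int (i2 - i1 - i3)" "\<alpha>2 - \<beta>2 = of_int (i1 - i2 - i3)" "\<alpha>12 - \<beta>12 = of_int (i3 - i1 - i2)"
    "d - e = of_int (- (i1 + i2 + i3))"
    using i by (simp_all add: defs)
  have ints: "\<alpha>1 - \<beta>1 \<in> \<int>" "\<alpha>2 - \<beta>2 \<in> \<int>" "\<alpha>12 - \<beta>12 \<in> \<int>" "d - e \<in> \<int>"
    unfolding ints' by (rule Ints_of_int)+
  obtain g where g: "correlator d e
         (\<lambda>r1 s1 r2 s2. \<theta> (Y a (- r1 - 1) (- s1 - 1) (Y b (- r2 - 1) (- s2 - 1) c)))
         (\<lambda>r0 s0 r2 s2. \<theta> (Y (Y a (- r0 - 1) (- s0 - 1) b) (- r2 - 1) (- s2 - 1) c))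
         (\<lambda>r1 s1 r2 s2. \<theta> (Y b (- r2 - 1) (- s2 - 1) (Y a (- r1 - 1) (- s1 - 1) c))) g"
    using correlators[OF theta_restricted_dual ints(4)] by blast
  define A12 where "A12 = (\<lambda>r s. \<theta> (Y a (- (d - r) - 1) (- (e - s) - 1) (Y b (- r - 1) (- s - 1) c)))"
  define A02 where "A02 = (\<lambda>r s. \<theta> (Y (Y a (- r - 1) (- s - 1) b) (- (d - r) - 1) (- (e - s) - 1) c))"
  define A21 where "A21 = (\<lambda>r s. \<theta> (Y b (- (d - r) - 1) (- (e - s) - 1) (Y a (- r - 1) (- s - 1) c)))"
  have de: "d = \<alpha>1 + \<alpha>2 + \<alpha>12" "e = \<beta>1 + \<beta>2 + \<beta>12" by (simp_all add: defs)
  have rec: "of_real (r - \<alpha>2) * A12 r s = of_real (r - \<alpha>2 - 1 - \<alpha>12) * A12 (r - 1) s"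
    "of_real (s - \<beta>2) * A12 r s = of_real (s - \<beta>2 - 1 - \<beta>12) * A12 r (s - 1)"
    "of_real (r - \<alpha>1) * A21 r s = of_real (r - \<alpha>1 - 1 - \<alpha>12) * A21 (r - 1) s"
    "of_real (s - \<beta>1) * A21 r s = of_real (s - \<beta>1 - 1 - \<beta>12) * A21 r (s - 1)"
    "of_real (r - \<alpha>12) * A02 r s = - of_real (r - \<alpha>12 - 1 - \<alpha>1) * A02 (r - 1) s"
    "of_real (s - \<beta>12) * A02 r s = - of_real (s - \<beta>12 - 1 - \<beta>1) * A02 r (s - 1)" for r s
  proof -
    show "of_real (r - \<alpha>2) * A12 r s = of_real (r - \<alpha>2 - 1 - \<alpha>12) * A12 (r - 1) s"
      using ward_12[OF a(1) b(1) Lp, of "- (d - r) - 2" "- (e - s) - 1" "- r - 1" "- s - 1"]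
      by (simp add: A12_def defs algebra_simps)
    show "of_real (r - \<alpha>1) * A21 r s = of_real (r - \<alpha>1 - 1 - \<alpha>12) * A21 (r - 1) s"
      using ward_12[OF b(1) a(1) Lp(2,1,3), of "- (d - r) - 2" "- (e - s) - 1" "- r - 1" "- s - 1"]
      by (simp add: A21_def defs algebra_simps)
    show "of_real (r - \<alpha>12) * A02 r s = - of_real (r - \<alpha>12 - 1 - \<alpha>1) * A02 (r - 1) s"
      using ward_02[OF a(1) b(1) Lp, of "- r - 1" "- (d - r) - 2" "- s - 1" "- (e - s) - 1"]
      by (simp add: A02_def defs algebra_simps)
    show "of_real (s - \<beta>2) * A12 r s = of_real (s - \<beta>2 - 1 - \<beta>12) * A12 r (s - 1)"
      using bar.ward_12[OF a(1) b(1) Lpb, of "- (e - s) - 2" "- (d - r) - 1" "- r - 1" "- s - 1"]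
      by (simp add: A12_def defs theta_bar algebra_simps)
    show "of_real (s - \<beta>1) * A21 r s = of_real (s - \<beta>1 - 1 - \<beta>12) * A21 r (s - 1)"
      using bar.ward_12[OF b(1) a(1) Lpb(2,1,3), of "- (e - s) - 2" "- (d - r) - 1" "- r - 1" "- s - 1"]
      by (simp add: A21_def defs theta_bar algebra_simps)
    show "of_real (s - \<beta>12) * A02 r s = - of_real (s - \<beta>12 - 1 - \<beta>1) * A02 r (s - 1)"
      using bar.ward_02[OF a(1) b(1) Lpb, of "- s - 1" "- (e - s) - 2" "- r - 1" "- (d - r) - 1"]
      by (simp add: A02_def defs theta_bar algebra_simps)
  qed
  note tp = correlator_three_point[OF g ints(1-3) de A12_def[THEN fun_cong, THEN fun_cong] 
      A02_def[THEN fun_cong, THEN fun_cong] A21_def[THEN fun_cong, THEN fun_cong] rec(1,2,3,4,5,6)]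
  have C: "A12 \<alpha>2 \<beta>2 = structure_constant (h1, k1) (h2, k2) (h3, k3) a b c"
    by (simp add: A12_def structure_constant_def defs algebra_simps)
  show "\<theta> (Y (Y a (h1 + h2 - h3 - 1) (k1 + k2 - k3 - 1) b) (2 * h3 - 1) (2 * k3 - 1) c) 
       = structure_constant (h1, k1) (h2, k2) (h3, k3) a b c"
    using tp(1) unfolding C by (simp add: A02_def defs algebra_simps)
  have "structure_constant (h2, k2) (h1, k1) (h3, k3) b a c = A21 \<alpha>1 \<beta>1"
    by (simp add: A21_def structure_constant_def defs algebra_simps)
  also have "\<dots> = (- 1) powi \<lfloor>\<alpha>12 - \<beta>12\<rfloor> * structure_constant (h1, k1) (h2, k2) (h3, k3) a b c"
    using tp(2) unfolding C .
  also have "(- 1) powi \<lfloor>\<alpha>12 - \<beta>12\<rfloor> = parity h1 k1 * parity h2 k2 * parity h3 k3"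
    unfolding parity_def i ints'(3) floor_of_int
    by (simp add: power_int_diff power_int_minus_left mult_ac flip: power_int_mult_distrib)
  finally show "structure_constant (h2, k2) (h1, k1) (h3, k3) b a c = 
      parity h1 k1 * parity h2 k2 * parity h3 k3 * structure_constant (h1, k1) (h2, k2) (h3, k3) a b c" .
  assume mn: "m \<noteq> 0 \<or> n \<noteq> 0"
  have neg: "- real m \<notin> \<nat>" if "m \<noteq> 0" for m
  proof
    assume "- real m \<in> \<nat>"
    then obtain k where "- real m = real k" by (auto elim: Nats_cases)
    thus False using that by linarith
  qed
  have "A02 (\<alpha>12 - real m) (\<beta>12 - real n) = 0"
    by (rule tp(3)) (use neg mn in auto)
  thus "\<theta> (Y (Y a (h1 + h2 - h3 - 1 + real m) (k1 + k2 - k3 - 1 + real n) b) 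
          (2 * h3 - 1 - real m) (2 * k3 - 1 - real n) c) = 0"
    by (simp add: A02_def defs algebra_simps)
qed

text \<open>Between quasi-primary vectors \<open>L(1)\<close> only raises the mode index, up to a
  scalar; the scalar is irrelevant, as the resulting terms will vanish under
  \<open>\<theta>\<close>.\<close>

lemma Lp_powers_quasiprimary_modes:
  assumes "a \<in> F h hb" "Lp a = 0" "Lp b = 0"
  shows "\<exists>k. (Lp ^^ m) (Y a r s b) = sc k (Y a (r + real m) s b)"
proof (induction m)
  case 0
  have "(Lp ^^ 0) (Y a r s b) = sc 1 (Y a (r + real 0) s b)" by simp
  thus ?case by blast
next
  case (Suc m)
  then obtain k where k: "(Lp ^^ m) (Y a r s b) = sc k (Y a (r + real m) s b)" by blast
  have "(Lp ^^ Suc m) (Y a r s b) = sc k (Lp (Y a (r + real m) s b))" by (simp add: k Y_right)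
  also have "\<dots> = sc (k * of_real (2 * h - (r + real m) - 2)) (Y a (r + real (Suc m)) s b)"
    unfolding Lp_quasiprimary_comm[OF assms] scale_scale by (simp add: algebra_simps)
  finally show ?case by blast
qed

lemma Lpb_powers_quasiprimary_modes:
  assumes "a \<in> F h hb" "Lpb a = 0" "Lpb b = 0"
  shows "\<exists>k. (Lpb ^^ m) (Y a r s b) = sc k (Y a r (s + real m) b)"
proof (induction m)
  case 0
  have "(Lpb ^^ 0) (Y a r s b) = sc 1 (Y a r (s + real 0) b)" by simp
  thus ?case by blast
next
  case (Suc m)
  then obtain k where k: "(Lpb ^^ m) (Y a r s b) = sc k (Y a r (s + real m) b)" by blast
  have "(Lpb ^^ Suc m) (Y a r s b) = sc k (Lpb (Y a r (s + real m) b))" by (simp add: k Y_right)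
  also have "\<dots> = sc (k * of_real (2 * hb - (s + real m) - 2)) (Y a r (s + real (Suc m)) b)"
    unfolding bar.Lp_quasiprimary_comm[OF assms] scale_scale by (simp add: algebra_simps)
  finally show ?case by blast
qed

lemma form_quasiprimary_left:
  assumes "a \<in> F h hb" "quasiprimary a"
  shows "form a x = parity h hb * \<theta> (Y a (2 * h - 1) (2 * hb - 1) x)"
  using assms(2) by (simp add: form_homogeneous[OF assms(1)] adjoint_quasiprimary quasiprimary_def theta_simps)

text \<open>The product of \<open>a\<close> and \<open>b\<close> is in general not quasi-primary, so
  its adjoint is a double sum over powers of \<open>L(1)\<close> and its conjugate. Each power
  raises a mode index, and \<open>three_point(3)\<close> annihilates all terms but the
  first.\<close>

lemma form_three_point:
  assumes a: "a \<in> F h1 k1" "quasiprimary a" and b: "b \<in> F h2 k2" "quasiprimary b" and c: "c \<in> F h3 k3" "quasiprimary c"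
    and nz: "a \<noteq> 0" "b \<noteq> 0" "c \<noteq> 0"
  shows "form (Y a (h1 + h2 - h3 - 1) (k1 + k2 - k3 - 1) b) c = parity h3 k3 * structure_constant (h1, k1) (h2, k2) (h3, k3) a b c"
proof -
  let ?r = "h1 + h2 - h3 - 1" and ?s = "k1 + k2 - k3 - 1"
  define y where "y = Y a ?r ?s b"
  have y: "y \<in> F h3 k3" using Y_weight[OF a(1) b(1), of ?r ?s] by (simp add: y_def algebra_simps)
  obtain K where K: "\<forall>m\<ge>K. (Lp ^^ m) y = 0" using Lp_nilpotent[OF y] by blast
  obtain K' where K': "\<forall>n\<ge>K'. (Lpb ^^ n) y = 0" using Lpb_nilpotent[OF y] by blast
  define f where "f = (\<lambda>m n. \<theta> (Y ((Lp ^^ m) ((Lpb ^^ n) y)) (0 - real m + 2 * h3 - 1) (0 - real n + 2 * k3 - 1) c))"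
  have f: "f m n = 0" if "m \<noteq> 0 \<or> n \<noteq> 0" for m n
  proof -
    obtain k where k: "(Lpb ^^ n) y = sc k (Y a ?r (?s + real n) b)"
      using Lpb_powers_quasiprimary_modes[OF a(1)] a(2) b(2) unfolding y_def quasiprimary_def by blast
    obtain k' where k': "(Lp ^^ m) (Y a ?r (?s + real n) b) = sc k' (Y a (?r + real m) (?s + real n) b)"
      using Lp_powers_quasiprimary_modes[OF a(1)] a(2) b(2) unfolding quasiprimary_def by blast
    have "(Lp ^^ m) ((Lpb ^^ n) y) = sc (k * k') (Y a (?r + real m) (?s + real n) b)"
      by (simp add: k Lp_powers_scale k')
    thus ?thesis using three_point(3)[OF a b c nz that] 
      by (simp add: f_def Y_left theta_simps algebra_simps)
  qed
  \<comment> \<open>\<open>Suc\<close> keeps the index 0 in the range of summation even when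
    \<open>K\<close> or \<open>K'\<close> is 0.\<close>
  have S: "\<forall>m\<ge>Suc K. (Lp ^^ m) y = 0" "\<forall>n\<ge>Suc K'. (Lpb ^^ n) y = 0" using K K' by auto
  have "form y c = parity h3 k3 * (\<Sum>n<Suc K'. \<Sum>m<Suc K. (1 / (fact m * fact n)) * f m n)"
    unfolding form_homogeneous[OF y] adjoint_double_sum[OF S] f_def by (simp only: theta_simps)
  also have "(\<Sum>n<Suc K'. \<Sum>m<Suc K. (1 / (fact m * fact n)) * f m n) = (\<Sum>n\<in>{0}. \<Sum>m<Suc K. (1 / (fact m * fact n)) * f m n)"
    by (rule sum.mono_neutral_right) (auto simp: f)
  also have "\<dots> = (\<Sum>m<Suc K. (1 / fact m) * f m 0)" by simp
  also have "\<dots> = (\<Sum>m\<in>{0}. (1 / fact m) * f m 0)"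
    by (rule sum.mono_neutral_right) (auto simp: f)
  also have "\<dots> = structure_constant (h1, k1) (h2, k2) (h3, k3) a b c"
    using three_point(1)[OF a b c nz] by (simp add: f_def y_def)
  finally show ?thesis by (simp add: y_def)
qed

text \<open>All modes at once, because commuting with \<open>Lm\<close> or \<open>Lp\<close> shifts
  \<open>r\<close>.\<close>

definition invariant_at :: "'a \<Rightarrow> real \<Rightarrow> real \<Rightarrow> 'a \<Rightarrow> 'a \<Rightarrow> bool" where
  "invariant_at a h hb b c \<longleftrightarrow> 
     (\<forall>r s. form (Y a (- r - 1) (- s - 1) b) c = form b (adjoint h hb a r s c))"

text \<open>Unless the weights match, both sides vanish. If they match, the sides are structure
  constants for \<open>(a, b, c)\<close> and \<open>(b, a, c)\<close>. Their relative sign is the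
  product of three parities; those of \<open>a\<close> and \<open>b\<close> cancel against the signs
  in the adjoint and in the form.\<close>

lemma invariant_quasiprimary:
  assumes a: "a \<in> F h1 k1" "quasiprimary a" and b: "b \<in> F h2 k2" "quasiprimary b" and c: "c \<in> F h3 k3" "quasiprimary c"
  shows "invariant_at a h1 k1 b c"
  unfolding invariant_at_def
proof (intro allI)
  fix r s
  consider "a = 0 \<or> b = 0 \<or> c = 0" | "a \<noteq> 0" "b \<noteq> 0" "c \<noteq> 0" "r = h3 - h1 - h2 \<and> s = k3 - k1 - k2"
    | "\<not> (r = h3 - h1 - h2 \<and> s = k3 - k1 - k2)" by blast
  thus "form (Y a (- r - 1) (- s - 1) b) c = form b (adjoint h1 k1 a r s c)"
  proof cases
    case 1
    thus ?thesis by (auto simp: Y_left Y_right form_left form_right adjoint_0_left adjoint_0_right)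
  next
    case 2
    have r: "- r - 1 = h1 + h2 - h3 - 1" "- s - 1 = k1 + k2 - k3 - 1" 
      "r + 2 * h1 - 1 = h1 + h3 - h2 - 1" "s + 2 * k1 - 1 = k1 + k3 - k2 - 1" using 2 by auto
    have par: "parity h1 k1 * parity h1 k1 = 1" "parity h2 k2 * parity h2 k2 = 1"
      using parity_steps(4) weight_diff_int[OF a(1) 2(1)] weight_diff_int[OF b(1) 2(2)] by auto
    have "form b (adjoint h1 k1 a r s c) = parity h1 k1 * parity h2 k2 * structure_constant (h2, k2) (h1, k1) (h3, k3) b a c"
      using a(2) unfolding form_quasiprimary_left[OF b] quasiprimary_def
      by (simp add: adjoint_quasiprimary r structure_constant_def Y_right theta_simps)
    also have "\<dots> = (parity h1 k1 * parity h1 k1) * (parity h2 k2 * parity h2 k2) * (parity h3 k3 * structure_constant (h1, k1) (h2, k2) (h3, k3) a b c)"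
      unfolding three_point(2)[OF a b c 2(1-3)] by (simp only: mult_ac)
    also have "\<dots> = form (Y a (- r - 1) (- s - 1) b) c"
      unfolding par r form_three_point[OF a b c 2(1-3)] by simp
    finally show ?thesis by simp
  next
    case 3
    have "form (Y a (- r - 1) (- s - 1) b) c = 0"
      by (rule form_weight[OF Y_weight[OF a(1) b(1)] c(1)]) (use 3 in auto)
    moreover have "form b (adjoint h1 k1 a r s c) = 0"
      by (rule form_weight[OF b(1) adjoint_weight[OF a(1) c(1)]]) (use 3 in auto)
    ultimately show ?thesis by simp
  qed
qed

text \<open>Contravariance turns \<open>Lm\<close> on \<open>c\<close> into \<open>Lp\<close> on the
  left-hand factor. As \<open>a\<close> and \<open>b\<close> are killed by \<open>Lp\<close>, this
  only shifts the mode of \<open>a\<close>, so the hypothesis for the same \<open>c\<close>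
  suffices.\<close>

lemma invariant_at_Lm_right:
  assumes a: "a \<in> F h hb" "Lp a = 0" and b: "Lp b = 0" and inv: "invariant_at a h hb b c"
  shows "invariant_at a h hb b (Lm c)"
  unfolding invariant_at_def
proof (intro allI)
  fix r s
  have "form (Y a (- r - 1) (- s - 1) b) (Lm c) = form (Lp (Y a (- r - 1) (- s - 1) b)) c"
    by (rule form_Lp_left[symmetric])
  also have "\<dots> = of_real (r + 2 * h - 1) * form (Y a (- (r - 1) - 1) (- s - 1) b) c"
    unfolding Lp_quasiprimary_comm[OF a b] by (simp add: form_left algebra_simps)
  also have "\<dots> = of_real (r + 2 * h - 1) * form b (adjoint h hb a (r - 1) s c)"
    by (simp only: inv[unfolded invariant_at_def, rule_format])
  also have "\<dots> = form b (adjoint h hb a r s (Lm c)) - form b (Lm (adjoint h hb a r s c))"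
    unfolding Lm_adjoint[OF a(1)] a(2) adjoint_0_left by (simp only: form_right) simp
  also have "form b (Lm (adjoint h hb a r s c)) = 0"
    unfolding form_Lp_left[symmetric] b by (rule form_left)
  finally show "form (Y a (- r - 1) (- s - 1) b) (Lm c) = form b (adjoint h hb a r s (Lm c))" by simp
qed

text \<open>Here contravariance produces \<open>Lp c\<close>, which is why invariance is assumed for
  every \<open>c\<close>.\<close>

lemma invariant_at_Lm_middle:
  assumes a: "a \<in> F h hb" and inv: "\<And>c. invariant_at a h hb b c"
  shows "invariant_at a h hb (Lm b) c"
  unfolding invariant_at_def
proof (intro allI)
  fix r s
  have "Y a (- r - 1) (- s - 1) (Lm b) = Lm (Y a (- r - 1) (- s - 1) b) - sc (of_real (r + 1)) (Y a (- (r + 1) - 1) (- s - 1) b)"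
    using Lm_comm[of a "- r - 1" "- s - 1" b] by (simp add: algebra_simps)
  hence "form (Y a (- r - 1) (- s - 1) (Lm b)) c = form (Y a (- r - 1) (- s - 1) b) (Lp c) 
      - of_real (r + 1) * form (Y a (- (r + 1) - 1) (- s - 1) b) c"
    by (simp only: form_left form_Lm_left)
  also have "\<dots> = form b (adjoint h hb a r s (Lp c)) - of_real (r + 1) * form b (adjoint h hb a (r + 1) s c)"
    by (simp only: inv[unfolded invariant_at_def, rule_format])
  also have "\<dots> = form b (Lp (adjoint h hb a r s c))"
    unfolding Lp_adjoint[OF a] by (simp only: form_right)
  also have "\<dots> = form (Lm b) (adjoint h hb a r s c)" by (rule form_Lm_left[symmetric])
  finally show "form (Y a (- r - 1) (- s - 1) (Lm b)) c = form (Lm b) (adjoint h hb a r s c)" .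
qed

lemma invariant_at_Lm_left:
  assumes a: "a \<in> F h hb" and inv: "invariant_at a h hb b c"
  shows "invariant_at (Lm a) (h + 1) hb b c"
  unfolding invariant_at_def
proof (intro allI)
  fix r s
  have "Y (Lm a) (- r - 1) (- s - 1) b = sc (of_real (r + 1)) (Y a (- (r + 1) - 1) (- s - 1) b)"
    using Lm_translation[of a "- r - 1" "- s - 1" b] by (simp add: algebra_simps)
  thus "form (Y (Lm a) (- r - 1) (- s - 1) b) c = form b (adjoint (h + 1) hb (Lm a) r s c)"
    using inv unfolding invariant_at_def by (simp only: form_left form_right adjoint_Lm[OF a])
qed

end

context fvoa_core begin

interpretation bar: fvoa_core sc "\<lambda>h hb. F hb h" "\<lambda>a r s. Y a s r" vac \<omega>b \<omega> by (rule swap)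

lemma invariant_at_bar: "a \<in> F h hb \<Longrightarrow> bar.invariant_at a hb h b c \<longleftrightarrow> invariant_at a h hb b c"
  unfolding bar.invariant_at_def invariant_at_def by (simp add: form_bar adjoint_bar) blast

lemma invariant_at_Lmb_right:
  "a \<in> F h hb \<Longrightarrow> Lpb a = 0 \<Longrightarrow> Lpb b = 0 \<Longrightarrow> invariant_at a h hb b c \<Longrightarrow> invariant_at a h hb b (Lmb c)"
  using bar.invariant_at_Lm_right[of a h hb b c] by (simp only: invariant_at_bar)

lemma invariant_at_Lmb_middle:
  "a \<in> F h hb \<Longrightarrow> (\<And>c. invariant_at a h hb b c) \<Longrightarrow> invariant_at a h hb (Lmb b) c"
  using bar.invariant_at_Lm_middle[of a h hb b c] by (simp only: invariant_at_bar)

lemma invariant_at_Lmb_left: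
  "a \<in> F h hb \<Longrightarrow> invariant_at a h hb b c \<Longrightarrow> invariant_at (Lmb a) h (hb + 1) b c"
  using bar.invariant_at_Lm_left[of a h hb b c] by (simp only: invariant_at_bar Lmb_weight)

text \<open>The order of the extensions is forced: descendants of \<open>c\<close> are reached while
  \<open>a\<close> and \<open>b\<close> are quasi-primary, descendants of \<open>b\<close> once all
  \<open>c\<close> are available, and those of \<open>a\<close> last.\<close>

lemma invariant_at_all:
  assumes "a \<in> F h1 k1"
  shows "invariant_at a h1 k1 b c"
proof -
  have add_c: "invariant_at a h k b (c + c')" if "invariant_at a h k b c" "invariant_at a h k b c'" for a h k b c c'
    using that unfolding invariant_at_def by (simp add: form_right adjoint_add_right)
  have add_b: "invariant_at a h k (b + b') c" if "invariant_at a h k b c" "invariant_at a h k b' c" for a h k b b' c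
    using that unfolding invariant_at_def by (simp add: form_left Y_right)
  have 1: "invariant_at a h1 k1 b c" if a: "a \<in> F h1 k1" "quasiprimary a" and b: "b \<in> F h2 k2" "quasiprimary b" for a b c h1 k1 h2 k2
  proof (induction c rule: homogeneous_induct)
    case (homogeneous h k c)
    show ?case
      using stable_family_F homogeneous
    proof (induction rule: quasiprimary_induct)
      case (quasiprimary h k w)
      thus ?case using a b by (intro invariant_quasiprimary)
    next
      case (Lm h k w)
      thus ?case using a b by (intro invariant_at_Lm_right) (auto simp: quasiprimary_def)
    next
      case (Lmb h k w)
      thus ?case using a b by (intro invariant_at_Lmb_right) (auto simp: quasiprimary_def)
    next
      case (add h k w x)
      thus ?case using add_c by blast
    next
      case (scale h k w t)
      thus ?case unfolding invariant_at_def by (simp add: form_right adjoint_scale_right)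
    qed
  qed (rule add_c)
  have 2: "invariant_at a h1 k1 b c" if a: "a \<in> F h1 k1" "quasiprimary a" for a b c h1 k1
  proof (induction b arbitrary: c rule: homogeneous_induct)
    case (homogeneous h k b)
    have "\<forall>c. invariant_at a h1 k1 b c"
      using stable_family_F homogeneous
    proof (induction rule: quasiprimary_induct)
      case (quasiprimary h k w)
      thus ?case using 1[OF a] by blast
    next
      case (Lm h k w)
      thus ?case using a(1) invariant_at_Lm_middle by blast
    next
      case (Lmb h k w)
      thus ?case using a(1) invariant_at_Lmb_middle by blast
    next
      case (add h k w x)
      thus ?case using add_b by blast
    next
      case (scale h k w t)
      thus ?case unfolding invariant_at_def by (simp add: form_left Y_right)
    qed
    thus ?case by blast
  qed (rule add_b)
  have "\<forall>b c. invariant_at a h1 k1 b c"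
    using stable_family_F assms
  proof (induction rule: quasiprimary_induct)
    case (quasiprimary h k w)
    thus ?case using 2 by blast
  next
    case (Lm h k w)
    thus ?case using invariant_at_Lm_left by blast
  next
    case (Lmb h k w)
    thus ?case using invariant_at_Lmb_left by blast
  next
    case (add h k w x)
    thus ?case unfolding invariant_at_def by (simp add: form_left form_right Y_left adjoint_add_left)
  next
    case (scale h k w t)
    thus ?case unfolding invariant_at_def by (simp add: form_left form_right Y_left adjoint_scale_left)
  qed
  thus ?thesis by blast
qed

section \<open>Symmetry of the form\<close>

lemma vac_quasiprimary: "quasiprimary vac"
proof -
  have "Lp vac = 0" "Lpb vac = 0"
    by (rule Y_vac; (auto simp: Nats_def; fail)?; simp add: Nats_altdef1)+
  thus ?thesis by (simp add: quasiprimary_def)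
qed

text \<open>With the vacuum as third vector the structure constant is a two-point function.
  Exchanging \<open>x\<close> and \<open>y\<close> costs the square of one parity, which is
  1.\<close>

lemma form_sym_quasiprimary:
  assumes x: "x \<in> F h k" "quasiprimary x" and y: "y \<in> F h' k'" "quasiprimary y"
  shows "form x y = form y x"
proof -
  consider "x = 0 \<or> y = 0" | "h \<noteq> h' \<or> k \<noteq> k'" | "x \<noteq> 0" "y \<noteq> 0" "h' = h" "k' = k" by blast
  thus ?thesis
  proof cases
    case 1
    thus ?thesis by (auto simp: form_left form_right)
  next
    case 2
    thus ?thesis using form_weight[OF x(1) y(1)] form_weight[OF y(1) x(1)] by auto
  next
    case 3
    have par: "parity h k * parity h k = 1" using parity_steps(4) weight_diff_int[OF x(1) 3(1)] by blast
    have "structure_constant (h, k) (h, k) (0, 0) y x vac = 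
        parity h k * parity h k * parity 0 0 * structure_constant (h, k) (h, k) (0, 0) x y vac"
      using three_point(2)[OF x y vac_weight vac_quasiprimary 3(1,2) vac_nonzero] 3(3,4) by simp
    hence "structure_constant (h, k) (h, k) (0, 0) y x vac = structure_constant (h, k) (h, k) (0, 0) x y vac"
      unfolding par by (simp add: parity_def)
    thus ?thesis using form_quasiprimary_left[OF x] form_quasiprimary_left[OF y] 3(3,4)
      by (simp add: structure_constant_def Y_vac_const)
  qed
qed

text \<open>It identifies the left and the right kernel of the form, so that one radical decides
  nondegeneracy on both sides.\<close>

lemma form_sym: "form x y = form y x"
proof -
  have 1: "form x y = form y x" if x: "x \<in> F h k" "quasiprimary x" for x y h k
  proof (induction y rule: homogeneous_induct)
    case (homogeneous h' k' y)
    have Lx: "Lp x = 0" "Lpb x = 0" using x by (auto simp: quasiprimary_def)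
    show ?case
      using stable_family_F homogeneous
    proof (induction rule: quasiprimary_induct)
      case (quasiprimary h k w)
      thus ?case using form_sym_quasiprimary x by blast
    next
      case (Lm h k w)
      thus ?case unfolding form_Lp_left[symmetric] form_Lm_left Lx by (simp add: form_left form_right)
    next
      case (Lmb h k w)
      thus ?case unfolding form_Lpb_left[symmetric] form_Lmb_left Lx by (simp add: form_left form_right)
    qed (simp_all add: form_left form_right)
  qed (simp add: form_left form_right)
  show ?thesis
  proof (induction x arbitrary: y rule: homogeneous_induct)
    case (homogeneous h k x)
    have "\<forall>y. form x y = form y x"
      using stable_family_F homogeneous
    proof (induction rule: quasiprimary_induct)
      case (quasiprimary h k w)
      thus ?case using 1 by blast
    next
      case (Lm h k w)
      thus ?case unfolding form_Lp_left[symmetric] form_Lm_left by simp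
    next
      case (Lmb h k w)
      thus ?case unfolding form_Lpb_left[symmetric] form_Lmb_left by simp
    qed (simp_all add: form_left form_right)
    thus ?case by blast
  qed (simp add: form_left form_right)
qed

section \<open>The radical as an ideal\<close>

definition radical :: "'a set" where
  "radical = {y. \<forall>x. form y x = 0}"

lemma radical_subspace: "subspace radical"
  unfolding radical_def by (intro subspaceI) (auto simp: form_left)

text \<open>Invariance moves the mode of \<open>a\<close> to the other argument, where
  \<open>y\<close> still pairs to zero.\<close>

lemma radical_left: 
  assumes "y \<in> radical"
  shows "Y a r s y \<in> radical"
proof (induction a rule: homogeneous_induct)
  case (homogeneous h k a)
  have "form (Y a r s y) c = 0" for c
  proof -
    have "form (Y a (- (- r - 1) - 1) (- (- s - 1) - 1) y) c = form y (adjoint h k a (- r - 1) (- s - 1) c)"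
      by (rule invariant_at_all[OF homogeneous, of y c, unfolded invariant_at_def, rule_format])
    thus ?thesis using assms by (simp add: radical_def)
  qed
  thus ?case by (simp add: radical_def)
qed (simp add: Y_left subspace_add[OF radical_subspace])

lemma radical_stable: "stable_family (\<lambda>h k. radical \<inter> F h k)"
  unfolding stable_family_def
  using radical_left subspace_inter[OF radical_subspace F_subspace] Lp_weight Lm_weight Lpb_weight Lmb_weight by blast

text \<open>Components of different weights are orthogonal, so pairing with a homogeneous vector
  sees a single component of \<open>y\<close>.\<close>

lemma radical_comp:
  assumes y: "y \<in> radical"
  shows "comp (h, k) y \<in> radical"
proof -
  have "form (comp (h, k) y) x = 0" for x
  proof (induction x rule: homogeneous_induct)
    case (homogeneous h' k' x)
    show ?case
    proof (cases "(h', k') = (h, k)")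
      case True
      have "form y x = (\<Sum>p | comp p y \<noteq> 0. form (comp p y) x)"
        using arg_cong[OF comp_props(3)[of y], of "\<lambda>y. form y x"] by (simp only: form_left)
      also have "\<dots> = (\<Sum>p\<in>{(h, k)}. form (comp p y) x)"
      proof (rule sum.mono_neutral_cong)
        show "finite {p. comp p y \<noteq> 0}" by (rule comp_props(2))
        show "form (comp p y) x = 0" if "p \<in> {p. comp p y \<noteq> 0} - {(h, k)}" for p
        proof -
          obtain h'' k'' where p: "p = (h'', k'')" by (cases p)
          show ?thesis unfolding p using that True p
            by (intro form_weight[OF comp_props(1) homogeneous]) auto
        qed
      qed (auto simp: form_left)
      finally show ?thesis using y by (simp add: radical_def)
    next
      case False
      thus ?thesis by (intro form_weight[OF comp_props(1) homogeneous]) auto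
    qed
  qed (simp add: form_right)
  thus ?thesis by (simp add: radical_def)
qed

text \<open>Instead of skew-symmetry, the structure constants are used: for quasi-primary
  \<open>y\<close>, \<open>a\<close>, \<open>c\<close> both \<open>form (Y y r s a) c\<close> and
  \<open>form y (Y a r' s' c)\<close>, at matching modes, are multiples of the same constant, the
  second by a sign, and it is zero for \<open>y\<close> in the radical. Descendants of
  \<open>c\<close>, of \<open>a\<close> and of \<open>y\<close> are then added in this
  order.\<close>

lemma radical_right:
  assumes y: "y \<in> radical"
  shows "Y y r s a \<in> radical"
proof -
  have 1: "form (Y y r s a) c = 0" if y: "y \<in> radical \<inter> F h1 k1" "quasiprimary y" and a: "a \<in> F h2 k2" "quasiprimary a" 
    and c: "c \<in> F h3 k3" for y a c r s h1 k1 h2 k2 h3 k3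
  proof -
    have Ly: "Lp y = 0" "Lpb y = 0" "Lp a = 0" "Lpb a = 0" "y \<in> F h1 k1" using y a by (auto simp: quasiprimary_def)
    have "\<forall>r s. form (Y y r s a) c = 0"
      using stable_family_F c
    proof (induction rule: quasiprimary_induct)
      case (quasiprimary h3 k3 c)
      show ?case
      proof (intro allI)
        fix r s
        consider "y = 0 \<or> a = 0 \<or> c = 0" | "y \<noteq> 0" "a \<noteq> 0" "c \<noteq> 0" "r = h1 + h2 - h3 - 1 \<and> s = k1 + k2 - k3 - 1"
          | "\<not> (r = h1 + h2 - h3 - 1 \<and> s = k1 + k2 - k3 - 1)" by blast
        thus "form (Y y r s a) c = 0"
        proof cases
          case 1
          thus ?thesis by (auto simp: Y_left Y_right form_left form_right)
        next
          case 2
          have par: "parity h1 k1 \<noteq> 0" using parity_steps(4)[OF weight_diff_int[OF Ly(5) 2(1)]] by auto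
          have "form y (Y a (h2 + h3 - h1 - 1) (k2 + k3 - k1 - 1) c) = parity h1 k1 * structure_constant (h1, k1) (h2, k2) (h3, k3) y a c"
            using form_quasiprimary_left[OF Ly(5) y(2)] by (simp add: structure_constant_def)
          hence "structure_constant (h1, k1) (h2, k2) (h3, k3) y a c = 0"
            using y(1) par by (simp add: radical_def)
          thus ?thesis using form_three_point[OF Ly(5) y(2) a quasiprimary 2(1-3)] 2(4) by simp
        next
          case 3
          thus ?thesis by (intro form_weight[OF Y_weight[OF Ly(5) a(1)] quasiprimary(1)]) auto
        qed
      qed
    next
      \<comment> \<open>Moving \<open>Lm\<close> to the left-hand argument raises the mode of
        \<open>y\<close> by one; the induction hypothesis covers all modes.\<close>
      case (Lm h k w)
      thus ?case unfolding form_Lp_left[symmetric] Lp_quasiprimary_comm[OF Ly(5,1,3)] by (simp add: form_left)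
    next
      case (Lmb h k w)
      thus ?case unfolding form_Lpb_left[symmetric] bar.Lp_quasiprimary_comm[OF Ly(5,2,4)] by (simp add: form_left)
    qed (simp_all add: form_right)
    thus ?thesis by blast
  qed
  have 2: "Y y r s a \<in> radical" if y: "y \<in> radical \<inter> F h1 k1" "quasiprimary y" for y a r s h1 k1
  proof (induction a rule: homogeneous_induct)
    case (homogeneous h2 k2 a)
    have "\<forall>r s. Y y r s a \<in> radical"
      using stable_family_F homogeneous
    proof (induction rule: quasiprimary_induct)
      case (quasiprimary h k w)
      have "form (Y y r s w) c = 0" for r s c
        by (induction c rule: homogeneous_induct) (use 1[OF y quasiprimary] in \<open>auto simp: form_right\<close>)
      thus ?case by (simp add: radical_def)
    next
      case (Lm h k w)
      show ?case
      proof (intro allI)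
        fix r s
        have "Y y r s (Lm w) = Lm (Y y r s w) - sc (of_real (- r)) (Y y (r - 1) s w)"
          using Lm_comm[of y r s w] by simp
        thus "Y y r s (Lm w) \<in> radical"
          using Lm.IH radical_left subspace_diff[OF radical_subspace] subspace_scale[OF radical_subspace] by metis
      qed
    next
      case (Lmb h k w)
      show ?case
      proof (intro allI)
        fix r s
        have "Y y r s (Lmb w) = Lmb (Y y r s w) - sc (of_real (- s)) (Y y r (s - 1) w)"
          using bar.Lm_comm[of y r s w] by simp
        thus "Y y r s (Lmb w) \<in> radical"
          using Lmb.IH radical_left subspace_diff[OF radical_subspace] subspace_scale[OF radical_subspace] by metis
      qed
    next
      case (add h k w x)
      thus ?case by (simp add: Y_right subspace_add[OF radical_subspace])
    next
      case (scale h k w t)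
      thus ?case by (simp add: Y_right subspace_scale[OF radical_subspace])
    qed
    thus ?case by blast
  next
    case (add v w)
    thus ?case by (simp add: Y_right subspace_add[OF radical_subspace])
  qed
  \<comment> \<open>The induction takes place inside the radical: \<open>radical_stable\<close>
    provides quasi-primary generators that lie in the radical themselves.\<close>
  have 3: "Y y r s a \<in> radical" if "y \<in> radical \<inter> F h k" for y r s h k
  proof -
    have "\<forall>r s. Y y r s a \<in> radical"
      using radical_stable that
    proof (induction rule: quasiprimary_induct)
      case (quasiprimary h k w)
      thus ?case using 2 by blast
    next
      case (Lm h k w)
      thus ?case by (simp add: Lm_translation subspace_scale[OF radical_subspace] subspace_neg[OF radical_subspace])
    next
      case (Lmb h k w)
      thus ?case by (simp add: bar.Lm_translation subspace_scale[OF radical_subspace] subspace_neg[OF radical_subspace])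
    next
      case (add h k w x)
      thus ?case by (simp add: Y_left subspace_add[OF radical_subspace])
    next
      case (scale h k w t)
      thus ?case by (simp add: Y_left subspace_scale[OF radical_subspace])
    qed
    thus ?thesis by blast
  qed
  have "Y y r s a = (\<Sum>p | comp p y \<noteq> 0. Y (comp p y) r s a)"
    using arg_cong[OF comp_props(3)[of y], of "\<lambda>y. Y y r s a"] by (simp only: Y_left)
  also have "\<dots> \<in> radical"
  proof (rule subspace_sum[OF radical_subspace])
    fix p :: "real \<times> real"
    obtain h k where p: "p = (h, k)" by (cases p)
    show "Y (comp p y) r s a \<in> radical"
      unfolding p using radical_comp[OF y] comp_props(1) by (intro 3) blast
  qed
  finally show ?thesis .
qed

lemma vac_not_in_radical: "vac \<notin> radical"
proof
  assume "vac \<in> radical"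
  hence "form vac vac = 0" by (simp add: radical_def)
  thus False using form_vac by simp
qed

end

section \<open>Passage between the two descriptions of the algebra and of the form\<close>

context fvoa_core begin

interpretation bar: fvoa_core sc "\<lambda>h hb. F hb h" "\<lambda>a r s. Y a s r" vac \<omega>b \<omega> by (rule swap)

text \<open>\<open>E\<close> stands for \<open>L1_exp\<close>, a constant of the original locale.
  The rectangle of indices shrinks to the support of \<open>E\<close>, since the other terms
  vanish.\<close>

lemma form_adjoint_sum:
  assumes a: "a \<in> F h hb" and E: "\<And>m n. E m n = sc (1 / (fact m * fact n)) ((Lp ^^ m) ((Lpb ^^ n) a))"
  shows "form b (adjoint h hb a r s c) = 
    (\<Sum>(m, n) | E m n \<noteq> 0. parity h hb * form b (Y (E m n) (r - real m + 2 * h - 1) (s - real n + 2 * hb - 1) c))"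
proof -
  obtain K where K: "\<forall>m\<ge>K. (Lp ^^ m) a = 0" using Lp_nilpotent[OF a] by blast
  obtain K' where K': "\<forall>n\<ge>K'. (Lpb ^^ n) a = 0" using Lpb_nilpotent[OF a] by blast
  define f where "f = (\<lambda>m n. parity h hb * form b (Y (E m n) (r - real m + 2 * h - 1) (s - real n + 2 * hb - 1) c))"
  have z: "E m n = 0" if "m \<ge> K \<or> n \<ge> K'" for m n
  proof (cases "n \<ge> K'")
    case True
    thus ?thesis using K' by (simp add: E Lp_powers_0)
  next
    case False
    hence "(Lpb ^^ n) ((Lp ^^ m) a) = 0" using K that by (simp add: bar.Lp_powers_0)
    thus ?thesis by (simp add: E Lpb_powers_Lp_powers)
  qed
  have "form b (adjoint h hb a r s c) = (\<Sum>n<K'. \<Sum>m<K. f m n)"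
    unfolding adjoint_double_sum[OF K K'] f_def E by (simp add: form_right Y_left sum_distrib_left)
  also have "\<dots> = (\<Sum>m<K. \<Sum>n<K'. f m n)" by (rule sum.swap)
  also have "\<dots> = (\<Sum>(m, n)\<in>{..<K} \<times> {..<K'}. f m n)" by (simp add: sum.cartesian_product)
  also have "\<dots> = (\<Sum>(m, n) | E m n \<noteq> 0. f m n)"
  proof (rule sum.mono_neutral_right)
    show "{(m, n). E m n \<noteq> 0} \<subseteq> {..<K} \<times> {..<K'}"
    proof
      fix p assume p: "p \<in> {(m, n). E m n \<noteq> 0}"
      obtain m n where mn: "p = (m, n)" by (cases p)
      have "\<not> (m \<ge> K \<or> n \<ge> K')" using p z[of m n] unfolding mn by blast
      thus "p \<in> {..<K} \<times> {..<K'}" by (simp add: mn)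
    qed
  qed (auto simp: f_def Y_left form_right)
  finally show ?thesis by (simp add: f_def)
qed

end

text \<open>PN3 speaks of integral second weights only, but that is no restriction: by
  \<open>FV2\<close> the spaces \<open>F 1 hb\<close> and \<open>F h 1\<close> are zero for the
  other weights. \<open>FV5\<close> enters through \<open>GCor2_correlator\<close>.\<close>

lemma fvoa_coreI:
  fixes sc :: "complex \<Rightarrow> 'a::ab_group_add \<Rightarrow> 'a"
  assumes FVOA: "full_vertex_operator_algebra sc F Y vac \<omega> \<omega>b"
    and PN1: "F 0 0 = {sc k vac | k. True}"
    and PN2: "\<And>n m. (\<exists>k::int. k < 0 \<and> n = of_int k / 2) \<or> (\<exists>k::int. k < 0 \<and> m = of_int k / 2)
                \<Longrightarrow> F n m = {0}"
    and PN3: "\<And>n::int. \<forall>v \<in> F 1 (of_int n). L_op Y \<omega> 1 v = 0"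
             "\<And>n::int. \<forall>v \<in> F (of_int n) 1. Lbar_op Y \<omega>b 1 v = 0"
    and vac: "vac \<noteq> 0"
  shows "fvoa_core sc F Y vac \<omega> \<omega>b"
proof -
  interpret full_vertex_operator_algebra sc F Y vac \<omega> \<omega>b by (rule FVOA)
  have series: "Vector_Spaces.linear sc sc (Y a r s)" "Y a r s \<noteq> 0 \<Longrightarrow> r - s \<in> \<int>" for a r s
  proof -
    note * = Y_series[of a, unfolded formal_series_def]
    from * have "Y a (- (- r - 1) - 1) (- (- s - 1) - 1) \<in> {T. Vector_Spaces.linear sc sc T}" by blast
    thus "Vector_Spaces.linear sc sc (Y a r s)" by simp
    assume "Y a r s \<noteq> 0"
    hence "Y a (- (- r - 1) - 1) (- (- s - 1) - 1) \<noteq> 0" by simp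
    with * have "(- r - 1) - (- s - 1) \<in> \<int>" by blast
    from Ints_minus[OF this] show "r - s \<in> \<int>" by simp
  qed
  have lin: "f 0 = 0" if "Vector_Spaces.linear sc sc f" for f
  proof -
    interpret Vector_Spaces.linear sc sc f by fact
    show ?thesis by (rule zero)
  qed
  have PN2': "F h hb = {0}" if "of_int k = 2 * h \<and> h < 0 \<or> of_int k = 2 * hb \<and> hb < 0" for k h hb
  proof (rule PN2)
    have "k < 0" using that by (smt (verit) of_int_0_le_iff)
    thus "(\<exists>k::int. k < 0 \<and> h = of_int k / 2) \<or> (\<exists>k::int. k < 0 \<and> hb = of_int k / 2)"
      using that by auto
  qed
  have vir: "L_op Y \<omega> = (\<lambda>n. Y \<omega> (of_int n + 1) (-1))" "Lbar_op Y \<omega>b = (\<lambda>n. Y \<omega>b (-1) (of_int n + 1))"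
    by (auto simp: L_op_def Lbar_op_def fun_eq_iff)
  show ?thesis
  proof unfold_locales
    show "graded_by sc F" by (rule grading)
    show "\<exists>N. \<forall>r s. N \<le> r \<or> N \<le> s \<longrightarrow> Y a r s b = 0" for a b by (rule FV1)
    show "r - s \<in> \<int>" if "Y a r s b \<noteq> 0" for a r s b using series(2)[of a r s] that by fastforce
    show "\<exists>g. correlator d e
         (\<lambda>r1 s1 r2 s2. u (Y a (- r1 - 1) (- s1 - 1) (Y b (- r2 - 1) (- s2 - 1) c)))
         (\<lambda>r0 s0 r2 s2. u (Y (Y a (- r0 - 1) (- s0 - 1) b) (- r2 - 1) (- s2 - 1) c))
         (\<lambda>r1 s1 r2 s2. u (Y b (- r2 - 1) (- s2 - 1) (Y a (- r1 - 1) (- s1 - 1) c))) g"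
      if "u \<in> restricted_dual sc F" "d - e \<in> \<int>" for u d e a b c
      using FV5[OF that(1)] GCor2_correlator[OF _ that(2)] by blast
    show "\<exists>c. virasoro sc c (\<lambda>n. Y \<omega> (of_int n + 1) (-1))" "\<exists>c. virasoro sc c (\<lambda>n. Y \<omega>b (-1) (of_int n + 1))"
      using virasoro_L virasoro_Lbar unfolding vir by blast+
    show "Y \<omega> (-1) (-2) vac = 0" "Y \<omega>b (-2) (-1) vac = 0"
      using Dbar_omega D_omegab unfolding D_op_def Dbar_op_def by blast+
    show "Y a (-2) (-1) vac = Y \<omega> 0 (-1) a" "Y a (-1) (-2) vac = Y \<omega>b (-1) 0 a" for a
      using fun_cong[OF D_eq, of a] fun_cong[OF Dbar_eq, of a] by (simp_all add: D_op_def Dbar_op_def L_op_def Lbar_op_def)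
    show "Y \<omega> 1 (-1) v = sc (of_real h) v" "Y \<omega>b (-1) 1 v = sc (of_real hb) v" if "v \<in> F h hb" for v h hb
      using L0[OF that] Lbar0[OF that] by (simp_all add: L_op_def Lbar_op_def)
    show "\<exists>N. \<forall>h hb. h \<le> N \<or> hb \<le> N \<longrightarrow> F h hb = {0}" by (rule bounded_below)
    show "F h hb = {0}" if "of_int k = 2 * h" "h < 0" for k h hb using that PN2' by blast
    show "F h hb = {0}" if "of_int k = 2 * hb" "hb < 0" for k h hb using that PN2' by blast
    show "Y \<omega> 2 (-1) v = 0" if "v \<in> F 1 hb" for v hb
    proof (cases "1 - hb \<in> \<int>")
      case True
      then obtain n where "1 - hb = of_int n" by (rule Ints_cases)
      hence "hb = of_int (1 - n)" by simp
      thus ?thesis using PN3(1)[of "1 - n"] that by (simp add: L_op_def)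
    next
      case False
      hence "v = 0" using FV2 that by blast
      thus ?thesis using lin[OF series(1)] by simp
    qed
    show "Y \<omega>b (-1) 2 v = 0" if "v \<in> F h 1" for v h
    proof (cases "h - 1 \<in> \<int>")
      case True
      then obtain n where "h - 1 = of_int n" by (rule Ints_cases)
      hence "h = of_int (n + 1)" by simp
      thus ?thesis using PN3(2)[of "n + 1"] that by (simp add: Lbar_op_def)
    next
      case False
      hence "v = 0" using FV2 that by blast
      thus ?thesis using lin[OF series(1)] by simp
    qed
    show "Y vac r s a = (if r = -1 \<and> s = -1 then a else 0)" for r s a by (rule FV4)
  qed (use series(1) Y_linear vac_weight vac FV2 FV3_series FV3_const FV6 PN1 in \<open>auto simp: Vector_Spaces.linear_iff\<close>)
qed

theorem corollary3p2:
  fixes sc :: "complex \<Rightarrow> 'a::ab_group_add \<Rightarrow> 'a"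
    and F :: "real \<Rightarrow> real \<Rightarrow> 'a set"
    and Y :: "'a \<Rightarrow> real \<Rightarrow> real \<Rightarrow> 'a \<Rightarrow> 'a"
    and vac \<omega> \<omega>b :: 'a
  assumes FVOA: "full_vertex_operator_algebra sc F Y vac \<omega> \<omega>b"
    and simple: "full_vertex_algebra.simple sc Y"
    and PN1: "F 0 0 = {sc k vac | k. True}"
    and PN2: "\<And>n m. (\<exists>k::int. k < 0 \<and> n = of_int k / 2) \<or> (\<exists>k::int. k < 0 \<and> m = of_int k / 2)
                \<Longrightarrow> F n m = {0}"
    and PN3: "\<And>n::int. \<forall>v \<in> F 1 (of_int n). L_op Y \<omega> 1 v = 0"
             "\<And>n::int. \<forall>v \<in> F (of_int n) 1. Lbar_op Y \<omega>b 1 v = 0"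
    and PN4: "\<And>n::int. \<forall>v \<in> F 0 (of_int n). L_op Y \<omega> (-1) v = 0"
             "\<And>n::int. \<forall>v \<in> F (of_int n) 0. Lbar_op Y \<omega>b (-1) v = 0"
  shows "full_vertex_operator_algebra.self_dual sc F Y \<omega> \<omega>b \<and>
         full_vertex_operator_algebra.QP_generated sc F Y \<omega> \<omega>b"
proof -
  interpret V: full_vertex_operator_algebra sc F Y vac \<omega> \<omega>b by (rule FVOA)
  have vs: "vector_space ((*) :: complex \<Rightarrow> complex \<Rightarrow> complex)"
    by unfold_locales (auto simp: algebra_simps)
  show ?thesis
  proof (cases "vac = 0")
    case True
    \<comment> \<open>\<open>Y vac\<close> has the identity as a coefficient and is linear in
      \<open>vac\<close>, so \<open>vac = 0\<close> leaves the zero space, where the zero form is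
      nondegenerate.\<close>
    have triv: "a = 0" for a :: 'a
    proof -
      interpret lin: Vector_Spaces.linear sc sc "\<lambda>v. Y v (-1) (-1) a" by (rule V.Y_linear)
      show ?thesis using V.FV4[of "-1" "-1" a] lin.zero True by simp
    qed
    have "V.bilinear_form (\<lambda>_ _. 0)"
      unfolding V.bilinear_form_def Vector_Spaces.linear_iff
      using vs V.vector_space_axioms by simp
    moreover have "V.invariant (\<lambda>_ _. 0)"
      unfolding V.invariant_def by (simp add: case_prod_unfold)
    moreover have "V.nondegenerate (\<lambda>_ _. 0)"
      unfolding V.nondegenerate_def using triv by blast
    moreover have "V.QP_generated" unfolding V.QP_generated_def
    proof (rule UNIV_eq_I[symmetric])
      fix v
      show "v \<in> V.span {(L_op Y \<omega> (- 1) ^^ m) ((Lbar_op Y \<omega>b (- 1) ^^ n) v) | m n v. v \<in> V.QF}"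
        unfolding triv[of v] by (rule V.span_zero)
    qed
    ultimately show ?thesis unfolding V.self_dual_def by blast
  next
    case False
    interpret C: fvoa_core sc F Y vac \<omega> \<omega>b by (rule fvoa_coreI[OF FVOA PN1 PN2 PN3 False])
    have L: "L_op Y \<omega> 1 = C.Lp" "L_op Y \<omega> (-1) = C.Lm" "Lbar_op Y \<omega>b 1 = C.Lpb" "Lbar_op Y \<omega>b (-1) = C.Lmb"
      by (simp_all add: L_op_def Lbar_op_def fun_eq_iff)
    \<comment> \<open>The two operators commute, so the recursion collapses to the binomial theorem;
      division by \<open>(m + n)!\<close> then splits the exponential into two factors.\<close>
    have L1_pow: "V.L1_pow m n v = sc (of_nat ((m + n) choose m)) ((C.Lp ^^ m) ((C.Lpb ^^ n) v))" for m n v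
    proof (induction m n v rule: V.L1_pow.induct)
      case (4 m n v)
      have "C.Lpb ((C.Lp ^^ k) w) = (C.Lp ^^ k) (C.Lpb w)" for k w
        by (induction k) (simp_all add: C.Lp_Lpb[symmetric])
      note comm = this
      have "V.L1_pow (Suc m) (Suc n) v = C.Lp (V.L1_pow m (Suc n) v) + C.Lpb (V.L1_pow (Suc m) n v)"
        by (simp only: V.L1_pow.simps L)
      also have "\<dots> = sc (of_nat ((m + Suc n) choose m)) (C.Lp ((C.Lp ^^ m) ((C.Lpb ^^ Suc n) v))) +
          sc (of_nat ((Suc m + n) choose Suc m)) ((C.Lp ^^ Suc m) (C.Lpb ((C.Lpb ^^ n) v)))"
        by (simp only: 4 C.Y_right(3) comm)
      also have "\<dots> = sc (of_nat ((m + Suc n) choose m)) ((C.Lp ^^ Suc m) ((C.Lpb ^^ Suc n) v)) +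
          sc (of_nat ((Suc m + n) choose Suc m)) ((C.Lp ^^ Suc m) ((C.Lpb ^^ Suc n) v))"
        by simp
      also have "\<dots> = sc (of_nat (((m + Suc n) choose m) + ((Suc m + n) choose Suc m))) ((C.Lp ^^ Suc m) ((C.Lpb ^^ Suc n) v))"
        by (simp only: V.scale_left_distrib of_nat_add)
      also have "((m + Suc n) choose m) + ((Suc m + n) choose Suc m) = (Suc m + Suc n) choose Suc m"
        by simp
      finally show ?case .
    qed (simp_all add: L C.Y_right)
    have L1_exp: "V.L1_exp m n v = sc (1 / (fact m * fact n)) ((C.Lp ^^ m) ((C.Lpb ^^ n) v))" for m n v
    proof -
      have "of_nat ((m + n) choose m) = (fact (m + n) / (fact m * fact n) :: complex)"
        using binomial_fact[of m "m + n"] by simp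
      thus ?thesis by (simp add: V.L1_exp_def L1_pow)
    qed
    have "V.QP_generated" unfolding V.QP_generated_def
    proof (rule UNIV_eq_I[symmetric])
      fix v
      show "v \<in> V.span {(L_op Y \<omega> (- 1) ^^ m) ((Lbar_op Y \<omega>b (- 1) ^^ n) v) | m n v. v \<in> V.QF}" (is "_ \<in> V.span ?S")
      proof (induction v rule: C.homogeneous_induct)
        case (homogeneous h hb v)
        have "{(C.Lm ^^ m) ((C.Lmb ^^ n) w) | m n w. w \<in> F (h - real m) (hb - real n) \<and> C.quasiprimary w} \<subseteq> ?S"
        proof clarify
          fix m n w assume "w \<in> F (h - real m) (hb - real n)" "C.quasiprimary w"
          hence "w \<in> V.QF_comp (h - real m) (hb - real n)" by (simp add: V.QF_comp_def C.quasiprimary_def L)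
          hence "w \<in> V.QF" unfolding V.QF_def by (intro V.span_base) blast
          thus "\<exists>m' n' v. (C.Lm ^^ m) ((C.Lmb ^^ n) w) = (L_op Y \<omega> (- 1) ^^ m') ((Lbar_op Y \<omega>b (- 1) ^^ n') v) \<and> v \<in> V.QF"
            unfolding L by blast
        qed
        thus ?case using C.quasiprimary_decomposition[OF C.stable_family_F homogeneous] V.span_mono by blast
      qed (rule V.span_add)
    qed
    moreover have "V.bilinear_form C.form"
      unfolding V.bilinear_form_def using C.form_linear by blast
    moreover have "V.invariant C.form"
      unfolding V.invariant_def
    proof (intro allI ballI)
      fix h hb a b c r s assume a: "a \<in> F h hb"
      show "C.form (Y a (- r - 1) (- s - 1) b) c = (\<Sum>(m, n) | V.L1_exp m n a \<noteq> 0. (- 1) powi \<lfloor>h - hb\<rfloor> *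
           C.form b (Y (V.L1_exp m n a) (r - real m + 2 * h - 1) (s - real n + 2 * hb - 1) c))"
        using C.invariant_at_all[OF a, of b c] C.form_adjoint_sum[OF a L1_exp, of b r s c]
        unfolding C.invariant_at_def parity_def by simp
    qed
    moreover have "V.nondegenerate C.form"
    proof -
      \<comment> \<open>An ideal requires formal Laurent series with coefficients in the radical.
        Countability and integrality of the support come from \<open>Y_series\<close>, the lower
        bound from \<open>FV1\<close>; only membership is special to the radical.\<close>
      have lower: "formal_laurent C.radical (\<lambda>r s. Y a (- r - 1) (- s - 1) v)" if "\<And>r s. Y a r s v \<in> C.radical" for a v
      proof -
        note * = V.Y_series[of a, unfolded formal_series_def]
        obtain N where N: "\<forall>r s. r \<ge> N \<or> s \<ge> N \<longrightarrow> Y a r s v = 0" using V.FV1 by blast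
        have "countable {(r, s). Y a (- r - 1) (- s - 1) v \<noteq> 0}"
        proof (rule countable_subset)
          show "{(r, s). Y a (- r - 1) (- s - 1) v \<noteq> 0} \<subseteq> {(r, s). Y a (- r - 1) (- s - 1) \<noteq> 0}" by auto
        qed (use * in blast)
        moreover have "r - s \<in> \<int>" if "Y a (- r - 1) (- s - 1) v \<noteq> 0" for r s
        proof -
          have "Y a (- r - 1) (- s - 1) \<noteq> 0" using that by auto
          thus ?thesis using * by blast
        qed
        moreover have "- N - 1 \<le> r \<and> - N - 1 \<le> s" if "Y a (- r - 1) (- s - 1) v \<noteq> 0" for r s
        proof -
          have "\<not> (- r - 1 \<ge> N \<or> - s - 1 \<ge> N)" using N that by blast
          thus ?thesis by linarith
        qed
        ultimately show ?thesis unfolding formal_laurent_def formal_series_def using that by blast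
      qed
      have "V.ideal C.radical"
        unfolding V.ideal_def using C.radical_subspace lower C.radical_left C.radical_right by blast
      moreover have "C.radical \<noteq> UNIV" using C.vac_not_in_radical by blast
      ultimately have rad: "C.radical = {0}" using simple unfolding V.simple_def by blast
      show ?thesis unfolding V.nondegenerate_def
      proof (intro conjI allI impI)
        show 1: "a = 0" if "\<forall>b. C.form a b = 0" for a using that rad unfolding C.radical_def by blast
        show "b = 0" if "\<forall>a. C.form a b = 0" for b using that 1[of b] C.form_sym by metis
      qed
    qed
    ultimately show ?thesis unfolding V.self_dual_def by blast
  qed
qed

end
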